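(* Let $n\ge 1$ be an integer, $1<p<2$ and $l>p$. Then for every $\theta>0$ the origin $(0,0)$ is regular (for the $p$-parabolic equation) with respect to $$\Theta_{l,\theta}=\{(x,t)\in\mathbf{R}^{n}\times\mathbf{R}: 0<-t<\theta|x|^l<\theta\}.$$
   Context: Let $n\ge1$ be an integer, $1<p<\infty$, and let $\Theta\subset\mathbf{R}^{n+1}$ be a nonempty bounded open set, with points written $(x,t)$, $x\in\mathbf{R}^n$, $t\in\mathbf{R}$. $\nabla$ and $\operatorname{div}$ are taken with respect to $x$ only, and $\partial\Theta$ is the full topological boundary. The $p$-parabolic equation is $\partial_t u-\Delta_p u=0$, where $\Delta_p u=\operatorname{div}(|\nabla u|^{p-2}\nabla u)$ (the heat equation if $p=2$). Solutions: $u:\Theta\to[-\infty,\infty]$ is a (weak) solution if for every open cylinder $U_{t_1,t_2}=U\times(t_1,t_2)\Subset\Theta$ we have $u\in C([t_1,t_2];L^2(U))\cap L^p(t_1,t_2;W^{1,p}(U))$ and $$\int_{t_1}^{t_2}\int_U|\nabla u|^{p-2}\nabla u\cdot\nabla\varphi\,dx\,dt-\int_{t_1}^{t_2}\int_U u\,\frac{\partial\varphi}{\partial t}\,dx\,dt=0\quad\text{for all }\varphi\in C_0^\infty(U_{t_1,t_2}).$$ A $p$-parabolic function is a continuous solution. Superparabolic functions: $u:\Theta\to(-\infty,\infty]$ is $p$-superparabolic if (i) $u$ is lower semicontinuous; (ii) $u$ is finite in a dense subset of $\Theta$; (iii) for every space-time box $Q_{t_1,t_2}=Q\times(t_1,t_2)\Subset\Theta$,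 $Q=(a_1,b_1)\times\dots\times(a_n,b_n)$, and every $h$ that is $p$-parabolic in $Q_{t_1,t_2}$, continuous on $\overline{Q_{t_1,t_2}}$ and satisfies $h\le u$ on the parabolic boundary $(\overline{Q}\times\{t_1\})\cup(\partial Q\times(t_1,t_2])$, we have $h\le u$ in $Q_{t_1,t_2}$. Perron solution: for bounded $f:\partial\Theta\to\mathbf{R}$, let $\mathcal{U}_f$ be the set of $p$-superparabolic $u$ on $\Theta$ with $\liminf_{\Theta\ni\eta\to\xi}u(\eta)\ge f(\xi)$ for all $\xi\in\partial\Theta$, and $\overline{H}_\Theta f(\xi)=\inf_{u\in\mathcal{U}_f}u(\xi)$ for $\xi\in\Theta$. Regularity: $\xi_0\in\partial\Theta$ is regular with respect to $\Theta$ if $\lim_{\Theta\ni\xi\to\xi_0}\overline{H}_\Theta f(\xi)=f(\xi_0)$ for all $f\in C(\partial\Theta)$; otherwise it is irregular. *)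

theory Defs
  imports "HOL-Analysis.Analysis"
begin

subsection \<open>Test functions\<close>

primrec Ck :: "nat \<Rightarrow> ('a::euclidean_space \<Rightarrow> real) \<Rightarrow> bool" where
  "Ck 0 f \<longleftrightarrow> continuous_on UNIV f"
| "Ck (Suc k) f \<longleftrightarrow>
     (\<forall>x. f differentiable (at x)) \<and> (\<forall>i\<in>Basis. Ck k (\<lambda>x. frechet_derivative f (at x) i))"

text \<open>The space of smooth functions with compact support in an open set, elements being extended
  by zero to the whole space.\<close>

definition test_functions :: "'a::euclidean_space set \<Rightarrow> ('a \<Rightarrow> real) set" where
  "test_functions V = {\<phi>. (\<forall>k. Ck k \<phi>) \<and>
     compact (closure {x. \<phi> x \<noteq> 0}) \<and> closure {x. \<phi> x \<noteq> 0} \<subseteq> V}"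

definition grad :: "(real ^ 'n \<Rightarrow> real) \<Rightarrow> real ^ 'n \<Rightarrow> real ^ 'n" where
  "grad f x = (\<chi> i. frechet_derivative f (at x) (axis i 1))"

subsection \<open>Function spaces\<close>

definition in_Lp :: "real \<Rightarrow> 'a::euclidean_space set \<Rightarrow> ('a \<Rightarrow> 'b::euclidean_space) \<Rightarrow> bool" where
  "in_Lp p S f \<longleftrightarrow> f \<in> borel_measurable (lebesgue_on S) \<and>
     integrable (lebesgue_on S) (\<lambda>x. norm (f x) powr p)"

text \<open>The function \<open>f\<close> is in \<open>W\<^sup>1\<^sup>,\<^sup>p(U)\<close> with distributional gradient \<open>g\<close>.\<close>

definition in_W1p :: "real \<Rightarrow> (real ^ 'n) set \<Rightarrow> (real ^ 'n \<Rightarrow> real) \<Rightarrow> (real ^ 'n \<Rightarrow> real ^ 'n) \<Rightarrow> bool"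
  where
  "in_W1p p U f g \<longleftrightarrow> in_Lp p U f \<and> in_Lp p U g \<and>
     (\<forall>\<phi>\<in>test_functions U. \<forall>i.
        (LINT x|lebesgue_on U. f x * grad \<phi> x $ i) = - (LINT x|lebesgue_on U. g x $ i * \<phi> x))"

text \<open>Membership of a space-time function in \<open>C([t1,t2]; L\<^sup>2(U))\<close>: the time slices are required to
  form a continuous curve for the given pointwise values, at every time.\<close>

definition in_C_L2 ::
  "(real ^ 'n) set \<Rightarrow> real \<Rightarrow> real \<Rightarrow> ((real ^ 'n) \<times> real \<Rightarrow> ereal) \<Rightarrow> bool" where
  "in_C_L2 U t1 t2 u \<longleftrightarrow>
     (\<forall>t\<in>{t1..t2}. (AE x in lebesgue_on U. \<bar>u (x, t)\<bar> \<noteq> \<infinity>) \<and>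
        in_Lp 2 U (\<lambda>x. real_of_ereal (u (x, t)))) \<and>
     (\<forall>t\<in>{t1..t2}.
        ((\<lambda>s. LINT x|lebesgue_on U. (real_of_ereal (u (x, s)) - real_of_ereal (u (x, t)))\<^sup>2)
          \<longlongrightarrow> 0) (at t within {t1..t2}))"

text \<open>Membership of \<open>u\<close> in \<open>L\<^sup>p(t1,t2; W\<^sup>1\<^sup>,\<^sup>p(U))\<close>, where \<open>G\<close> is the spatial weak gradient (unique almost everywhere).
  Measurability and integrability in time are expressed through the joint functions on
  \<open>U \<times> (t1,t2)\<close>.\<close>

definition in_Lp_W1p ::
  "real \<Rightarrow> (real ^ 'n) set \<Rightarrow> real \<Rightarrow> real \<Rightarrow> ((real ^ 'n) \<times> real \<Rightarrow> ereal) \<Rightarrow>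
     ((real ^ 'n) \<times> real \<Rightarrow> real ^ 'n) \<Rightarrow> bool" where
  "in_Lp_W1p p U t1 t2 u G \<longleftrightarrow>
     (AE z in lebesgue_on (U \<times> {t1<..<t2}). \<bar>u z\<bar> \<noteq> \<infinity>) \<and>
     in_Lp p (U \<times> {t1<..<t2}) (\<lambda>z. real_of_ereal (u z)) \<and>
     in_Lp p (U \<times> {t1<..<t2}) G \<and>
     (AE t in lebesgue_on {t1<..<t2}.
        in_W1p p U (\<lambda>x. real_of_ereal (u (x, t))) (\<lambda>x. G (x, t)))"

subsection \<open>The p-parabolic equation\<close>

definition compactly_inside :: "'a::topological_space set \<Rightarrow> 'a set \<Rightarrow> bool" where
  "compactly_inside V W \<longleftrightarrow> compact (closure V) \<and> closure V \<subseteq> W"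

text \<open>Where the gradient \<open>G\<close> vanishes, \<open>norm G powr (p - 2) *\<^sub>R G\<close> is zero, also for \<open>p < 2\<close>.\<close>

definition weak_solution ::
  "real \<Rightarrow> ((real ^ 'n) \<times> real) set \<Rightarrow> ((real ^ 'n) \<times> real \<Rightarrow> ereal) \<Rightarrow> bool" where
  "weak_solution p \<Theta> u \<longleftrightarrow>
     (\<forall>U t1 t2. open U \<and> t1 < t2 \<and> compactly_inside (U \<times> {t1<..<t2}) \<Theta> \<longrightarrow>
        in_C_L2 U t1 t2 u \<and>
        (\<exists>G. in_Lp_W1p p U t1 t2 u G \<and>
          (\<forall>\<phi>\<in>test_functions (U \<times> {t1<..<t2}).
             (LINT (x, t)|lebesgue_on (U \<times> {t1<..<t2}).
                (norm (G (x, t)) powr (p - 2) *\<^sub>R G (x, t)) \<bullet> grad (\<lambda>y. \<phi> (y, t)) x)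
           - (LINT (x, t)|lebesgue_on (U \<times> {t1<..<t2}).
                real_of_ereal (u (x, t)) * deriv (\<lambda>s. \<phi> (x, s)) t) = 0)))"

text \<open>Continuous functions are understood to be real-valued.\<close>

definition p_parabolic ::
  "real \<Rightarrow> ((real ^ 'n) \<times> real) set \<Rightarrow> ((real ^ 'n) \<times> real \<Rightarrow> real) \<Rightarrow> bool" where
  "p_parabolic p \<Theta> h \<longleftrightarrow> continuous_on \<Theta> h \<and> weak_solution p \<Theta> (\<lambda>z. ereal (h z))"

definition parabolic_boundary ::
  "(real ^ 'n) set \<Rightarrow> real \<Rightarrow> real \<Rightarrow> ((real ^ 'n) \<times> real) set" where
  "parabolic_boundary Q t1 t2 = closure Q \<times> {t1} \<union> frontier Q \<times> {t1<..t2}"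

definition superparabolic ::
  "real \<Rightarrow> ((real ^ 'n) \<times> real) set \<Rightarrow> ((real ^ 'n) \<times> real \<Rightarrow> ereal) \<Rightarrow> bool" where
  "superparabolic p \<Theta> u \<longleftrightarrow>
     (\<forall>z\<in>\<Theta>. u z \<noteq> -\<infinity>) \<and>
     (\<forall>z\<in>\<Theta>. u z \<le> Liminf (at z within \<Theta>) u) \<and>
     \<Theta> \<subseteq> closure {z\<in>\<Theta>. \<bar>u z\<bar> \<noteq> \<infinity>} \<and>
     (\<forall>a b t1 t2 h.
        (\<forall>i. a $ i < b $ i) \<and> t1 < t2 \<and>
        compactly_inside (box a b \<times> {t1<..<t2}) \<Theta> \<and>
        p_parabolic p (box a b \<times> {t1<..<t2}) h \<and>
        continuous_on (closure (box a b \<times> {t1<..<t2})) h \<and>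
        (\<forall>z\<in>parabolic_boundary (box a b) t1 t2. ereal (h z) \<le> u z) \<longrightarrow>
        (\<forall>z\<in>box a b \<times> {t1<..<t2}. ereal (h z) \<le> u z))"

subsection \<open>Perron solutions and boundary regularity\<close>

definition upper_class ::
  "real \<Rightarrow> ((real ^ 'n) \<times> real) set \<Rightarrow> ((real ^ 'n) \<times> real \<Rightarrow> real) \<Rightarrow>
     ((real ^ 'n) \<times> real \<Rightarrow> ereal) set" where
  "upper_class p \<Theta> f =
     {u. superparabolic p \<Theta> u \<and> (\<forall>\<xi>\<in>frontier \<Theta>. ereal (f \<xi>) \<le> Liminf (at \<xi> within \<Theta>) u)}"

definition upper_Perron ::
  "real \<Rightarrow> ((real ^ 'n) \<times> real) set \<Rightarrow> ((real ^ 'n) \<times> real \<Rightarrow> real) \<Rightarrow> (real ^ 'n) \<times> real \<Rightarrow> ereal"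
  where
  "upper_Perron p \<Theta> f \<xi> = (INF u\<in>upper_class p \<Theta> f. u \<xi>)"

definition regular_point ::
  "real \<Rightarrow> ((real ^ 'n) \<times> real) set \<Rightarrow> (real ^ 'n) \<times> real \<Rightarrow> bool" where
  "regular_point p \<Theta> \<xi>0 \<longleftrightarrow> \<xi>0 \<in> frontier \<Theta> \<and>
     (\<forall>f. continuous_on (frontier \<Theta>) f \<longrightarrow>
        (upper_Perron p \<Theta> f \<longlongrightarrow> ereal (f \<xi>0)) (at \<xi>0 within \<Theta>))"

definition Theta_dom :: "real \<Rightarrow> real \<Rightarrow> ((real ^ 'n) \<times> real) set" where
  "Theta_dom l \<theta> = {(x, t). 0 < - t \<and> - t < \<theta> * norm x powr l \<and> \<theta> * norm x powr l < \<theta>}"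

end

theory Submission
  imports Defs
begin

text \<open>
  Put \<open>\<gamma> = p - \<alpha> (p - 1)\<close> with \<open>\<alpha>\<close> so small that \<open>\<alpha> + \<gamma> \<le> l\<close>. The function
  \<open>A (|x|\<^sup>\<alpha> + t |x|\<^sup>-\<^sup>\<gamma> / (2\<theta>))\<close> is a classical supersolution in the domain as soon as \<open>A\<close> is
  large: its time derivative is linear in \<open>A\<close>, while the p-Laplacian is homogeneous of degree
  \<open>p - 1 < 1\<close>. It lies between \<open>A |x|\<^sup>\<alpha> / 2\<close> and \<open>A |x|\<^sup>\<alpha>\<close>, so it is a barrier at the origin.

  To compare it with p-parabolic functions from above, and its negative with arbitrary
  superparabolic functions from below, only the explicit solutions
  \<open>d - \<tau> t - K |x - c|\<^sup>p\<^sup>'\<close> with \<open>p' = p / (p - 1)\<close> are needed; their flux is affine in \<open>x\<close>. At a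
  hypothetical touching point such a solution, centred half way to the origin, fits strictly
  below the negative of the barrier, and the comparison property on a small box gives a
  contradiction. The comparison of a weak solution with an explicit one is the usual energy
  estimate; it is carried out on mollifications, so that translates of one smooth kernel are the
  only test functions.
\<close>

subsection \<open>Smooth kernels and integration by parts\<close>

text \<open>The exponent \<open>\<gamma>\<close> comes from scaling: the p-Laplacian of |x|^\<alpha>
  has order |x|^((\<alpha>-1)(p-1)-1) = |x|^(-\<gamma>), the power of |x| in the time derivative of
  the barrier, so only the factors A^(p-1) and A compete. The condition \<alpha>+\<gamma> \<le> l
  makes the time term at most half of |x|^\<alpha>; as \<alpha>+\<gamma> = p + \<alpha>(2-p), a
  positive \<alpha> exists because l > p. The obstacle is the lower bound: a member of the upper
  class is merely lower semicontinuous and reacts only to p-parabolic functions on boxes. The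
  explicit solutions are the intermediaries. Centring one at x0/2 makes its level sphere through x0
  internally tangent to |x| = |x0|, so contact happens at x0 alone; the price is curvature 2/|x0|,
  the origin of the factor 2 in the condition on A. Since the equation is odd, -h has the same
  comparison property for p-parabolic h, and one touching argument yields both barriers.\<close>

text \<open>The index \<open>m\<close> makes the family closed under differentiation: the derivative
  of \<open>flat m\<close> is a combination of \<open>flat (m + 2)\<close> and
  \<open>flat (m + 1)\<close>, so smoothness of exp(-1/s) becomes an induction inside the
  family.\<close>

definition flat :: "nat \<Rightarrow> real \<Rightarrow> real" where
  "flat m s = (if s \<le> 0 then 0 else exp (- 1 / s) / s ^ m)"

lemma flat_nonneg: "0 \<le> flat m s"
  by (auto simp: flat_def)

text \<open>A single term of the exponential series of 1/s already dominates (1/s)^(m+k).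
  Differentiability at 0 uses \<open>k = 2\<close>: one factor cancels against the difference
  quotient, the other tends to 0.\<close>

lemma flat_bound:
  assumes "0 < s"
  shows "flat m s \<le> fact (m + k) * s ^ k"
proof -
  let ?N = "m + k"
  obtain t where t: "exp (1 / s) = (\<Sum>j<Suc ?N. (1 / s) ^ j / fact j) + exp t / fact (Suc ?N) * (1 / s) ^ Suc ?N"
    using Maclaurin_exp_le by blast
  have "(1 / s) ^ ?N / fact ?N \<le> (\<Sum>j<Suc ?N. (1 / s) ^ j / fact j)"
    using assms by (intro member_le_sum) auto
  also have "\<dots> \<le> exp (1 / s)"
    using assms unfolding t by simp
  finally have "1 \<le> fact ?N * s ^ ?N * exp (1 / s)"
    using assms by (simp add: field_simps)
  then have "exp (- 1 / s) \<le> fact ?N * s ^ ?N"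
    using assms by (simp add: exp_minus field_simps)
  then show ?thesis
    using assms by (simp add: flat_def field_simps power_add)
qed

lemma flat_has_derivative:
  "(flat m has_real_derivative (flat (m + 2) s - real m * flat (m + 1) s)) (at s)"
proof -
  consider "s < 0" | "s = 0" | "s > 0" by linarith
  then show ?thesis
  proof cases
    case 1
    have "((\<lambda>s. 0) has_real_derivative 0) (at s)" by simp
    then have "(flat m has_real_derivative 0) (at s)"
      by (rule has_field_derivative_transform_within_open[of _ _ _ "{..<0}"]) (use 1 in \<open>auto simp: flat_def\<close>)
    then show ?thesis using 1 by (simp add: flat_def)
  next
    case 2
    have "((\<lambda>h. (flat m (0 + h) - flat m 0) / h) \<longlongrightarrow> 0) (at 0)"
    proof (rule tendsto_0_le[where K = 1])
      show "((\<lambda>h. fact (m + 2) * h) \<longlongrightarrow> 0) (at (0::real))" by (auto intro!: tendsto_eq_intros)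
      show "\<forall>\<^sub>F h in at 0. norm ((flat m (0 + h) - flat m 0) / h) \<le> norm (fact (m + 2) * h) * 1"
      proof (rule always_eventually, rule allI)
        fix h :: real
        show "norm ((flat m (0 + h) - flat m 0) / h) \<le> norm (fact (m + 2) * h) * 1"
        proof (cases "h > 0")
          case True
          have "flat m h / h \<le> fact (m + 2) * h ^ 2 / h"
            using True flat_bound[OF True, of m 2] by (intro divide_right_mono) auto
          then show ?thesis using True flat_nonneg[of m h]
            by (auto simp: flat_def[of m 0] power2_eq_square abs_mult)
        qed (auto simp: flat_def)
      qed
    qed
    then show ?thesis using 2 by (simp add: DERIV_def flat_def)
  next
    case 3
    have "((\<lambda>s. exp (- 1 / s) / s ^ m) has_real_derivative (flat (m + 2) s - real m * flat (m + 1) s)) (at s)"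
      using 3
      apply (auto intro!: derivative_eq_intros simp: flat_def)
      apply (cases m)
      apply (auto simp: field_simps power2_eq_square)
      done
    then show ?thesis
      by (rule has_field_derivative_transform_within_open[of _ _ _ "{0<..}"]) (use 3 in \<open>auto simp: flat_def\<close>)
  qed
qed

lemma Ck_SucI:
  assumes "\<And>x. (f has_derivative D x) (at x)" "\<And>i. i \<in> Basis \<Longrightarrow> Ck k (\<lambda>x. D x i)"
  shows "Ck (Suc k) f"
proof -
  have "frechet_derivative f (at x) = D x" for x
    using assms(1) frechet_derivative_at by metis
  then show ?thesis using assms by (auto simp: differentiable_def)
qed

lemma Ck_SucD:
  assumes "Ck (Suc k) f"
  shows "(f has_derivative frechet_derivative f (at x)) (at x)"
    "i \<in> Basis \<Longrightarrow> Ck k (\<lambda>x. frechet_derivative f (at x) i)"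
  using assms by (auto simp: frechet_derivative_works)

lemma Ck_continuous: "Ck k f \<Longrightarrow> continuous_on UNIV f"
proof (cases k)
  case (Suc j)
  assume "Ck k f"
  then show ?thesis using Suc
    by (auto intro!: differentiable_imp_continuous_on differentiable_at_imp_differentiable_on)
qed auto

lemma Ck_lower: "Ck (Suc k) f \<Longrightarrow> Ck k f"
proof (induction k arbitrary: f)
  case 0
  then show ?case using Ck_continuous by (metis Ck.simps(1))
next
  case (Suc k)
  then show ?case by (metis Ck.simps(2))
qed

lemma Ck_const: "Ck k (\<lambda>x. c)"
proof (induction k arbitrary: c)
  case (Suc k)
  show ?case
    by (rule Ck_SucI[where D = "\<lambda>x h. 0"]) (auto intro: Suc)
qed auto

lemma Ck_add:
  "Ck k f \<Longrightarrow> Ck k g \<Longrightarrow> Ck k (\<lambda>x. f x + g x)"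
proof (induction k arbitrary: f g)
  case 0
  then show ?case by (auto intro: continuous_intros)
next
  case (Suc k)
  show ?case
    by (rule Ck_SucI, rule has_derivative_add[OF Ck_SucD(1)[OF Suc.prems(1)] Ck_SucD(1)[OF Suc.prems(2)]])
      (intro Suc.IH Ck_SucD Suc.prems)
qed

lemma Ck_mult:
  "Ck k f \<Longrightarrow> Ck k g \<Longrightarrow> Ck k (\<lambda>x. f x * g x)"
proof (induction k arbitrary: f g)
  case 0
  then show ?case by (auto intro: continuous_intros)
next
  case (Suc k)
  show ?case
    by (rule Ck_SucI, rule has_derivative_mult[OF Ck_SucD(1)[OF Suc.prems(1)] Ck_SucD(1)[OF Suc.prems(2)]])
      (intro Ck_add Suc.IH Ck_SucD Suc.prems Ck_lower[OF Suc.prems(1)] Ck_lower[OF Suc.prems(2)])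
qed

lemma Ck_inner: "Ck k (\<lambda>x. x \<bullet> v)"
proof (cases k)
  case (Suc j)
  show ?thesis unfolding Suc
    by (rule Ck_SucI[where D = "\<lambda>x h. h \<bullet> v"])
      (auto intro!: derivative_eq_intros Ck_const)
qed (auto intro: continuous_intros)

lemma Ck_paraboloid: "Ck k (\<lambda>x. c - (x - a) \<bullet> (x - a))"
proof (cases k)
  case (Suc j)
  have *: "Ck j (\<lambda>x. x \<bullet> ((- 2) *\<^sub>R i) + 2 * (a \<bullet> i))" for i
    by (intro Ck_add Ck_inner Ck_const)
  show ?thesis unfolding Suc
    by (rule Ck_SucI[where D = "\<lambda>x h. h \<bullet> ((- 2) *\<^sub>R (x - a))"])
      (use * in \<open>auto intro!: derivative_eq_intros simp: inner_commute algebra_simps\<close>)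
qed (auto intro!: continuous_intros)

text \<open>The claim is proved for all \<open>m\<close> at once, since one derivative leads from
  \<open>m\<close> to \<open>m + 1\<close> and \<open>m + 2\<close>; the remaining factor is a
  derivative of \<open>g\<close>, which is again of every class.\<close>

lemma Ck_flat_comp:
  fixes g :: "'a::euclidean_space \<Rightarrow> real"
  assumes "\<And>k. Ck k g"
  shows "Ck k (\<lambda>x. flat m (g x))"
proof (induction k arbitrary: m)
  case 0
  have "continuous_on UNIV (flat m)"
    using DERIV_isCont[OF flat_has_derivative] by (simp add: continuous_at_imp_continuous_on)
  then show ?case using Ck_continuous[OF assms] 
    by (auto intro: continuous_on_compose2)
next
  case (Suc k)
  have g: "(g has_derivative frechet_derivative g (at x)) (at x)" for x
    using Ck_SucD(1)[OF assms] .
  have Ck: "Ck k (\<lambda>x. (flat (m + 2) (g x) + (- real m) * flat (m + 1) (g x)) * frechet_derivative g (at x) i)"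
    if "i \<in> Basis" for i
    by (intro Ck_mult Ck_add Suc.IH Ck_const Ck_SucD(2)[OF assms] that)
  show ?case
    by (rule Ck_SucI, rule has_derivative_compose[OF g], 
      rule flat_has_derivative[unfolded has_field_derivative_def])
      (use Ck in \<open>simp add: algebra_simps\<close>)
qed

section \<open>Integrals of derivatives of compactly supported functions\<close>

lemma integrable_continuous_compact_support:
  fixes f :: "'a::euclidean_space \<Rightarrow> real"
  assumes "continuous_on UNIV f" "compact K" "\<And>x. x \<notin> K \<Longrightarrow> f x = 0"
  shows "integrable lborel f"
proof -
  have "integrable lborel (\<lambda>x. indicator K x *\<^sub>R f x)"
    using assms by (intro borel_integrable_compact) (auto intro: continuous_on_subset)
  also have "(\<lambda>x. indicator K x *\<^sub>R f x) = f"
    using assms(3) by (auto simp: fun_eq_iff indicator_def)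
  finally show ?thesis .
qed

lemma lborel_integral_translate:
  fixes f :: "'a::euclidean_space \<Rightarrow> real"
  assumes "f \<in> borel_measurable borel"
  shows "(LINT x|lborel. f (x + a)) = integral\<^sup>L lborel f"
proof -
  have "integral\<^sup>L lborel f = integral\<^sup>L (distr lborel borel ((+) a)) f"
    by (simp only: lborel_distr_plus)
  also have "\<dots> = (LINT x|lborel. f (x + a))"
    using assms by (subst integral_distr) (auto simp: add.commute)
  finally show ?thesis by simp
qed

lemma integrable_indicator_bounded:
  fixes A :: "'a::euclidean_space set"
  assumes "bounded A" "A \<in> sets borel"
  shows "integrable lborel (\<lambda>x. c * indicator A x :: real)"
  using assms emeasure_bounded_finite[of A]
  by (intro integrable_mult_right integrable_real_indicator) auto

text \<open>Difference quotients along \<open>e\<close> have integral 0 by translation invariance of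
  \<open>lborel\<close>, and they converge dominatedly to the derivative. Every integration by parts
  in the development is this lemma applied to a product.\<close>

lemma integral_directional_derivative_eq_0:
  fixes \<psi> \<psi>' :: "'a::euclidean_space \<Rightarrow> real" and e :: 'a
  assumes d: "\<And>x. ((\<lambda>s. \<psi> (x + s *\<^sub>R e)) has_real_derivative \<psi>' x) (at 0)"
    and c: "continuous_on UNIV \<psi>" and c': "continuous_on UNIV \<psi>'"
    and K: "compact K" and z: "\<And>x. x \<notin> K \<Longrightarrow> \<psi> x = 0"
  shows "integral\<^sup>L lborel \<psi>' = 0"
proof -
  have dd: "((\<lambda>s. \<psi> (x + s *\<^sub>R e)) has_real_derivative \<psi>' (x + s *\<^sub>R e)) (at s)" for x s
    using d[of "x + s *\<^sub>R e"] DERIV_shift[of "\<lambda>s. \<psi> (x + s *\<^sub>R e)" _ 0 s]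
    by (simp add: algebra_simps)
  have z': "\<psi>' x = 0" if "x \<notin> K" for x
  proof -
    have "open (- K)" using K by (simp add: compact_imp_closed open_Compl)
    moreover have "continuous_on UNIV (\<lambda>s. x + s *\<^sub>R e)" by (intro continuous_intros)
    ultimately have "open ((\<lambda>s::real. x + s *\<^sub>R e) -` (- K))"
      by (intro open_vimage) auto
    then have "((\<lambda>s. \<psi> (x + s *\<^sub>R e)) has_real_derivative 0) (at 0)"
      by (intro has_field_derivative_transform_within_open[OF DERIV_const[of 0]]) (use that z in auto)
    then show ?thesis using d[of x] DERIV_unique by blast
  qed
  obtain r where r: "0 < r" "K \<subseteq> cball 0 r"
    using bounded_subset_ballD[OF compact_imp_bounded[OF K]] ball_subset_cball by (metis subset_trans)
  have "bounded (\<psi>' ` K)"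
    by (intro compact_imp_bounded compact_continuous_image K continuous_on_subset[OF c']) auto
  then obtain M where M: "\<And>x. x \<in> K \<Longrightarrow> \<bar>\<psi>' x\<bar> \<le> M"
    by (auto simp: bounded_iff)
  define L where "L = max M 0"
  have L: "\<bar>\<psi>' x\<bar> \<le> L" for x
    using M[of x] z'[of x] by (cases "x \<in> K") (auto simp: L_def)
  define h where "h k = 1 / real (Suc k)" for k
  have h: "0 < h k" "h k \<le> 1" for k by (auto simp: h_def)
  define q where "q k x = (\<psi> (x + h k *\<^sub>R e) - \<psi> x) / h k" for k x
  have i\<psi>: "integrable lborel \<psi>"
    by (rule integrable_continuous_compact_support[OF c K z])
  have m: "\<psi> \<in> borel_measurable borel" using c by (rule borel_measurable_continuous_onI)
  have q0: "integral\<^sup>L lborel (q k) = 0" for k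
  proof -
    have "integrable lborel (\<lambda>x. \<psi> (x + h k *\<^sub>R e))"
    proof (rule integrable_continuous_compact_support)
      show "continuous_on UNIV (\<lambda>x. \<psi> (x + h k *\<^sub>R e))"
        by (intro continuous_on_compose2[OF c] continuous_intros) auto
      show "compact ((+) (- (h k *\<^sub>R e)) ` K)" by (intro compact_translation K)
      show "\<psi> (x + h k *\<^sub>R e) = 0" if "x \<notin> (+) (- (h k *\<^sub>R e)) ` K" for x
        using that z[of "x + h k *\<^sub>R e"] by (force simp: image_iff)
    qed
    then show ?thesis
      unfolding q_def using i\<psi> lborel_integral_translate[OF m] by simp
  qed
  \<comment> \<open>The mean value theorem bounds the quotient by \<open>L\<close>. The radius grows
    by \<open>norm e\<close> because the steps are at most 1, so outside the larger ball both
    evaluation points miss \<open>K\<close>.\<close>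
  have bnd: "\<bar>q k x\<bar> \<le> L * indicator (cball 0 (r + norm e)) x" for k x
  proof (cases "x \<in> cball 0 (r + norm e)")
    case True
    have "\<exists>s>0. s < h k \<and> \<psi> (x + h k *\<^sub>R e) - \<psi> (x + 0 *\<^sub>R e) = (h k - 0) * \<psi>' (x + s *\<^sub>R e)"
      by (rule MVT2) (use h dd in auto)
    then show ?thesis
      using True L h[of k] by (auto simp: q_def abs_mult)
  next
    case False
    then have "norm x > r + norm e" by simp
    moreover have "norm (h k *\<^sub>R e) \<le> norm e"
      using h[of k] by (auto intro: mult_left_le_one_le)
    moreover have "norm x \<le> norm (x + h k *\<^sub>R e) + norm (h k *\<^sub>R e)"
      by (metis add_diff_cancel_right' norm_triangle_ineq4)
    ultimately have "x \<notin> K" "x + h k *\<^sub>R e \<notin> K"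
      using r norm_ge_zero[of e] by (smt (verit) mem_cball_0 subsetD)+
    then show ?thesis using z False by (simp add: q_def)
  qed
  have lim: "(\<lambda>k. q k x) \<longlonglongrightarrow> \<psi>' x" for x
  proof -
    have "h \<longlonglongrightarrow> 0" unfolding h_def by (rule LIMSEQ_Suc[OF lim_1_over_n])
    then have "filterlim h (at 0) sequentially"
      using h(1) by (auto simp: filterlim_at less_imp_neq[symmetric])
    moreover have "((\<lambda>s. (\<psi> (x + s *\<^sub>R e) - \<psi> x) / s) \<longlongrightarrow> \<psi>' x) (at 0)"
      using d[of x] by (simp add: DERIV_def)
    ultimately show ?thesis unfolding q_def
      by (rule filterlim_compose[rotated])
  qed
  have "(\<lambda>k. integral\<^sup>L lborel (q k)) \<longlonglongrightarrow> integral\<^sup>L lborel \<psi>'"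
  proof (rule integral_dominated_convergence)
    show "integrable lborel (\<lambda>x. L * indicator (cball 0 (r + norm e)) x)"
      by (rule integrable_indicator_bounded) auto
    show "\<psi>' \<in> borel_measurable lborel"
      using borel_measurable_continuous_onI[OF c'] by simp
    show "q k \<in> borel_measurable lborel" for k
      unfolding q_def using m by measurable
  qed (use lim bnd in auto)
  then show ?thesis
    using q0 LIMSEQ_unique[OF _ tendsto_const] by simp
qed

lemma integral_continuous_pos:
  fixes f :: "'a::euclidean_space \<Rightarrow> real"
  assumes f: "continuous_on UNIV f" "integrable lborel f" "\<And>x. 0 \<le> f x" and x0: "0 < f x0"
  shows "0 < integral\<^sup>L lborel f"
proof (rule ccontr)
  assume "\<not> 0 < integral\<^sup>L lborel f"
  moreover have "0 \<le> integral\<^sup>L lborel f" using f(3) by (intro integral_nonneg_AE) simp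
  ultimately have "integral\<^sup>L lborel f = 0" by simp
  then have ae: "AE x in lborel. f x = 0"
    using integral_nonneg_eq_0_iff_AE[OF f(2)] f(3) by auto
  have "open (f -` {0<..})" using f(1) by (intro open_vimage) auto
  then obtain r where r: "r > 0" "ball x0 r \<subseteq> f -` {0<..}"
    using x0 by (metis greaterThan_iff open_contains_ball vimageI)
  have "AE x in lborel. x \<notin> ball x0 r"
    using ae by eventually_elim (use r in auto)
  then have "emeasure lborel (ball x0 r) = 0"
    by (subst (asm) AE_iff_measurable[OF _ refl]) (auto simp: ball_def)
  then have "measure lborel (ball x0 r) = 0" by (simp add: measure_def)
  then show False using content_ball_pos[of r x0] r by simp
qed

section \<open>The standard mollifier\<close>

text \<open>This is exp(-1/(\<epsilon>^2 - |x|^2)) inside the ball and 0 outside. Using the squared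
  norm keeps the argument of \<open>flat\<close> polynomial, hence smooth at the centre too.\<close>

definition bump :: "real \<Rightarrow> 'a::euclidean_space \<Rightarrow> real" where
  "bump \<epsilon> x = flat 0 (\<epsilon>\<^sup>2 - x \<bullet> x)"

definition moll :: "real \<Rightarrow> 'a::euclidean_space \<Rightarrow> real" where
  "moll \<epsilon> x = bump \<epsilon> x / integral\<^sup>L lborel (bump \<epsilon> :: 'a \<Rightarrow> real)"

definition dmoll :: "real \<Rightarrow> 'a::euclidean_space \<Rightarrow> 'a \<Rightarrow> real" where
  "dmoll \<epsilon> e x = frechet_derivative (moll \<epsilon>) (at x) e"

lemma Ck_bump: "Ck k (\<lambda>x::'a::euclidean_space. bump \<epsilon> (x - a))"
  unfolding bump_def by (intro Ck_flat_comp Ck_paraboloid)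

lemma Ck_moll: "Ck k (\<lambda>x::'a::euclidean_space. moll \<epsilon> (x - a))"
  unfolding moll_def divide_inverse by (intro Ck_mult Ck_bump Ck_const)

lemma bump_nonneg: "0 \<le> bump \<epsilon> x"
  by (simp add: bump_def flat_nonneg)

lemma bump_eq_0: "\<epsilon> \<ge> 0 \<Longrightarrow> \<epsilon> \<le> norm x \<Longrightarrow> bump \<epsilon> x = 0"
  by (simp add: bump_def flat_def dot_square_norm)

lemma bump_pos: "\<epsilon> > 0 \<Longrightarrow> norm x < \<epsilon> \<Longrightarrow> bump \<epsilon> x > 0"
  using power_strict_mono[of "norm x" \<epsilon> 2]
  by (simp add: bump_def flat_def dot_square_norm)

lemma continuous_on_bump: "continuous_on UNIV (bump \<epsilon>)"
  using Ck_continuous[OF Ck_bump[of 0 \<epsilon> 0]] by simp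

lemma integrable_bump: "\<epsilon> > 0 \<Longrightarrow> integrable lborel (bump \<epsilon> :: 'a::euclidean_space \<Rightarrow> real)"
  by (rule integrable_continuous_compact_support[OF continuous_on_bump compact_cball[of 0 \<epsilon>]])
    (auto intro: bump_eq_0)

lemma integral_bump_pos:
  "\<epsilon> > 0 \<Longrightarrow> integral\<^sup>L lborel (bump \<epsilon> :: 'a::euclidean_space \<Rightarrow> real) > 0"
  by (rule integral_continuous_pos[where ?x0.0 = 0])
    (auto intro: continuous_on_bump integrable_bump bump_nonneg bump_pos)

lemma moll_nonneg: "0 \<le> moll \<epsilon> x"
  by (auto simp: moll_def bump_nonneg intro!: divide_nonneg_nonneg integral_nonneg_AE)

lemma moll_eq_0: "\<epsilon> > 0 \<Longrightarrow> \<epsilon> \<le> norm x \<Longrightarrow> moll \<epsilon> x = 0"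
  by (simp add: moll_def bump_eq_0)

lemma moll_minus: "moll \<epsilon> (- x) = moll \<epsilon> x"
  by (simp add: moll_def bump_def)

lemma moll_commute: "moll \<epsilon> (x - y) = moll \<epsilon> (y - x)"
  using moll_minus[of \<epsilon> "x - y"] by simp

lemma continuous_on_moll: "continuous_on UNIV (moll \<epsilon>)"
  using Ck_continuous[OF Ck_moll[of 0 \<epsilon> 0]] by simp

lemma borel_measurable_moll [measurable]: "moll \<epsilon> \<in> borel_measurable borel"
  using continuous_on_moll by (rule borel_measurable_continuous_onI)

lemma integral_moll: "\<epsilon> > 0 \<Longrightarrow> integral\<^sup>L lborel (moll \<epsilon> :: 'a::euclidean_space \<Rightarrow> real) = 1"
  using integral_bump_pos[of \<epsilon>, where 'a = 'a] by (simp add: moll_def[abs_def])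

lemma moll_has_derivative:
  "(moll \<epsilon> has_derivative (\<lambda>e. dmoll \<epsilon> e x)) (at x)"
  using Ck_SucD(1)[OF Ck_moll[of "Suc 0" \<epsilon> 0]] by (simp add: dmoll_def)

lemma continuous_on_dmoll: "e \<in> Basis \<Longrightarrow> continuous_on UNIV (dmoll \<epsilon> e)"
  using Ck_SucD(2)[OF Ck_moll[of "Suc 0" \<epsilon> 0]] by (simp add: dmoll_def)

lemma dmoll_eq_0:
  assumes "\<epsilon> > 0" "\<epsilon> < norm x"
  shows "dmoll \<epsilon> e x = 0"
proof -
  have "open (- cball (0::'a) \<epsilon>)" by (simp add: open_Compl)
  then have "(moll \<epsilon> has_derivative (\<lambda>e. 0)) (at x)"
    by (intro has_derivative_transform_within_open[OF has_derivative_const[of 0]])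
      (use assms in \<open>auto intro: moll_eq_0\<close>)
  then show ?thesis
    using has_derivative_unique[OF moll_has_derivative] by metis
qed

lemma moll_line_derivative:
  "((\<lambda>s. moll \<epsilon> (x + s *\<^sub>R e)) has_real_derivative dmoll \<epsilon> e x) (at 0)"
proof -
  have "((\<lambda>s::real. x + s *\<^sub>R e) has_derivative (\<lambda>s. s *\<^sub>R e)) (at 0)"
    by (auto intro!: derivative_eq_intros)
  moreover have "(moll \<epsilon> has_derivative (\<lambda>e. dmoll \<epsilon> e x)) (at (x + 0 *\<^sub>R e))"
    by (simp add: moll_has_derivative)
  ultimately have "((\<lambda>s. moll \<epsilon> (x + s *\<^sub>R e)) has_derivative (\<lambda>s. dmoll \<epsilon> (s *\<^sub>R e) x)) (at 0)"
    by (rule has_derivative_compose)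
  moreover have "dmoll \<epsilon> (s *\<^sub>R e) x = dmoll \<epsilon> e x * s" for s
    using linear_scale[OF has_derivative_linear[OF moll_has_derivative[of \<epsilon> x]]] by simp
  ultimately show ?thesis by (simp add: has_field_derivative_def)
qed

lemma moll_test_function:
  assumes "\<epsilon> > 0" "cball w \<epsilon> \<subseteq> V"
  shows "(\<lambda>z. moll \<epsilon> (z - w)) \<in> test_functions V"
proof -
  have "{z. moll \<epsilon> (z - w) \<noteq> 0} \<subseteq> cball w \<epsilon>"
    using moll_eq_0[OF assms(1), of "_ - w"] by (force simp: dist_norm norm_minus_commute)
  then have sub: "closure {z. moll \<epsilon> (z - w) \<noteq> 0} \<subseteq> cball w \<epsilon>"
    by (intro closure_minimal) auto
  then have "compact (closure {z. moll \<epsilon> (z - w) \<noteq> 0})"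
    by (meson bounded_cball bounded_subset closed_closure compact_eq_bounded_closed)
  then show ?thesis
    using sub assms(2) Ck_moll unfolding test_functions_def by blast
qed

text \<open>Weak gradients are defined slice by slice, so a time slice of the space-time kernel must
  itself be a test function. At fixed time it is again \<open>flat\<close> of a paraboloid, with
  \<epsilon>^2 lowered by the squared time distance.\<close>

lemma moll_slice_test_function:
  fixes w :: "'a::euclidean_space \<times> real"
  assumes "\<epsilon> > 0" "cball w \<epsilon> \<subseteq> U \<times> I"
  shows "(\<lambda>x. moll \<epsilon> ((x, t) - w)) \<in> test_functions U"
proof -
  let ?f = "\<lambda>x. moll \<epsilon> ((x, t) - w)"
  let ?S = "(\<lambda>x. (x, t)) -` cball w \<epsilon>"
  have "closed ?S"
    by (intro closed_vimage) (auto intro!: continuous_intros)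
  moreover have "{x. ?f x \<noteq> 0} \<subseteq> ?S"
    using moll_eq_0[OF assms(1), of "(_, t) - w"] by (force simp: dist_norm norm_minus_commute)
  ultimately have sub: "closure {x. ?f x \<noteq> 0} \<subseteq> ?S"
    by (rule closure_minimal[rotated])
  have "bounded (fst ` cball w \<epsilon>)"
    by (intro bounded_fst) auto
  moreover have "?S \<subseteq> fst ` cball w \<epsilon>" by force
  ultimately have "compact (closure {x. ?f x \<noteq> 0})"
    using sub by (meson bounded_subset closed_closure compact_eq_bounded_closed)
  moreover have "Ck k ?f" for k
  proof -
    have "?f = (\<lambda>x. flat 0 ((\<epsilon>\<^sup>2 - (t - snd w)\<^sup>2) - (x - fst w) \<bullet> (x - fst w)) *
        inverse (integral\<^sup>L lborel (bump \<epsilon> :: 'a \<times> real \<Rightarrow> real)))"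
      by (auto simp: moll_def bump_def fun_eq_iff inner_prod_def divide_inverse power2_eq_square algebra_simps
        minus_prod_def)
    then show ?thesis
      by (auto intro!: Ck_mult Ck_const Ck_flat_comp Ck_paraboloid)
  qed
  moreover have "?S \<subseteq> U" using assms(2) by auto
  ultimately show ?thesis
    using sub unfolding test_functions_def by blast
qed

section \<open>Integration by parts against test functions\<close>

text \<open>The definitions integrate over \<open>lebesgue_on V\<close>, whereas translation and
  Fubini are used on \<open>lborel\<close>; this lemma carries continuous, compactly supported
  integrands from one to the other.\<close>

lemma lebesgue_on_compact_support:
  fixes g :: "'a::euclidean_space \<Rightarrow> real"
  assumes "continuous_on UNIV g" "compact K" "K \<subseteq> V" "open V" "\<And>x. x \<notin> K \<Longrightarrow> g x = 0"
  shows "integrable (lebesgue_on V) g" "(LINT x|lebesgue_on V. g x) = (LINT x|lborel. g x)"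
proof -
  have V: "V \<in> sets lebesgue" using assms(4) by (simp add: borel_open)
  have eq: "(\<lambda>x. indicator V x * g x) = g"
    using assms(3,5) by (auto simp: indicator_def fun_eq_iff)
  have m: "g \<in> borel_measurable lborel"
    using borel_measurable_continuous_onI[OF assms(1)] by simp
  have "integrable lebesgue g"
    using integrable_continuous_compact_support[OF assms(1,2,5)] m by (simp add: integrable_completion)
  then show "integrable (lebesgue_on V) g"
    using V by (subst integrable_restrict_space) (auto simp: eq)
  show "(LINT x|lebesgue_on V. g x) = (LINT x|lborel. g x)"
    using V m by (subst integral_restrict_space) (auto simp: eq integral_completion)
qed

lemma test_functionsE:
  fixes \<phi> :: "'a::euclidean_space \<Rightarrow> real"
  assumes "\<phi> \<in> test_functions V"
  obtains K where "compact K" "K \<subseteq> V" "\<And>x. x \<notin> K \<Longrightarrow> \<phi> x = 0"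
    "\<And>x e. x \<notin> K \<Longrightarrow> frechet_derivative \<phi> (at x) e = 0"
    "continuous_on UNIV \<phi>" "\<And>x. (\<phi> has_derivative frechet_derivative \<phi> (at x)) (at x)"
    "\<And>e. e \<in> Basis \<Longrightarrow> continuous_on UNIV (\<lambda>x. frechet_derivative \<phi> (at x) e)"
proof -
  define K where "K = closure {x. \<phi> x \<noteq> 0}"
  have Ck: "Ck k \<phi>" for k
    using assms by (auto simp: test_functions_def)
  have K: "compact K" "K \<subseteq> V"
    using assms by (auto simp: test_functions_def K_def)
  have z: "\<phi> x = 0" if "x \<notin> K" for x
    using that closure_subset[of "{x. \<phi> x \<noteq> 0}"] by (auto simp: K_def)
  have d: "(\<phi> has_derivative frechet_derivative \<phi> (at x)) (at x)" for x
    using Ck_SucD(1)[OF Ck] .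
  have "open (- K)"
    using K by (simp add: compact_imp_closed open_Compl)
  then have z': "frechet_derivative \<phi> (at x) e = 0" if "x \<notin> K" for x e
  proof -
    have "(\<phi> has_derivative (\<lambda>e. 0)) (at x)"
      by (rule has_derivative_transform_within_open[OF has_derivative_const[of 0] \<open>open (- K)\<close>])
        (auto simp: that z)
    then show ?thesis using has_derivative_unique[OF d] by metis
  qed
  have c: "continuous_on UNIV (\<lambda>x. frechet_derivative \<phi> (at x) e)" if "e \<in> Basis" for e
    using Ck_SucD(2)[OF Ck that] by (rule Ck_continuous)
  show ?thesis
    by (rule that[OF K z z' Ck_continuous[OF Ck] d c])
qed

lemma has_derivative_line:
  assumes "(f has_derivative D) (at x)"
  shows "((\<lambda>s. f (x + s *\<^sub>R e)) has_real_derivative D e) (at 0)"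
proof -
  have "((\<lambda>s::real. x + s *\<^sub>R e) has_derivative (\<lambda>s. s *\<^sub>R e)) (at 0)"
    by (auto intro!: derivative_eq_intros)
  moreover have "(f has_derivative D) (at (x + 0 *\<^sub>R e))"
    using assms by simp
  ultimately have "((\<lambda>s. f (x + s *\<^sub>R e)) has_derivative (\<lambda>s. D (s *\<^sub>R e))) (at 0)"
    by (rule has_derivative_compose)
  moreover have "D (s *\<^sub>R e) = D e * s" for s
    using linear_scale[OF has_derivative_linear[OF assms]] by simp
  ultimately show ?thesis by (simp add: has_field_derivative_def)
qed

text \<open>The product of \<open>f\<close> and the test function has compact support, so its
  derivative along \<open>e\<close> integrates to 0.\<close>

lemma test_function_integration_by_parts:
  fixes f f' \<phi> :: "'a::euclidean_space \<Rightarrow> real"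
  assumes "\<phi> \<in> test_functions V" "open V" "e \<in> Basis"
    and f: "continuous_on UNIV f" "continuous_on UNIV f'"
      "\<And>x. ((\<lambda>s. f (x + s *\<^sub>R e)) has_real_derivative f' x) (at 0)"
  shows "(LINT x|lebesgue_on V. f x * frechet_derivative \<phi> (at x) e) = - (LINT x|lebesgue_on V. f' x * \<phi> x)"
    "integrable (lebesgue_on V) (\<lambda>x. f x * frechet_derivative \<phi> (at x) e)"
proof -
  obtain K where K: "compact K" "K \<subseteq> V" "\<And>x. x \<notin> K \<Longrightarrow> \<phi> x = 0"
    "\<And>x e. x \<notin> K \<Longrightarrow> frechet_derivative \<phi> (at x) e = 0"
    "continuous_on UNIV \<phi>" "\<And>x. (\<phi> has_derivative frechet_derivative \<phi> (at x)) (at x)"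
    "\<And>e. e \<in> Basis \<Longrightarrow> continuous_on UNIV (\<lambda>x. frechet_derivative \<phi> (at x) e)"
    by (rule test_functionsE[OF assms(1)]) blast
  let ?D = "\<lambda>x. frechet_derivative \<phi> (at x) e"
  have c: "continuous_on UNIV (\<lambda>x. f x * ?D x)" "continuous_on UNIV (\<lambda>x. f' x * \<phi> x)"
    by (intro continuous_on_mult f K assms)+
  note 1 = lebesgue_on_compact_support[OF c(1) K(1,2) assms(2)]
  note 2 = lebesgue_on_compact_support[OF c(2) K(1,2) assms(2)]
  have i: "integrable lborel (\<lambda>x. f x * ?D x)" "integrable lborel (\<lambda>x. f' x * \<phi> x)"
    using K by (auto intro!: integrable_continuous_compact_support[OF c(1) K(1)]
        integrable_continuous_compact_support[OF c(2) K(1)])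
  have "(LINT x|lborel. f x * ?D x + f' x * \<phi> x) = 0"
  proof (rule integral_directional_derivative_eq_0[where e = e, OF _ _ _ K(1)])
    show "((\<lambda>s. f (x + s *\<^sub>R e) * \<phi> (x + s *\<^sub>R e)) has_real_derivative f x * ?D x + f' x * \<phi> x) (at 0)" for x
      by (rule DERIV_cong[OF DERIV_mult[OF f(3)[of x] has_derivative_line[OF K(6)]]]) simp
  qed (use K c f in \<open>auto intro!: continuous_intros\<close>)
  then show "(LINT x|lebesgue_on V. f x * ?D x) = - (LINT x|lebesgue_on V. f' x * \<phi> x)"
    using i K by (subst 1(2) 2(2); simp)+
  show "integrable (lebesgue_on V) (\<lambda>x. f x * ?D x)"
    using K by (intro 1(1)) auto
qed

lemma in_Lp_continuous:
  fixes f :: "'a::euclidean_space \<Rightarrow> 'b::euclidean_space"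
  assumes "continuous_on UNIV f" "bounded U" "open U" "p \<ge> 0"
  shows "in_Lp p U f"
proof -
  have U: "U \<in> lmeasurable" using assms by (simp add: lmeasurable_open)
  have m: "f \<in> borel_measurable (lebesgue_on U)"
    using assms U by (intro continuous_imp_measurable_on_sets_lebesgue) (auto intro: continuous_on_subset)
  have "bounded (f ` closure U)"
    using assms by (intro compact_imp_bounded compact_continuous_image continuous_on_subset[OF assms(1)]) auto
  then obtain M where M: "\<And>x. x \<in> U \<Longrightarrow> norm (f x) \<le> M"
    using closure_subset unfolding bounded_iff by blast
  interpret finite_measure "lebesgue_on U"
    using U by (rule finite_measure_lebesgue_on)
  have "integrable (lebesgue_on U) (\<lambda>x. norm (f x) powr p)"
  proof (rule integrable_const_bound[where B = "M powr p"])
    show "AE x in lebesgue_on U. norm (norm (f x) powr p) \<le> M powr p"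
      using M assms(4) by (auto intro!: powr_mono2)
  qed (use m in measurable)
  then show ?thesis using m by (simp add: in_Lp_def)
qed

lemma norm_powr_has_derivative:
  fixes x :: "'a::euclidean_space"
  assumes "s > 1"
  shows "((\<lambda>x. norm x powr s) has_derivative (\<lambda>h. s * norm x powr (s - 2) * (x \<bullet> h))) (at x)"
proof (cases "x = 0")
  case True
  \<comment> \<open>At the origin the difference quotient is |h|^(s-1), which tends to 0 because s >
    1; the claimed derivative is 0 there since the inner product with x = 0 vanishes.\<close>
  have "((\<lambda>h::'a. norm h powr (s - 1)) \<longlongrightarrow> 0) (at 0)"
    using assms by (intro tendsto_eq_intros) (auto intro!: tendsto_eq_intros)
  then have "((\<lambda>h::'a. norm (norm h powr s - norm (0::'a) powr s - 0) / norm h) \<longlongrightarrow> 0) (at 0)"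
    by (rule Lim_transform_eventually)
      (auto simp: eventually_at powr_diff intro!: exI[of _ 1])
  then show ?thesis
    using True by (simp add: has_derivative_at2 has_derivative_at)
next
  case False
  have "((\<lambda>x. norm x powr s) has_derivative (\<lambda>h. s * norm x powr (s - 1) * (sgn x \<bullet> h))) (at x)"
    using False by (auto intro!: derivative_eq_intros has_derivative_norm simp: powr_diff field_simps inner_commute)
  moreover have "s * norm x powr (s - 1) * (sgn x \<bullet> h) = s * norm x powr (s - 2) * (x \<bullet> h)" for h
    using False by (simp add: sgn_div_norm powr_diff field_simps power2_eq_square)
  ultimately show ?thesis by simp
qed

subsection \<open>An explicit family of p-parabolic functions\<close>

lemma grad_slice:
  fixes \<phi> :: "(real ^ 'n) \<times> real \<Rightarrow> real"
  assumes "(\<phi> has_derivative D) (at (x, t))"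
  shows "grad (\<lambda>y. \<phi> (y, t)) x $ i = D (axis i 1, 0)"
proof -
  have "((\<lambda>y. (y, t)) has_derivative (\<lambda>h. (h, 0))) (at x)"
    by (auto intro!: derivative_eq_intros)
  then have "((\<lambda>y. \<phi> (y, t)) has_derivative (\<lambda>h. D (h, 0))) (at x)"
    by (rule has_derivative_compose) (use assms in simp)
  from frechet_derivative_at[OF this] show ?thesis
    by (simp add: grad_def) metis
qed

lemma deriv_slice:
  fixes \<phi> :: "'a::real_normed_vector \<times> real \<Rightarrow> real"
  assumes "(\<phi> has_derivative D) (at (x, t))"
  shows "deriv (\<lambda>s. \<phi> (x, s)) t = D (0, 1)"
proof -
  have "((\<lambda>s. (x, s)) has_derivative (\<lambda>h. (0, h))) (at t)"
    by (auto intro!: derivative_eq_intros)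
  then have "((\<lambda>s. \<phi> (x, s)) has_derivative (\<lambda>h. D (0, h))) (at t)"
    by (rule has_derivative_compose) (use assms in simp)
  moreover have "(\<lambda>h. D (0, h)) = (*) (D (0, 1))"
  proof
    fix h :: real
    show "D (0, h) = D (0, 1) * h"
      using linear_scale[OF has_derivative_linear[OF assms], of h "(0, 1)"] by simp
  qed
  ultimately have "((\<lambda>s. \<phi> (x, s)) has_real_derivative D (0, 1)) (at t)"
    by (simp only: has_field_derivative_def)
  then show ?thesis by (rule DERIV_imp_deriv)
qed

lemma axis_in_Basis_prod: "(axis i (1::real), 0::real) \<in> Basis" "(0 :: real ^ 'n, 1::real) \<in> Basis"
  by (auto simp: Basis_prod_def axis_in_Basis_iff)

text \<open>With the conjugate exponent p' = p/(p-1) one has (p'-1)(p-1) = 1, so the flux has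
  modulus proportional to |x-c|: it equals -k(x-c) with k = (K p')^(p-1). Its divergence is the
  constant -n k, which is therefore the coefficient of time.\<close>

definition expl :: "real \<Rightarrow> real \<Rightarrow> real ^ 'n \<Rightarrow> real \<Rightarrow> (real ^ 'n) \<times> real \<Rightarrow> real" where
  "expl p K c d z =
     d - real CARD('n) * (K * (p / (p - 1))) powr (p - 1) * snd z - K * norm (fst z - c) powr (p / (p - 1))"

definition expl_grad :: "real \<Rightarrow> real \<Rightarrow> real ^ 'n \<Rightarrow> real ^ 'n \<Rightarrow> real ^ 'n" where
  "expl_grad p K c x = - (K * (p / (p - 1)) * norm (x - c) powr (p / (p - 1) - 2)) *\<^sub>R (x - c)"

lemma expl_flux:
  fixes x c :: "real ^ 'n"
  assumes "1 < p" "K > 0"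
  shows "norm (expl_grad p K c x) powr (p - 2) *\<^sub>R expl_grad p K c x =
    - ((K * (p / (p - 1))) powr (p - 1)) *\<^sub>R (x - c)"
proof (cases "x = c")
  case False
  define q where "q = p / (p - 1)"
  define r where "r = norm (x - c)"
  define L where "L = K * q"
  have r: "r > 0" and L: "L > 0" using False assms by (auto simp: q_def r_def L_def)
  \<comment> \<open>The two identities say that the gradient has norm L r^(1/(p-1)) and that its
    power p-2 cancels the factor r^(q-2), leaving the flux linear in x - c.\<close>
  have q1: "(q - 2) + 1 = 1 / (p - 1)" and q2: "1 / (p - 1) * (p - 2) + (q - 2) = 0"
    using assms by (simp_all add: q_def field_simps)
  have eg: "expl_grad p K c x = - (L * r powr (q - 2)) *\<^sub>R (x - c)"
    by (simp add: expl_grad_def L_def q_def r_def)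
  have "norm (expl_grad p K c x) = L * (r powr (q - 2) * r powr 1)"
    using r L by (simp add: eg abs_mult r_def[symmetric])
  also have "\<dots> = L * r powr (1 / (p - 1))"
    by (simp only: powr_add[symmetric] q1)
  finally have "norm (expl_grad p K c x) powr (p - 2) * (L * r powr (q - 2)) =
      (L powr (p - 2) * L powr 1) * (r powr (1 / (p - 1) * (p - 2)) * r powr (q - 2))"
    using L r by (simp add: powr_mult powr_powr)
  also have "\<dots> = L powr (p - 1) * r powr 0"
    by (simp only: powr_add[symmetric] q2) simp
  finally have "norm (expl_grad p K c x) powr (p - 2) * (L * r powr (q - 2)) = L powr (p - 1)"
    using r by simp
  then show ?thesis
    unfolding eg[symmetric] L_def[symmetric] q_def[symmetric]
    by (subst (2) eg) (simp only: scaleR_scaleR mult_minus_right)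
qed (simp add: expl_grad_def)

lemma continuous_on_expl: "1 < p \<Longrightarrow> continuous_on S (expl p K c d)"
  unfolding expl_def by (intro continuous_intros continuous_on_powr') auto

text \<open>For p < 2 the exponent p/(p-1) - 2 is positive, so the power of the norm is continuous
  at the centre as well.\<close>

lemma continuous_on_expl_grad: "1 < p \<Longrightarrow> p < 2 \<Longrightarrow> continuous_on S (expl_grad p K c)"
  unfolding expl_grad_def
  by (intro continuous_intros continuous_on_powr') (auto simp: field_simps)

lemma expl_space_derivative:
  assumes "1 < p"
  shows "((\<lambda>s. expl p K c d (x + s *\<^sub>R axis i 1, t)) has_real_derivative expl_grad p K c x $ i) (at 0)"
proof -
  have "((\<lambda>x. x - c) has_derivative (\<lambda>h. h)) (at x)"
    by (auto intro!: derivative_eq_intros)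
  then have "((\<lambda>x. norm (x - c) powr (p / (p - 1))) has_derivative
      (\<lambda>h. p / (p - 1) * norm (x - c) powr (p / (p - 1) - 2) * ((x - c) \<bullet> h))) (at x)"
    by (rule has_derivative_compose[OF _ norm_powr_has_derivative]) (use assms in \<open>simp add: field_simps\<close>)
  from has_derivative_diff[OF has_derivative_const has_derivative_mult_right[OF this]]
  have "((\<lambda>x. expl p K c d (x, t)) has_derivative
      (\<lambda>h. 0 - K * (p / (p - 1) * norm (x - c) powr (p / (p - 1) - 2) * ((x - c) \<bullet> h)))) (at x)"
    unfolding expl_def fst_conv snd_conv .
  from has_derivative_line[OF this, of "axis i 1"] show ?thesis
    by (rule DERIV_cong) (simp add: expl_grad_def inner_axis)
qed

lemma expl_time_derivative:
  fixes c x :: "real ^ 'n"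
  shows "((\<lambda>s. expl p K c d (x, t + s)) has_real_derivative
    - (real CARD('n) * (K * (p / (p - 1))) powr (p - 1))) (at 0)"
  unfolding expl_def by (auto intro!: derivative_eq_intros)

text \<open>Each of the n spatial integrations by parts contributes k times the integral of the test
  function, and the single one in time contributes n k times it; both sides are the same multiple of
  that integral.\<close>

lemma expl_weak_identity:
  fixes c :: "real ^ 'n" and V :: "((real ^ 'n) \<times> real) set"
  assumes p: "1 < p" "K > 0" and V: "open V" and \<phi>: "\<phi> \<in> test_functions V"
  shows "(LINT (x, t)|lebesgue_on V.
        (norm (expl_grad p K c x) powr (p - 2) *\<^sub>R expl_grad p K c x) \<bullet> grad (\<lambda>y. \<phi> (y, t)) x)
      = (LINT (x, t)|lebesgue_on V. expl p K c d (x, t) * deriv (\<lambda>s. \<phi> (x, s)) t)"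
    (is "?L = ?R")
proof -
  let ?k = "(K * (p / (p - 1))) powr (p - 1)"
  obtain S where S: "compact S" "S \<subseteq> V" "\<And>x. x \<notin> S \<Longrightarrow> \<phi> x = 0"
    "\<And>x. (\<phi> has_derivative frechet_derivative \<phi> (at x)) (at x)"
    by (rule test_functionsE[OF \<phi>]) blast
  have 1: "(LINT z|lebesgue_on V. (- ?k * (fst z - c) $ i) * frechet_derivative \<phi> (at z) (axis i 1, 0)) =
      ?k * (LINT z|lebesgue_on V. \<phi> z)"
    "integrable (lebesgue_on V) (\<lambda>z. (- ?k * (fst z - c) $ i) * frechet_derivative \<phi> (at z) (axis i 1, 0))" for i
  proof -
    have d: "((\<lambda>s. - ?k * (fst (x + s *\<^sub>R (axis i 1, 0)) - c) $ i) has_real_derivative - ?k) (at 0)"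
      for x :: "(real ^ 'n) \<times> real"
      by (auto intro!: derivative_eq_intros simp: axis_def)
    have c: "continuous_on UNIV (\<lambda>z::(real ^ 'n) \<times> real. - ?k * (fst z - c) $ i)"
      by (intro continuous_intros)
    note * = test_function_integration_by_parts[OF \<phi> V axis_in_Basis_prod(1)[of i] c continuous_on_const d]
    show "(LINT z|lebesgue_on V. (- ?k * (fst z - c) $ i) * frechet_derivative \<phi> (at z) (axis i 1, 0)) =
      ?k * (LINT z|lebesgue_on V. \<phi> z)"
      using *(1) by simp
    show "integrable (lebesgue_on V) (\<lambda>z. (- ?k * (fst z - c) $ i) * frechet_derivative \<phi> (at z) (axis i 1, 0))"
      by (rule *(2))
  qed
  have "?L = (LINT z|lebesgue_on V. (\<Sum>i\<in>UNIV. (- ?k * (fst z - c) $ i) * frechet_derivative \<phi> (at z) (axis i 1, 0)))"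
    by (intro Bochner_Integration.integral_cong refl)
      (auto simp: expl_flux[OF p] inner_vec_def grad_slice[OF S(4)] case_prod_beta)
  also have "\<dots> = real CARD('n) * ?k * (LINT z|lebesgue_on V. \<phi> z)"
    using 1 by (subst Bochner_Integration.integral_sum) auto
  finally have L: "?L = real CARD('n) * ?k * (LINT z|lebesgue_on V. \<phi> z)" .
  have "((\<lambda>s. expl p K c d (z + s *\<^sub>R (0, 1))) has_real_derivative - (real CARD('n) * ?k)) (at 0)" for z
    using expl_time_derivative[of p K c d "fst z" "snd z"] by (cases z) simp
  from test_function_integration_by_parts(1)[OF \<phi> V axis_in_Basis_prod(2) continuous_on_expl[OF p(1)] continuous_on_const this]
  have "(LINT z|lebesgue_on V. expl p K c d z * frechet_derivative \<phi> (at z) (0, 1)) =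
      real CARD('n) * ?k * (LINT z|lebesgue_on V. \<phi> z)"
    by simp
  also have "(LINT z|lebesgue_on V. expl p K c d z * frechet_derivative \<phi> (at z) (0, 1)) = ?R"
    by (intro Bochner_Integration.integral_cong refl) (auto simp: deriv_slice[OF S(4)])
  finally show ?thesis using L by simp
qed

lemma bounded_fst_compactly_inside:
  fixes U :: "'a::real_normed_vector set"
  assumes "compactly_inside (U \<times> {t1<..<t2::real}) \<Theta>" "t1 < t2"
  shows "bounded U"
proof -
  have "bounded (U \<times> {t1<..<t2})"
    by (rule bounded_subset[OF compact_imp_bounded closure_subset])
      (use assms(1) in \<open>simp add: compactly_inside_def\<close>)
  then have "bounded (fst ` (U \<times> {t1<..<t2}))" by (rule bounded_fst)
  also have "fst ` (U \<times> {t1<..<t2}) = U" using assms(2) by (simp add: fst_image_times)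
  finally show ?thesis .
qed

lemma expl_in_W1p:
  assumes p: "1 < p" "p < 2" and U: "open U" "bounded U"
  shows "in_W1p p U (\<lambda>x. expl p K c d (x, t)) (expl_grad p K c)"
  unfolding in_W1p_def
proof (intro conjI ballI allI)
  have e: "continuous_on UNIV (\<lambda>x. expl p K c d (x, t))"
    by (intro continuous_on_compose2[OF continuous_on_expl[OF p(1), where S = UNIV]] continuous_intros) auto
  show "in_Lp p U (\<lambda>x. expl p K c d (x, t))" "in_Lp p U (expl_grad p K c)"
    using p U by (auto intro!: in_Lp_continuous e continuous_on_expl_grad)
  fix \<phi> i assume \<phi>: "\<phi> \<in> test_functions U"
  have "continuous_on UNIV (\<lambda>x. expl_grad p K c x $ i)"
    by (intro continuous_intros continuous_on_expl_grad p)
  from test_function_integration_by_parts(1)[OF \<phi> U(1) _ e this expl_space_derivative[OF p(1)]]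
  show "(LINT x|lebesgue_on U. expl p K c d (x, t) * grad \<phi> x $ i) =
      - (LINT x|lebesgue_on U. expl_grad p K c x $ i * \<phi> x)"
    by (simp add: grad_def axis_in_Basis_iff)
qed

lemma expl_weak_solution:
  fixes c :: "real ^ 'n"
  assumes p: "1 < p" "p < 2" and K: "K > 0"
  shows "weak_solution p \<Theta> (\<lambda>z. ereal (expl p K c d z))"
  unfolding weak_solution_def
proof (intro allI impI, elim conjE, intro conjI)
  fix U :: "(real ^ 'n) set" and t1 t2 :: real
  assume U: "open U" and t: "t1 < t2" and ci: "compactly_inside (U \<times> {t1<..<t2}) \<Theta>"
  let ?k = "real CARD('n) * (K * (p / (p - 1))) powr (p - 1)"
  have bU: "bounded U" using bounded_fst_compactly_inside[OF ci t] .
  have oV: "open (U \<times> {t1<..<t2})" using U by (intro open_Times) auto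
  have bV: "bounded (U \<times> {t1<..<t2})" using bU by (intro bounded_Times) auto
  have e: "continuous_on UNIV (\<lambda>x. expl p K c d (x, t))" for t
    by (intro continuous_on_compose2[OF continuous_on_expl[OF p(1), where S = UNIV]] continuous_intros) auto
  show "in_C_L2 U t1 t2 (\<lambda>z. ereal (expl p K c d z))"
    unfolding in_C_L2_def
  proof (intro conjI ballI)
    fix t assume "t \<in> {t1..t2}"
    show "in_Lp 2 U (\<lambda>x. real_of_ereal (ereal (expl p K c d (x, t))))"
      using U bU by (auto intro!: in_Lp_continuous e)
    \<comment> \<open>Two time slices of \<open>expl\<close> differ by a constant in x, so the
      squared L^2 distance is an explicit quadratic in s.\<close>
    have "(LINT x|lebesgue_on U. (real_of_ereal (ereal (expl p K c d (x, s))) - real_of_ereal (ereal (expl p K c d (x, t))))\<^sup>2)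
        = (?k * (t - s))\<^sup>2 * measure (lebesgue_on U) U" for s
    proof -
      have "expl p K c d (x, s) - expl p K c d (x, t) = ?k * (t - s)" for x
        by (simp add: expl_def algebra_simps)
      then show ?thesis by (simp add: space_restrict_space)
    qed
    moreover have "((\<lambda>s. (?k * (t - s))\<^sup>2 * measure (lebesgue_on U) U) \<longlongrightarrow>
        (?k * (t - t))\<^sup>2 * measure (lebesgue_on U) U) (at t within {t1..t2})"
      by (intro tendsto_intros)
    ultimately show "((\<lambda>s. LINT x|lebesgue_on U. (real_of_ereal (ereal (expl p K c d (x, s))) -
        real_of_ereal (ereal (expl p K c d (x, t))))\<^sup>2) \<longlongrightarrow> 0) (at t within {t1..t2})"
      by simp
  qed auto
  have G: "continuous_on UNIV (\<lambda>z. expl_grad p K c (fst z))"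
    by (intro continuous_on_compose2[OF continuous_on_expl_grad[OF p, where S = UNIV]] continuous_intros) auto
  show "\<exists>G. in_Lp_W1p p U t1 t2 (\<lambda>z. ereal (expl p K c d z)) G \<and>
    (\<forall>\<phi>\<in>test_functions (U \<times> {t1<..<t2}).
       (LINT (x, t)|lebesgue_on (U \<times> {t1<..<t2}).
           (norm (G (x, t)) powr (p - 2) *\<^sub>R G (x, t)) \<bullet> grad (\<lambda>y. \<phi> (y, t)) x) -
       (LINT (x, t)|lebesgue_on (U \<times> {t1<..<t2}).
           real_of_ereal (ereal (expl p K c d (x, t))) * deriv (\<lambda>s. \<phi> (x, s)) t) = 0)"
  proof (intro exI[of _ "\<lambda>z. expl_grad p K c (fst z)"] conjI ballI)
    show "in_Lp_W1p p U t1 t2 (\<lambda>z. ereal (expl p K c d z)) (\<lambda>z. expl_grad p K c (fst z))"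
      unfolding in_Lp_W1p_def
      using oV bV p expl_in_W1p[OF p U bU, of K c d]
      by (auto intro!: in_Lp_continuous G continuous_on_expl)
  qed (use expl_weak_identity[OF p(1) K oV, of _ c d] in simp)
qed

lemma expl_p_parabolic:
  assumes "1 < p" "p < 2" "K > 0"
  shows "p_parabolic p \<Theta> (expl p K c d)"
  unfolding p_parabolic_def by (intro conjI expl_weak_solution continuous_on_expl assms)

subsection \<open>Mollification\<close>

definition conv :: "real \<Rightarrow> ('a::euclidean_space \<Rightarrow> real) \<Rightarrow> 'a \<Rightarrow> real" where
  "conv \<epsilon> f w = (LINT z|lborel. f z * moll \<epsilon> (z - w))"

text \<open>The minus sign comes from differentiating \<open>moll \<epsilon> (z - w)\<close> in w
  rather than in z.\<close>

definition dconv :: "real \<Rightarrow> 'a \<Rightarrow> ('a::euclidean_space \<Rightarrow> real) \<Rightarrow> 'a \<Rightarrow> real" where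
  "dconv \<epsilon> e f w = - (LINT z|lborel. f z * dmoll \<epsilon> e (z - w))"

text \<open>A bridge to the gauge integral over a fixed box, to which continuity in a parameter and
  the Leibniz rule apply.\<close>

lemma lborel_integral_eq_cbox:
  fixes f :: "'a::euclidean_space \<Rightarrow> real"
  assumes "continuous_on UNIV f" "\<And>x. x \<notin> cbox a b \<Longrightarrow> f x = 0"
  shows "(LINT x|lborel. f x) = integral (cbox a b) f"
proof -
  have "integrable lborel f"
    using integrable_continuous_compact_support[OF assms(1) compact_cbox assms(2)] .
  then have "(LINT x|lborel. f x) = integral UNIV f"
    by (simp add: integral_lborel)
  also have "\<dots> = integral UNIV (\<lambda>x. if x \<in> cbox a b then f x else 0)"
    by (rule arg_cong[where f = "integral UNIV"]) (use assms(2) in auto)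
  finally show ?thesis by (simp add: integral_restrict_UNIV)
qed

lemma cball_subset_cbox:
  fixes w :: "'a::euclidean_space"
  obtains a where "cball w r \<subseteq> cbox (- a) a"
  using bounded_subset_cbox_symmetric[OF bounded_cball] by blast

text \<open>For w within distance 1 of w0 all shifted kernels live in one box, so the domain of
  integration does not move with w.\<close>

lemma continuous_on_kernel_integral:
  fixes u \<kappa> :: "'a::euclidean_space \<Rightarrow> real"
  assumes u: "continuous_on UNIV u" and \<kappa>: "continuous_on UNIV \<kappa>"
    and z: "\<And>x. \<epsilon> < norm x \<Longrightarrow> \<kappa> x = 0"
  shows "continuous_on UNIV (\<lambda>w. LINT z|lborel. u z * \<kappa> (z - w))"
proof (rule continuous_at_imp_continuous_on, rule ballI)
  fix w0 :: 'a
  obtain a where a: "cball w0 (\<epsilon> + 1) \<subseteq> cbox (- a) a"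
    by (rule cball_subset_cbox)
  have "continuous_on (ball w0 1) (\<lambda>w. integral (cbox (- a) a) (\<lambda>z. u z * \<kappa> (z - w)))"
    by (rule integral_continuous_on_param)
      (auto simp: case_prod_beta intro!: continuous_intros continuous_on_compose2[OF u] continuous_on_compose2[OF \<kappa>])
  also have "?this \<longleftrightarrow> continuous_on (ball w0 1) (\<lambda>w. LINT z|lborel. u z * \<kappa> (z - w))"
  proof (rule continuous_on_cong[OF refl])
    fix w assume w: "w \<in> ball w0 1"
    have "\<kappa> (x - w) = 0" if "x \<notin> cbox (- a) a" for x
    proof (rule z)
      have "dist w0 x > \<epsilon> + 1" using that a by force
      also have "dist w0 x \<le> dist w0 w + dist w x" by (rule dist_triangle)
      finally show "\<epsilon> < norm (x - w)" using w by (simp add: dist_norm norm_minus_commute)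
    qed
    then show "integral (cbox (- a) a) (\<lambda>z. u z * \<kappa> (z - w)) = (LINT z|lborel. u z * \<kappa> (z - w))"
      by (intro lborel_integral_eq_cbox[symmetric])
        (auto intro!: continuous_intros continuous_on_compose2[OF u] continuous_on_compose2[OF \<kappa>])
  qed
  finally show "isCont (\<lambda>w. LINT z|lborel. u z * \<kappa> (z - w)) w0"
    by (simp add: continuous_on_eq_continuous_at)
qed

lemma continuous_on_conv:
  "\<epsilon> > 0 \<Longrightarrow> continuous_on UNIV u \<Longrightarrow> continuous_on UNIV (conv \<epsilon> u)"
  unfolding conv_def
  by (rule continuous_on_kernel_integral[OF _ continuous_on_moll, where \<epsilon> = \<epsilon>]) (auto intro: moll_eq_0)

lemma continuous_on_dconv:
  "\<epsilon> > 0 \<Longrightarrow> e \<in> Basis \<Longrightarrow> continuous_on UNIV u \<Longrightarrow> continuous_on UNIV (dconv \<epsilon> e u)"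
  unfolding dconv_def
  by (rule continuous_on_minus, rule continuous_on_kernel_integral[OF _ continuous_on_dmoll, where \<epsilon> = \<epsilon>])
    (auto intro: dmoll_eq_0)

lemma conv_line_derivative:
  fixes u :: "'a::euclidean_space \<Rightarrow> real"
  assumes \<epsilon>: "\<epsilon> > 0" and e: "e \<in> Basis" and u: "continuous_on UNIV u"
  shows "((\<lambda>s. conv \<epsilon> u (w + s *\<^sub>R e)) has_real_derivative dconv \<epsilon> e u w) (at 0)"
proof -
  obtain a where a: "cball w (\<epsilon> + 1) \<subseteq> cbox (- a) a"
    by (rule cball_subset_cbox)
  let ?U = "{-1<..<1::real}"
  have out: "\<epsilon> < norm (x - (w + s *\<^sub>R e))" if "x \<notin> cbox (- a) a" "s \<in> ?U" for x s
  proof -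
    have "dist w x > \<epsilon> + 1" using that a by force
    also have "dist w x \<le> dist w (w + s *\<^sub>R e) + dist (w + s *\<^sub>R e) x" by (rule dist_triangle)
    also have "dist w (w + s *\<^sub>R e) = \<bar>s\<bar>" using e by (simp add: dist_norm)
    also have "dist (w + s *\<^sub>R e) x = norm (x - (w + s *\<^sub>R e))" by (metis dist_commute dist_norm)
    finally show ?thesis using that by auto
  qed
  have "((\<lambda>s. integral (cbox (- a) a) (\<lambda>z. u z * moll \<epsilon> (z - (w + s *\<^sub>R e)))) has_real_derivative
      integral (cbox (- a) a) (\<lambda>z. u z * - dmoll \<epsilon> e (z - (w + 0 *\<^sub>R e)))) (at 0 within ?U)"
  proof (rule leibniz_rule_field_derivative)
    fix s z
    \<comment> \<open>The kernel sees s only through -s e: the line derivative at the shifted point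
      is reflected, which produces the sign, and translated from 0 to s.\<close>
    have "((\<lambda>h. moll \<epsilon> (z - (w + s *\<^sub>R e) + h *\<^sub>R e)) has_real_derivative dmoll \<epsilon> e (z - (w + s *\<^sub>R e))) (at (- 0))"
      using moll_line_derivative by simp
    from DERIV_mirror[THEN iffD1, OF this]
    have "((\<lambda>h. moll \<epsilon> (z - (w + s *\<^sub>R e) + (- h) *\<^sub>R e)) has_real_derivative - dmoll \<epsilon> e (z - (w + s *\<^sub>R e))) (at 0)"
      by simp
    then have "((\<lambda>h. moll \<epsilon> (z - (w + (h + s) *\<^sub>R e))) has_real_derivative - dmoll \<epsilon> e (z - (w + s *\<^sub>R e))) (at 0)"
      by (simp add: algebra_simps)
    then have "((\<lambda>s. moll \<epsilon> (z - (w + s *\<^sub>R e))) has_real_derivative - dmoll \<epsilon> e (z - (w + s *\<^sub>R e))) (at s)"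
      using DERIV_shift[of "\<lambda>s. moll \<epsilon> (z - (w + s *\<^sub>R e))" _ 0 s] by simp
    from DERIV_cmult[OF this, of "u z"]
    show "((\<lambda>s. u z * moll \<epsilon> (z - (w + s *\<^sub>R e))) has_real_derivative u z * - dmoll \<epsilon> e (z - (w + s *\<^sub>R e))) (at s within ?U)"
      by (rule has_field_derivative_at_within)
  next
    show "(\<lambda>z. u z * moll \<epsilon> (z - (w + s *\<^sub>R e))) integrable_on cbox (- a) a" for s
      by (intro integrable_continuous continuous_intros continuous_on_compose2[OF u]
          continuous_on_compose2[OF continuous_on_moll]) auto
  next
    show "continuous_on (?U \<times> cbox (- a) a) (\<lambda>(s, z). u z * - dmoll \<epsilon> e (z - (w + s *\<^sub>R e)))"
      unfolding case_prod_beta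
      by (intro continuous_intros continuous_on_compose2[OF u]
          continuous_on_compose2[OF continuous_on_dmoll[OF e]]) auto
  qed auto
  also have "integral (cbox (- a) a) (\<lambda>z. u z * - dmoll \<epsilon> e (z - (w + 0 *\<^sub>R e))) = dconv \<epsilon> e u w"
  proof -
    have "dmoll \<epsilon> e (x - w) = 0" if "x \<notin> cbox (- a) a" for x
      using out[OF that, of 0] by (intro dmoll_eq_0 \<epsilon>) simp
    then have "(LINT z|lborel. u z * dmoll \<epsilon> e (z - w)) = integral (cbox (- a) a) (\<lambda>z. u z * dmoll \<epsilon> e (z - w))"
      by (intro lborel_integral_eq_cbox)
        (auto intro!: continuous_intros continuous_on_compose2[OF u] continuous_on_compose2[OF continuous_on_dmoll[OF e]])
    then show ?thesis by (simp add: dconv_def)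
  qed
  finally have "((\<lambda>s. integral (cbox (- a) a) (\<lambda>z. u z * moll \<epsilon> (z - (w + s *\<^sub>R e)))) has_real_derivative
      dconv \<epsilon> e u w) (at 0)"
    by (simp add: at_within_open[of 0 ?U])
  then show ?thesis
  proof (rule has_field_derivative_transform_within_open[of _ _ _ ?U])
    fix s assume s: "s \<in> ?U"
    show "integral (cbox (- a) a) (\<lambda>z. u z * moll \<epsilon> (z - (w + s *\<^sub>R e))) = conv \<epsilon> u (w + s *\<^sub>R e)"
      unfolding conv_def
    proof (rule lborel_integral_eq_cbox[symmetric])
      show "u x * moll \<epsilon> (x - (w + s *\<^sub>R e)) = 0" if "x \<notin> cbox (- a) a" for x
        using out[OF that s] \<epsilon> by (simp add: moll_eq_0)
    qed (auto intro!: continuous_intros continuous_on_compose2[OF u] continuous_on_compose2[OF continuous_on_moll])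
  qed auto
qed

lemma Fubini_kernel:
  fixes V \<eta> \<kappa> :: "'a::euclidean_space \<Rightarrow> real"
  assumes V: "integrable lborel V" and \<eta>: "integrable lborel \<eta>"
    and \<kappa>: "\<kappa> \<in> borel_measurable borel" "\<And>x. \<bar>\<kappa> x\<bar> \<le> M"
  shows "(LINT w|lborel. \<eta> w * (LINT z|lborel. V z * \<kappa> (z - w))) =
    (LINT z|lborel. V z * (LINT w|lborel. \<eta> w * \<kappa> (z - w)))"
    and "integrable lborel (\<lambda>w. \<eta> w * (LINT z|lborel. V z * \<kappa> (z - w)))"
proof -
  have [measurable]: "V \<in> borel_measurable borel" "\<eta> \<in> borel_measurable borel" "\<kappa> \<in> borel_measurable borel"
    using borel_measurable_integrable[OF V] borel_measurable_integrable[OF \<eta>] \<kappa> by auto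
  have "integrable (lborel \<Otimes>\<^sub>M lborel) (\<lambda>(w, z). \<eta> w * V z)"
  proof (rule lborel_pair.Fubini_integrable)
    show "integrable lborel (\<lambda>x. LINT y|lborel. norm (case (x, y) of (w, z) \<Rightarrow> \<eta> w * V z))"
      using \<eta> V by (simp add: abs_mult)
    show "AE x in lborel. integrable lborel (\<lambda>y. case (x, y) of (w, z) \<Rightarrow> \<eta> w * V z)"
      using V by simp
  qed measurable
  then have "integrable (lborel \<Otimes>\<^sub>M lborel) (\<lambda>x. M * (case x of (w, z) \<Rightarrow> \<eta> w * V z))"
    by (rule integrable_mult_right)
  then have i: "integrable (lborel \<Otimes>\<^sub>M lborel) (\<lambda>(w, z). \<eta> w * (V z * \<kappa> (z - w)))"
  proof (rule Bochner_Integration.integrable_bound)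
    show "AE x in lborel \<Otimes>\<^sub>M lborel. norm (case x of (w, z) \<Rightarrow> \<eta> w * (V z * \<kappa> (z - w))) \<le>
        norm (M * (case x of (w, z) \<Rightarrow> \<eta> w * V z))"
    proof (rule AE_I2, clarify)
      fix w z :: 'a
      have "\<bar>\<kappa> (z - w)\<bar> \<le> \<bar>M\<bar>" using \<kappa>(2)[of "z - w"] by linarith
      then have "\<bar>\<eta> w * V z\<bar> * \<bar>\<kappa> (z - w)\<bar> \<le> \<bar>\<eta> w * V z\<bar> * \<bar>M\<bar>"
        by (intro mult_left_mono) auto
      then show "norm (\<eta> w * (V z * \<kappa> (z - w))) \<le> norm (M * (\<eta> w * V z))"
        by (simp add: abs_mult mult_ac)
    qed
  qed measurable
  show "(LINT w|lborel. \<eta> w * (LINT z|lborel. V z * \<kappa> (z - w))) =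
    (LINT z|lborel. V z * (LINT w|lborel. \<eta> w * \<kappa> (z - w)))"
    unfolding integral_mult_right_zero[symmetric] lborel_pair.Fubini_integral[OF i, symmetric]
    by (simp only: mult.left_commute)
  show "integrable lborel (\<lambda>w. \<eta> w * (LINT z|lborel. V z * \<kappa> (z - w)))"
    using lborel_pair.integrable_fst[OF i] by simp
qed

lemma bounded_moll:
  assumes "\<epsilon> > 0"
  obtains M where "\<And>x. \<bar>moll \<epsilon> (x::'a::euclidean_space)\<bar> \<le> M"
proof -
  have "bounded (moll \<epsilon> ` cball (0::'a) \<epsilon>)"
    by (intro compact_imp_bounded compact_continuous_image continuous_on_subset[OF continuous_on_moll]) auto
  then obtain M where M: "\<And>x. x \<in> cball (0::'a) \<epsilon> \<Longrightarrow> \<bar>moll \<epsilon> x\<bar> \<le> M"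
    unfolding bounded_iff by (metis imageI real_norm_def)
  have "\<bar>moll \<epsilon> x\<bar> \<le> max M 0" for x :: 'a
    using M[of x] moll_eq_0[OF assms, of x] by (cases "norm x \<le> \<epsilon>") auto
  then show ?thesis by (rule that)
qed

lemma bounded_dmoll:
  assumes "\<epsilon> > 0" "e \<in> Basis"
  obtains M where "\<And>x. \<bar>dmoll \<epsilon> e (x::'a::euclidean_space)\<bar> \<le> M"
proof -
  have "bounded (dmoll \<epsilon> e ` cball (0::'a) \<epsilon>)"
    by (intro compact_imp_bounded compact_continuous_image continuous_on_subset[OF continuous_on_dmoll] assms) auto
  then obtain M where M: "\<And>x. x \<in> cball (0::'a) \<epsilon> \<Longrightarrow> \<bar>dmoll \<epsilon> e x\<bar> \<le> M"
    unfolding bounded_iff by (metis imageI real_norm_def)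
  have "\<bar>dmoll \<epsilon> e x\<bar> \<le> max M 0" for x :: 'a
    using M[of x] dmoll_eq_0[OF assms(1), of x e] by (cases "norm x \<le> \<epsilon>") auto
  then show ?thesis by (rule that)
qed

text \<open>Fubini moves the derivative from the mollifier to \<open>\<eta>\<close>.\<close>

lemma kernel_integration_by_parts:
  fixes V \<eta> \<eta>' :: "'a::euclidean_space \<Rightarrow> real"
  assumes \<epsilon>: "\<epsilon> > 0" and e: "e \<in> Basis" and V: "integrable lborel V"
    and \<eta>: "continuous_on UNIV \<eta>" "continuous_on UNIV \<eta>'" "compact S" "\<And>x. x \<notin> S \<Longrightarrow> \<eta> x = 0"
      "\<And>x. x \<notin> S \<Longrightarrow> \<eta>' x = 0"
      "\<And>x. ((\<lambda>s. \<eta> (x + s *\<^sub>R e)) has_real_derivative \<eta>' x) (at 0)"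
  shows "(LINT w|lborel. \<eta> w * (LINT z|lborel. V z * dmoll \<epsilon> e (z - w))) = (LINT w|lborel. \<eta>' w * conv \<epsilon> V w)"
proof -
  obtain M where M: "\<And>x. \<bar>moll \<epsilon> (x::'a)\<bar> \<le> M" by (rule bounded_moll[OF \<epsilon>]) blast
  obtain M' where M': "\<And>x. \<bar>dmoll \<epsilon> e (x::'a)\<bar> \<le> M'" by (rule bounded_dmoll[OF \<epsilon> e]) blast
  have i: "integrable lborel \<eta>" "integrable lborel \<eta>'"
    using integrable_continuous_compact_support \<eta> by blast+
  have dm: "dmoll \<epsilon> e \<in> borel_measurable borel"
    using continuous_on_dmoll[OF e] by (rule borel_measurable_continuous_onI)
  \<comment> \<open>For fixed z the product of \<eta> and w \<mapsto>
    \<open>moll \<epsilon> (z - w)\<close> is supported in S, and its derivative along e is the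
    difference of the two integrands.\<close>
  have key: "(LINT w|lborel. \<eta> w * dmoll \<epsilon> e (z - w)) = (LINT w|lborel. \<eta>' w * moll \<epsilon> (z - w))" for z
  proof -
    have c: "continuous_on UNIV (\<lambda>w. \<eta>' w * moll \<epsilon> (z - w))" "continuous_on UNIV (\<lambda>w. \<eta> w * dmoll \<epsilon> e (z - w))"
      by (auto intro!: continuous_intros \<eta> continuous_on_compose2[OF continuous_on_moll]
          continuous_on_compose2[OF continuous_on_dmoll[OF e]])
    have "(LINT w|lborel. \<eta>' w * moll \<epsilon> (z - w) - \<eta> w * dmoll \<epsilon> e (z - w)) = 0"
    proof (rule integral_directional_derivative_eq_0[where e = e, OF _ _ _ \<eta>(3)])
      fix x
      have "((\<lambda>h. moll \<epsilon> (z - x + h *\<^sub>R e)) has_real_derivative dmoll \<epsilon> e (z - x)) (at (- 0))"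
        using moll_line_derivative by simp
      from DERIV_mirror[THEN iffD1, OF this]
      have "((\<lambda>h. moll \<epsilon> (z - (x + h *\<^sub>R e))) has_real_derivative - dmoll \<epsilon> e (z - x)) (at 0)"
        by (simp add: algebra_simps)
      from DERIV_mult[OF \<eta>(6)[of x] this]
      show "((\<lambda>s. \<eta> (x + s *\<^sub>R e) * moll \<epsilon> (z - (x + s *\<^sub>R e))) has_real_derivative
          \<eta>' x * moll \<epsilon> (z - x) - \<eta> x * dmoll \<epsilon> e (z - x)) (at 0)"
        by (rule DERIV_cong) simp
    qed (use c \<eta> in \<open>auto intro!: continuous_intros continuous_on_compose2[OF continuous_on_moll]\<close>)
    moreover have "integrable lborel (\<lambda>w. \<eta>' w * moll \<epsilon> (z - w))" "integrable lborel (\<lambda>w. \<eta> w * dmoll \<epsilon> e (z - w))"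
      using \<eta> by (auto intro!: integrable_continuous_compact_support[OF c(1) \<eta>(3)]
        integrable_continuous_compact_support[OF c(2) \<eta>(3)])
    ultimately show ?thesis by simp
  qed
  show ?thesis
    unfolding conv_def Fubini_kernel(1)[OF V i(1) dm M'] Fubini_kernel(1)[OF V i(2) borel_measurable_moll M] key ..
qed

section \<open>L^p functions: Jensen's inequality, density, convergence of mollifications\<close>

text \<open>Functions instead of classes, and Borel instead of Lebesgue measurable, so that product
  measures of \<open>lborel\<close> can be used without passing to completions.\<close>

definition Lp_fun :: "real \<Rightarrow> ('a::euclidean_space \<Rightarrow> real) \<Rightarrow> bool" where
  "Lp_fun p f \<longleftrightarrow> f \<in> borel_measurable borel \<and> integrable lborel (\<lambda>x. \<bar>f x\<bar> powr p)"

text \<open>Young's inequality with its two weights, both below 1, dropped. Combined with a free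
  scaling it does the work of Hoelder's inequality later on.\<close>

lemma young_powr:
  fixes x y :: real
  assumes "1 < p" "0 \<le> x" "0 \<le> y"
  shows "x * y \<le> x powr (p / (p - 1)) + y powr p"
proof -
  have q: "p / (p - 1) > 1" "1 / (p / (p - 1)) + 1 / p = 1" using assms by (simp_all add: field_simps)
  have "x * y \<le> x powr (p / (p - 1)) / (p / (p - 1)) + y powr p / p"
    by (rule Youngs_inequality) (use assms q in auto)
  also have "x powr (p / (p - 1)) / (p / (p - 1)) \<le> x powr (p / (p - 1)) / 1"
    using q by (intro divide_left_mono) auto
  also have "y powr p / p \<le> y powr p / 1"
    using assms by (intro divide_left_mono) auto
  finally show ?thesis by simp
qed

lemma powr_add_le:
  fixes a b :: real
  assumes "0 \<le> a" "0 \<le> b" "0 \<le> p"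
  shows "(a + b) powr p \<le> 2 powr p * (a powr p + b powr p)"
proof -
  have "(a + b) powr p \<le> (2 * max a b) powr p"
    using assms by (intro powr_mono2) auto
  also have "\<dots> = 2 powr p * max a b powr p"
    by (rule powr_mult)
  also have "\<dots> \<le> 2 powr p * (a powr p + b powr p)"
    by (intro mult_left_mono) (auto simp: max_def)
  finally show ?thesis .
qed

text \<open>Weighted AM-GM for s^p and c^p, with the degenerate values 0 treated apart. It is the
  supporting line needed for Jensen's inequality.\<close>

lemma powr_tangent:
  fixes s c p :: real
  assumes "1 < p" "0 \<le> s" "0 \<le> c"
  shows "c powr p + p * c powr (p - 1) * (s - c) \<le> s powr p"
proof -
  have "p * s * c powr (p - 1) \<le> s powr p + (p - 1) * c powr p"
  proof (cases "s = 0 \<or> c = 0")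
    case True
    then show ?thesis using assms by auto
  next
    case False
    then have sc: "s > 0" "c > 0" using assms by auto
    have "(s powr p) powr (1 / p) * (c powr p) powr (1 - 1 / p) \<le> 1 / p * s powr p + (1 - 1 / p) * c powr p"
      using assms sc Youngs_inequality_0[of "1 / p" "1 - 1 / p" "s powr p" "c powr p"]
      by simp
    also have "(s powr p) powr (1 / p) * (c powr p) powr (1 - 1 / p) = s * c powr (p - 1)"
      using assms sc by (simp add: powr_powr right_diff_distrib)
    finally have "p * (s * c powr (p - 1)) \<le> p * (1 / p * s powr p + (1 - 1 / p) * c powr p)"
      using assms by (intro mult_left_mono) auto
    also have "\<dots> = s powr p + (p - 1) * c powr p"
      using assms by (simp add: field_simps)
    finally show ?thesis by (simp add: mult_ac)
  qed
  moreover have "c powr (p - 1) * c = c powr p"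
    using assms by (cases "c = 0") (auto simp: powr_diff)
  ultimately show ?thesis by (simp add: algebra_simps)
qed

lemma Lp_fun_diff:
  assumes "Lp_fun p f" "Lp_fun p g" "0 \<le> p"
  shows "Lp_fun p (\<lambda>x. f x - g x)"
    and "(LINT x|lborel. \<bar>f x - g x\<bar> powr p) \<le> 2 powr p * ((LINT x|lborel. \<bar>f x\<bar> powr p) + (LINT x|lborel. \<bar>g x\<bar> powr p))"
proof -
  have [measurable]: "f \<in> borel_measurable borel" "g \<in> borel_measurable borel"
    using assms by (auto simp: Lp_fun_def)
  have i: "integrable lborel (\<lambda>x. 2 powr p * (\<bar>f x\<bar> powr p + \<bar>g x\<bar> powr p))"
    using assms by (auto simp: Lp_fun_def)
  have le: "\<bar>f x - g x\<bar> powr p \<le> 2 powr p * (\<bar>f x\<bar> powr p + \<bar>g x\<bar> powr p)" for x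
    by (rule order_trans[OF powr_mono2 powr_add_le]) (use assms in auto)
  have j: "integrable lborel (\<lambda>x. \<bar>f x - g x\<bar> powr p)"
    using i by (rule Bochner_Integration.integrable_bound) (measurable, use le in \<open>auto intro: order_trans\<close>)
  then show "Lp_fun p (\<lambda>x. f x - g x)" by (simp add: Lp_fun_def)
  have "(LINT x|lborel. \<bar>f x - g x\<bar> powr p) \<le> (LINT x|lborel. 2 powr p * (\<bar>f x\<bar> powr p + \<bar>g x\<bar> powr p))"
    by (rule integral_mono[OF j i le])
  also have "\<dots> = 2 powr p * ((LINT x|lborel. \<bar>f x\<bar> powr p) + (LINT x|lborel. \<bar>g x\<bar> powr p))"
    using assms by (simp add: Lp_fun_def)
  finally show "(LINT x|lborel. \<bar>f x - g x\<bar> powr p) \<le> 2 powr p * ((LINT x|lborel. \<bar>f x\<bar> powr p) + (LINT x|lborel. \<bar>g x\<bar> powr p))" .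
qed

lemma integrable_mult_moll:
  fixes f :: "'a::euclidean_space \<Rightarrow> real"
  assumes "\<epsilon> > 0" "Lp_fun p f" "1 < p"
  shows "integrable lborel (\<lambda>z. f z * moll \<epsilon> (z - w))" "integrable lborel (\<lambda>z. \<bar>f z\<bar> powr p * moll \<epsilon> (z - w))"
    "integrable lborel (\<lambda>z. moll \<epsilon> (z - w))" "(LINT z|lborel. moll \<epsilon> (z - w)) = 1"
    "(LINT z|lborel. moll \<epsilon> (w - z)) = 1"
proof -
  obtain M where M: "\<And>x. \<bar>moll \<epsilon> (x::'a)\<bar> \<le> M" by (rule bounded_moll[OF assms(1)]) blast
  have [measurable]: "f \<in> borel_measurable borel" using assms by (auto simp: Lp_fun_def)
  have c: "continuous_on UNIV (\<lambda>z. moll \<epsilon> (z - w))"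
    by (auto intro!: continuous_on_compose2[OF continuous_on_moll] continuous_intros)
  show m: "integrable lborel (\<lambda>z. moll \<epsilon> (z - w))"
    by (rule integrable_continuous_compact_support[OF c compact_cball[of w \<epsilon>]])
      (auto intro!: moll_eq_0 assms simp: dist_norm norm_minus_commute)
  have "integrable lborel (\<lambda>z. M * \<bar>f z\<bar> powr p)"
    using assms by (auto simp: Lp_fun_def)
  then show i: "integrable lborel (\<lambda>z. \<bar>f z\<bar> powr p * moll \<epsilon> (z - w))"
  proof (rule Bochner_Integration.integrable_bound)
    show "AE z in lborel. norm (\<bar>f z\<bar> powr p * moll \<epsilon> (z - w)) \<le> norm (M * \<bar>f z\<bar> powr p)"
    proof (rule AE_I2)
      fix z
      have "\<bar>moll \<epsilon> (z - w)\<bar> \<le> \<bar>M\<bar>" using M[of "z - w"] by linarith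
      then show "norm (\<bar>f z\<bar> powr p * moll \<epsilon> (z - w)) \<le> norm (M * \<bar>f z\<bar> powr p)"
        by (simp add: abs_mult mult.commute[of "\<bar>f z\<bar> powr p"] mult_right_mono)
    qed
  qed measurable
  have "integrable lborel (\<lambda>z. moll \<epsilon> (z - w) + \<bar>f z\<bar> powr p * moll \<epsilon> (z - w))"
    using m i by simp
  then show "integrable lborel (\<lambda>z. f z * moll \<epsilon> (z - w))"
  proof (rule Bochner_Integration.integrable_bound)
    have le: "\<bar>f z\<bar> \<le> 1 + \<bar>f z\<bar> powr p" for z
      using young_powr[of p 1 "\<bar>f z\<bar>"] assms by simp
    show "AE z in lborel. norm (f z * moll \<epsilon> (z - w)) \<le> norm (moll \<epsilon> (z - w) + \<bar>f z\<bar> powr p * moll \<epsilon> (z - w))"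
    proof (rule AE_I2)
      fix z
      have "\<bar>f z\<bar> * moll \<epsilon> (z - w) \<le> (1 + \<bar>f z\<bar> powr p) * moll \<epsilon> (z - w)"
        by (intro mult_right_mono le moll_nonneg)
      then show "norm (f z * moll \<epsilon> (z - w)) \<le> norm (moll \<epsilon> (z - w) + \<bar>f z\<bar> powr p * moll \<epsilon> (z - w))"
        using moll_nonneg[of \<epsilon> "z - w"] by (simp add: abs_mult algebra_simps)
    qed
  qed measurable
  show one: "(LINT z|lborel. moll \<epsilon> (z - w)) = 1"
    using lborel_integral_translate[of "moll \<epsilon>" "- w"] integral_moll[OF assms(1), where 'a = 'a] by simp
  then show "(LINT z|lborel. moll \<epsilon> (w - z)) = 1"
    by (simp add: moll_commute[of _ w])
qed

lemma measurable_conv: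
  assumes [measurable]: "f \<in> borel_measurable borel"
  shows "conv \<epsilon> f \<in> borel_measurable borel"
  unfolding conv_def by measurable

text \<open>Jensen's inequality for the probability density \<open>moll\<close>: the supporting line
  of s^p at the mean c of |f| is integrated, and the multiple of |f| - c averages to 0.\<close>

lemma conv_powr_le:
  fixes f :: "'a::euclidean_space \<Rightarrow> real"
  assumes "\<epsilon> > 0" "Lp_fun p f" "1 < p"
  shows "\<bar>conv \<epsilon> f w\<bar> powr p \<le> conv \<epsilon> (\<lambda>z. \<bar>f z\<bar> powr p) w"
proof -
  define c where "c = (LINT z|lborel. \<bar>f z\<bar> * moll \<epsilon> (z - w))"
  note i = integrable_mult_moll[OF assms, of w]
  have ia: "integrable lborel (\<lambda>z. \<bar>f z\<bar> * moll \<epsilon> (z - w))"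
    using integrable_abs[OF i(1)] by (simp add: abs_mult moll_nonneg)
  have c0: "0 \<le> c" unfolding c_def by (intro integral_nonneg_AE) (simp add: moll_nonneg)
  have "\<bar>conv \<epsilon> f w\<bar> \<le> c"
    unfolding conv_def c_def
    using integral_abs_bound[of lborel "\<lambda>z. f z * moll \<epsilon> (z - w)"] by (simp add: abs_mult moll_nonneg)
  then have "\<bar>conv \<epsilon> f w\<bar> powr p \<le> c powr p"
    using assms by (intro powr_mono2) auto
  also have "\<dots> = (LINT z|lborel. (c powr p - p * c powr (p - 1) * c) * moll \<epsilon> (z - w) +
      p * c powr (p - 1) * (\<bar>f z\<bar> * moll \<epsilon> (z - w)))"
    using i ia by (simp add: c_def[symmetric])
  also have "\<dots> \<le> (LINT z|lborel. \<bar>f z\<bar> powr p * moll \<epsilon> (z - w))"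
  proof (rule integral_mono)
    fix z
    have "(c powr p + p * c powr (p - 1) * (\<bar>f z\<bar> - c)) * moll \<epsilon> (z - w) \<le> \<bar>f z\<bar> powr p * moll \<epsilon> (z - w)"
      using assms(3) c0 by (intro mult_right_mono powr_tangent moll_nonneg) auto
    then show "(c powr p - p * c powr (p - 1) * c) * moll \<epsilon> (z - w) +
      p * c powr (p - 1) * (\<bar>f z\<bar> * moll \<epsilon> (z - w)) \<le> \<bar>f z\<bar> powr p * moll \<epsilon> (z - w)"
      by (simp add: algebra_simps)
  qed (use i ia in auto)
  finally show ?thesis by (simp add: conv_def)
qed

lemma integral_conv:
  fixes g :: "'a::euclidean_space \<Rightarrow> real"
  assumes "\<epsilon> > 0" "integrable lborel g"
  shows "integrable lborel (conv \<epsilon> g)" "(LINT w|lborel. conv \<epsilon> g w) = (LINT z|lborel. g z)"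
proof -
  have [measurable]: "g \<in> borel_measurable borel" using assms(2) by simp
  have one: "(LINT w|lborel. moll \<epsilon> (z - w)) = 1" and im: "integrable lborel (\<lambda>w. moll \<epsilon> (z - w))" for z :: 'a
    using integrable_mult_moll(3,5)[OF assms(1), of 2 "\<lambda>_. 0" z] by (auto simp: Lp_fun_def moll_commute[of _ z])
  have i: "integrable (lborel \<Otimes>\<^sub>M lborel) (\<lambda>(z, w). g z * moll \<epsilon> (z - w))"
  proof (rule lborel_pair.Fubini_integrable)
    show "integrable lborel (\<lambda>x. LINT y|lborel. norm (case (x, y) of (z, w) \<Rightarrow> g z * moll \<epsilon> (z - w)))"
      using assms(2) one by (simp add: abs_mult moll_nonneg)
    show "AE x in lborel. integrable lborel (\<lambda>y. case (x, y) of (z, w) \<Rightarrow> g z * moll \<epsilon> (z - w))"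
      using im by simp
  qed measurable
  show "integrable lborel (conv \<epsilon> g)"
    unfolding conv_def using lborel_pair.integrable_snd[OF i] .
  show "(LINT w|lborel. conv \<epsilon> g w) = (LINT z|lborel. g z)"
    unfolding conv_def using lborel_pair.Fubini_integral[OF i] one by simp
qed

lemma conv_Lp:
  fixes f :: "'a::euclidean_space \<Rightarrow> real"
  assumes "\<epsilon> > 0" "Lp_fun p f" "1 < p"
  shows "Lp_fun p (conv \<epsilon> f)" "(LINT w|lborel. \<bar>conv \<epsilon> f w\<bar> powr p) \<le> (LINT z|lborel. \<bar>f z\<bar> powr p)"
proof -
  have [measurable]: "conv \<epsilon> f \<in> borel_measurable borel"
    using assms by (intro measurable_conv) (simp add: Lp_fun_def)
  have g: "integrable lborel (\<lambda>z. \<bar>f z\<bar> powr p)" using assms by (simp add: Lp_fun_def)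
  note ig = integral_conv[OF assms(1) g]
  note le = conv_powr_le[OF assms]
  have i: "integrable lborel (\<lambda>w. \<bar>conv \<epsilon> f w\<bar> powr p)"
    using ig(1) by (rule Bochner_Integration.integrable_bound)
      (measurable, use le in \<open>auto intro: order_trans[OF _ abs_ge_self]\<close>)
  then show "Lp_fun p (conv \<epsilon> f)" by (simp add: Lp_fun_def)
  have "(LINT w|lborel. \<bar>conv \<epsilon> f w\<bar> powr p) \<le> (LINT w|lborel. conv \<epsilon> (\<lambda>z. \<bar>f z\<bar> powr p) w)"
    by (rule integral_mono[OF i ig(1) le])
  then show "(LINT w|lborel. \<bar>conv \<epsilon> f w\<bar> powr p) \<le> (LINT z|lborel. \<bar>f z\<bar> powr p)"
    using ig(2) by simp
qed

lemma conv_diff: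
  fixes f :: "'a::euclidean_space \<Rightarrow> real"
  assumes "\<epsilon> > 0" "1 < p" "Lp_fun p f" "Lp_fun p g"
  shows "conv \<epsilon> (\<lambda>x. f x - g x) w = conv \<epsilon> f w - conv \<epsilon> g w"
  unfolding conv_def
  using integrable_mult_moll(1)[OF assms(1,3,2)] integrable_mult_moll(1)[OF assms(1,4,2)]
  by (simp add: left_diff_distrib)

text \<open>A weighted mean of values within d of c is itself within d of c. With c = 0 this gives
  sup bounds and supports, with c = g w it gives convergence.\<close>

lemma conv_near:
  fixes g :: "'a::euclidean_space \<Rightarrow> real"
  assumes \<epsilon>: "\<epsilon> > 0" and g: "continuous_on UNIV g" and le: "\<And>z. dist z w < \<epsilon> \<Longrightarrow> \<bar>g z - c\<bar> \<le> d"
  shows "\<bar>conv \<epsilon> g w - c\<bar> \<le> d"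
proof -
  have m: "integrable lborel (\<lambda>z. moll \<epsilon> (z - w))" "(LINT z|lborel. moll \<epsilon> (z - w)) = 1"
    using integrable_mult_moll(3,4)[OF \<epsilon>, of 2 "\<lambda>_. 0" w] by (auto simp: Lp_fun_def)
  have c: "continuous_on UNIV (\<lambda>z. g z * moll \<epsilon> (z - w))"
    by (auto intro!: continuous_on_compose2[OF continuous_on_moll] continuous_intros g)
  have i: "integrable lborel (\<lambda>z. g z * moll \<epsilon> (z - w))"
    by (rule integrable_continuous_compact_support[OF c compact_cball[of w \<epsilon>]])
      (auto intro!: moll_eq_0 \<epsilon> simp: dist_norm norm_minus_commute)
  have "conv \<epsilon> g w - c = (LINT z|lborel. g z * moll \<epsilon> (z - w) - c * moll \<epsilon> (z - w))"
    using i m by (simp add: conv_def)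
  also have "\<bar>\<dots>\<bar> \<le> (LINT z|lborel. \<bar>g z * moll \<epsilon> (z - w) - c * moll \<epsilon> (z - w)\<bar>)"
    by (rule integral_abs_bound)
  also have "\<dots> \<le> (LINT z|lborel. d * moll \<epsilon> (z - w))"
  proof (rule integral_mono)
    fix z
    have "\<bar>g z - c\<bar> * moll \<epsilon> (z - w) \<le> d * moll \<epsilon> (z - w)"
      using le[of z] moll_eq_0[OF \<epsilon>, of "z - w"] moll_nonneg[of \<epsilon> "z - w"]
      by (cases "dist z w < \<epsilon>") (auto simp: dist_norm intro: mult_right_mono)
    then show "\<bar>g z * moll \<epsilon> (z - w) - c * moll \<epsilon> (z - w)\<bar> \<le> d * moll \<epsilon> (z - w)"
      using moll_nonneg[of \<epsilon> "z - w"] by (simp add: abs_mult flip: left_diff_distrib)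
  qed (use i m in auto)
  also have "\<dots> = d" using m by simp
  finally show ?thesis .
qed

lemma conv_tendsto:
  fixes g :: "'a::euclidean_space \<Rightarrow> real"
  assumes e: "\<And>k. e k > 0" "e \<longlonglongrightarrow> 0" and g: "continuous_on UNIV g"
  shows "(\<lambda>k. conv (e k) g w) \<longlonglongrightarrow> g w"
proof (rule LIMSEQ_I)
  fix r :: real assume r: "r > 0"
  obtain d where d: "d > 0" "\<And>z. dist z w < d \<Longrightarrow> dist (g z) (g w) < r / 2"
    using g r unfolding continuous_on_iff by (metis UNIV_I half_gt_zero)
  obtain N where N: "\<And>k. k \<ge> N \<Longrightarrow> e k < d"
    using order_tendstoD(2)[OF e(2) d(1)] unfolding eventually_sequentially by blast
  have "\<bar>conv (e k) g w - g w\<bar> \<le> r / 2" if "k \<ge> N" for k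
  proof (rule conv_near[OF e(1) g])
    fix z assume "dist z w < e k"
    then show "\<bar>g z - g w\<bar> \<le> r / 2" using d(2)[of z] N[OF that] by (simp add: dist_real_def)
  qed
  then show "\<exists>N. \<forall>k\<ge>N. norm (conv (e k) g w - g w) < r"
    using r by (intro exI[of _ N]) force
qed

lemma Lp_truncate:
  fixes f :: "'a::euclidean_space \<Rightarrow> real"
  assumes f: "Lp_fun p f" and p: "1 < p" and \<delta>: "\<delta> > 0"
  obtains n :: nat where "(LINT x|lborel. \<bar>f x - (if \<bar>f x\<bar> \<le> real n \<and> norm x \<le> real n then f x else 0)\<bar> powr p) < \<delta>"
proof -
  have [measurable]: "f \<in> borel_measurable borel" using f by (simp add: Lp_fun_def)
  let ?g = "\<lambda>n x. \<bar>f x - (if \<bar>f x\<bar> \<le> real n \<and> norm x \<le> real n then f x else 0)\<bar> powr p"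
  have "(\<lambda>n. integral\<^sup>L lborel (?g n)) \<longlonglongrightarrow> (LINT x|(lborel :: 'a measure). (0::real))"
  proof (rule integral_dominated_convergence)
    show "integrable lborel (\<lambda>x. \<bar>f x\<bar> powr p)" using f by (simp add: Lp_fun_def)
    show "AE x in lborel. (\<lambda>n. ?g n x) \<longlonglongrightarrow> 0"
    proof (rule AE_I2, rule tendsto_eventually)
      fix x :: 'a
      obtain N :: nat where "\<bar>f x\<bar> + norm x \<le> real N" using real_arch_simple by blast
      then show "\<forall>\<^sub>F n in sequentially. ?g n x = 0"
        by (intro eventually_sequentiallyI[of N]) (auto, (smt (verit) norm_ge_zero of_nat_mono)+)
    qed
  qed auto
  then have "\<forall>\<^sub>F n in sequentially. integral\<^sup>L lborel (?g n) < \<delta>"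
    using \<delta> by (intro order_tendstoD(2)) auto
  then show ?thesis using that by (auto simp: eventually_sequentially)
qed

text \<open>\<open>measurable_on\<close> supplies continuous functions converging to f off a
  negligible set. Clipping their values to [-M, M] and multiplying by a cutoff provides a dominating
  function and does not change the limit.\<close>

lemma Lp_approx_bounded:
  fixes f :: "'a::euclidean_space \<Rightarrow> real"
  assumes m: "f \<in> borel_measurable borel" and b: "\<And>x. \<bar>f x\<bar> \<le> M" and z: "\<And>x. norm x > M \<Longrightarrow> f x = 0"
    and p: "1 < p" and \<delta>: "\<delta> > 0"
  obtains g where "continuous_on UNIV g" "\<And>x. x \<notin> cball 0 (M + 1) \<Longrightarrow> g x = 0"
    "(LINT x|lborel. \<bar>f x - g x\<bar> powr p) < \<delta>"
proof -
  note [measurable] = m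
  have M: "0 \<le> M" using b[of 0] by linarith
  have "f measurable_on UNIV"
    by (rule lebesgue_measurable_imp_measurable_on_real) (use m in \<open>auto simp: measurable_completion\<close>)
  then obtain N h where N: "negligible N" and h: "\<And>n. continuous_on UNIV (h n)"
    and lim: "\<And>x. x \<notin> N \<Longrightarrow> (\<lambda>n. h n x) \<longlonglongrightarrow> f x"
    by (auto simp: measurable_on_def)
  define cut where "cut x = max 0 (min 1 (M + 1 - norm x))" for x :: 'a
  define g where "g n x = cut x * max (- M) (min M (h n x))" for n x
  have cut: "cut x * f x = f x" "0 \<le> cut x" "cut x \<le> 1" "norm x > M + 1 \<Longrightarrow> cut x = 0" for x
    using z[of x] by (auto simp: cut_def)
  have g: "continuous_on UNIV (g n)" for n
    unfolding g_def cut_def by (intro continuous_intros h)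
  then have [measurable]: "g n \<in> borel_measurable borel" for n
    by (rule borel_measurable_continuous_onI)
  have gM: "\<bar>g n x\<bar> \<le> M" for n x
  proof -
    have "cut x * \<bar>max (- M) (min M (h n x))\<bar> \<le> 1 * M"
      using cut[of x] M by (intro mult_mono) auto
    then show ?thesis using cut(2)[of x] by (simp add: g_def abs_mult)
  qed
  have g0: "g n x = 0" if "x \<notin> cball 0 (M + 1)" for n x
    using cut(4)[of x] that by (simp add: g_def)
  have "(\<lambda>n. LINT x|lborel. \<bar>f x - g n x\<bar> powr p) \<longlonglongrightarrow> (LINT x|(lborel :: 'a measure). (0::real))"
  proof (rule integral_dominated_convergence)
    show "integrable lborel (\<lambda>x::'a. (2 * M) powr p * indicator (cball 0 (M + 1)) x)"
      by (rule integrable_indicator_bounded) auto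
    have "AE x in lebesgue. x \<notin> N"
      using N by (simp add: negligible_iff_null_sets AE_not_in)
    then have "AE x in lebesgue. (\<lambda>n. \<bar>f x - g n x\<bar> powr p) \<longlonglongrightarrow> 0"
    proof eventually_elim
      fix x assume x: "x \<notin> N"
      have "(\<lambda>n. g n x) \<longlonglongrightarrow> cut x * max (- M) (min M (f x))"
        unfolding g_def by (intro tendsto_intros lim x)
      also have "max (- M) (min M (f x)) = f x" using b[of x] by auto
      finally have "(\<lambda>n. g n x) \<longlonglongrightarrow> f x" by (simp add: cut)
      then have "(\<lambda>n. \<bar>f x - g n x\<bar>) \<longlonglongrightarrow> \<bar>f x - f x\<bar>" by (intro tendsto_intros)
      then show "(\<lambda>n. \<bar>f x - g n x\<bar> powr p) \<longlonglongrightarrow> 0"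
        using p by (intro tendsto_zero_powrI[OF _ tendsto_const]) auto
    qed
    then show "AE x in lborel. (\<lambda>n. \<bar>f x - g n x\<bar> powr p) \<longlonglongrightarrow> 0"
      by (simp add: AE_completion_iff)
    show "AE x in lborel. norm (\<bar>f x - g n x\<bar> powr p) \<le> (2 * M) powr p * indicator (cball 0 (M + 1)) x" for n
    proof (rule AE_I2)
      fix x
      have "\<bar>f x - g n x\<bar> powr p \<le> (2 * M) powr p"
        using b[of x] gM[of n x] p by (intro powr_mono2) auto
      moreover have "f x = 0 \<and> g n x = 0" if "x \<notin> cball 0 (M + 1)"
        using that z[of x] g0[OF that] by auto
      ultimately show "norm (\<bar>f x - g n x\<bar> powr p) \<le> (2 * M) powr p * indicator (cball 0 (M + 1)) x"
        by (cases "x \<in> cball 0 (M + 1)") (auto simp: indicator_def)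
    qed
  qed auto
  then have "\<forall>\<^sub>F n in sequentially. (LINT x|lborel. \<bar>f x - g n x\<bar> powr p) < \<delta>"
    using \<delta> by (intro order_tendstoD(2)) auto
  then obtain n where "(LINT x|lborel. \<bar>f x - g n x\<bar> powr p) < \<delta>"
    by (auto simp: eventually_sequentially)
  then show ?thesis using that[of "g n"] g g0 by blast
qed

lemma Lp_fun_continuous:
  fixes g :: "'a::euclidean_space \<Rightarrow> real"
  assumes "continuous_on UNIV g" "compact K" "\<And>x. x \<notin> K \<Longrightarrow> g x = 0" "0 < p"
  shows "Lp_fun p g"
proof -
  have "continuous_on UNIV (\<lambda>x. \<bar>g x\<bar> powr p)"
    using assms by (intro continuous_on_powr' continuous_intros) auto
  then have "integrable lborel (\<lambda>x. \<bar>g x\<bar> powr p)"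
    by (rule integrable_continuous_compact_support[OF _ assms(2)]) (use assms in auto)
  then show ?thesis
    using assms(1) by (auto simp: Lp_fun_def intro: borel_measurable_continuous_onI)
qed

lemma Lp_fun_bounded_support:
  fixes f :: "'a::euclidean_space \<Rightarrow> real"
  assumes [measurable]: "f \<in> borel_measurable borel" and "\<And>x. \<bar>f x\<bar> \<le> M" "\<And>x. x \<notin> A \<Longrightarrow> f x = 0"
    and A: "bounded A" "A \<in> sets borel" and "0 \<le> p"
  shows "Lp_fun p f"
proof -
  have "integrable lborel (\<lambda>x. M powr p * indicator A x)"
    using A by (rule integrable_indicator_bounded)
  then have "integrable lborel (\<lambda>x. \<bar>f x\<bar> powr p)"
  proof (rule Bochner_Integration.integrable_bound)
    show "AE x in lborel. norm (\<bar>f x\<bar> powr p) \<le> norm (M powr p * indicator A x)"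
      using assms by (intro AE_I2) (auto simp: indicator_def intro!: powr_mono2)
  qed measurable
  then show ?thesis by (simp add: Lp_fun_def)
qed

lemma Lp_approx:
  fixes f :: "'a::euclidean_space \<Rightarrow> real"
  assumes f: "Lp_fun p f" and p: "1 < p" and \<delta>: "\<delta> > 0"
  obtains g K where "continuous_on UNIV g" "compact K" "\<And>x. x \<notin> K \<Longrightarrow> g x = 0"
    "(LINT x|lborel. \<bar>f x - g x\<bar> powr p) < \<delta>"
proof -
  \<comment> \<open>Two errors are added, and the quasi-triangle inequality for p-th powers costs a
    factor 2^p.\<close>
  define \<gamma> where "\<gamma> = \<delta> / (2 * 2 powr p)"
  have \<gamma>: "\<gamma> > 0" using \<delta> by (simp add: \<gamma>_def)
  obtain n :: nat where n: "(LINT x|lborel. \<bar>f x - (if \<bar>f x\<bar> \<le> real n \<and> norm x \<le> real n then f x else 0)\<bar> powr p) < \<gamma>"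
    by (rule Lp_truncate[OF f p \<gamma>])
  define h where "h x = (if \<bar>f x\<bar> \<le> real n \<and> norm x \<le> real n then f x else 0)" for x
  have [measurable]: "f \<in> borel_measurable borel" using f by (simp add: Lp_fun_def)
  have hm: "h \<in> borel_measurable borel" unfolding h_def by measurable
  have hb: "\<bar>h x\<bar> \<le> real n" for x by (auto simp: h_def)
  have hz: "norm x > real n \<Longrightarrow> h x = 0" for x by (auto simp: h_def)
  obtain g where g: "continuous_on UNIV g" "\<And>x. x \<notin> cball 0 (real n + 1) \<Longrightarrow> g x = 0"
    "(LINT x|lborel. \<bar>h x - g x\<bar> powr p) < \<gamma>"
    by (rule Lp_approx_bounded[OF hm hb hz p \<gamma>]) blast+
  have Lh: "Lp_fun p h"
    by (rule Lp_fun_bounded_support[OF hm hb, of "cball 0 (real n)"]) (use hz p in auto)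
  have Lg: "Lp_fun p g"
    using g p by (intro Lp_fun_continuous[of g "cball 0 (real n + 1)"]) auto
  have *: "Lp_fun p (\<lambda>x. f x - h x)" "Lp_fun p (\<lambda>x. g x - h x)"
    using f Lh Lg p by (auto intro: Lp_fun_diff)
  have "(LINT x|lborel. \<bar>(f x - h x) - (g x - h x)\<bar> powr p) \<le>
      2 powr p * ((LINT x|lborel. \<bar>f x - h x\<bar> powr p) + (LINT x|lborel. \<bar>g x - h x\<bar> powr p))"
    using p by (intro Lp_fun_diff(2)[OF *]) auto
  also have "\<dots> < 2 powr p * (\<gamma> + \<gamma>)"
    using n g(3) by (intro mult_strict_left_mono add_strict_mono) (auto simp: h_def[symmetric] abs_minus_commute)
  also have "\<dots> = \<delta>" by (simp add: \<gamma>_def)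
  finally have "(LINT x|lborel. \<bar>f x - g x\<bar> powr p) < \<delta>" by simp
  then show ?thesis using g(2) by (intro that[OF g(1) compact_cball[of 0 "real n + 1"]])
qed

lemma conv_Lp_tendsto_continuous:
  fixes g :: "'a::euclidean_space \<Rightarrow> real"
  assumes e: "\<And>k. e k > 0" "e \<longlonglongrightarrow> 0" "\<And>k. e k \<le> 1" and g: "continuous_on UNIV g"
    and K: "compact K" "\<And>x. x \<notin> K \<Longrightarrow> g x = 0" and p: "1 < p"
  shows "(\<lambda>k. LINT w|lborel. \<bar>conv (e k) g w - g w\<bar> powr p) \<longlonglongrightarrow> 0"
proof -
  obtain r where r: "0 < r" "K \<subseteq> ball 0 r"
    using bounded_subset_ballD[OF compact_imp_bounded[OF K(1)]] by blast
  have "bounded (g ` K)"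
    by (intro compact_imp_bounded compact_continuous_image K continuous_on_subset[OF g]) auto
  then obtain M0 where M0: "\<And>x. x \<in> K \<Longrightarrow> \<bar>g x\<bar> \<le> M0"
    unfolding bounded_iff by (metis imageI real_norm_def)
  define M where "M = max M0 0"
  have M: "\<bar>g x\<bar> \<le> M" for x using M0[of x] K(2)[of x] by (cases "x \<in> K") (auto simp: M_def)
  have cM: "\<bar>conv (e k) g w\<bar> \<le> M" for k w
    using conv_near[OF e(1) g, of w k 0 M] M by simp
  have c0: "conv (e k) g w = 0" if "w \<notin> cball 0 (r + 1)" for k w
  proof -
    have "\<bar>conv (e k) g w - 0\<bar> \<le> 0"
    proof (rule conv_near[OF e(1) g])
      fix z assume z: "dist z w < e k"
      have "norm w \<le> norm z + dist z w" by (metis dist_commute dist_norm norm_triangle_sub)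
      then have "norm z \<ge> r" using that z e(3)[of k] by simp
      then have "z \<notin> K" using r by auto
      then show "\<bar>g z - 0\<bar> \<le> 0" using K by simp
    qed
    then show ?thesis by simp
  qed
  have gm: "g \<in> borel_measurable borel" using g by (rule borel_measurable_continuous_onI)
  note [measurable] = gm measurable_conv[OF gm]
  have "(\<lambda>k. LINT w|lborel. \<bar>conv (e k) g w - g w\<bar> powr p) \<longlonglongrightarrow> (LINT w|(lborel :: 'a measure). (0::real))"
  proof (rule integral_dominated_convergence)
    show "integrable lborel (\<lambda>x::'a. (2 * M) powr p * indicator (cball 0 (r + 1)) x)"
      by (rule integrable_indicator_bounded) auto
    show "AE x in lborel. (\<lambda>k. \<bar>conv (e k) g x - g x\<bar> powr p) \<longlonglongrightarrow> 0"
    proof (rule AE_I2)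
      fix x
      have "(\<lambda>k. \<bar>conv (e k) g x - g x\<bar>) \<longlonglongrightarrow> \<bar>g x - g x\<bar>"
        by (intro tendsto_intros conv_tendsto e g)
      then show "(\<lambda>k. \<bar>conv (e k) g x - g x\<bar> powr p) \<longlonglongrightarrow> 0"
        using p by (intro tendsto_zero_powrI[OF _ tendsto_const]) auto
    qed
    show "AE x in lborel. norm (\<bar>conv (e k) g x - g x\<bar> powr p) \<le> (2 * M) powr p * indicator (cball 0 (r + 1)) x" for k
    proof (rule AE_I2)
      fix x
      have "\<bar>conv (e k) g x - g x\<bar> powr p \<le> (2 * M) powr p"
        using M[of x] cM[of k x] p by (intro powr_mono2) auto
      moreover have "conv (e k) g x = 0 \<and> g x = 0" if "x \<notin> cball 0 (r + 1)"
      proof -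
        have "x \<notin> K" using that r by (fastforce dest: subsetD)
        then show ?thesis using c0[OF that] K(2) by blast
      qed
      ultimately show "norm (\<bar>conv (e k) g x - g x\<bar> powr p) \<le> (2 * M) powr p * indicator (cball 0 (r + 1)) x"
        by (cases "x \<in> cball 0 (r + 1)") (auto simp: indicator_def)
    qed
  qed auto
  then show ?thesis by simp
qed

text \<open>A density argument: for a continuous g close to f the error splits into that of g, which
  tends to 0, and f - g together with its mollification, both small because mollification is a
  contraction in L^p.\<close>

lemma conv_Lp_tendsto:
  fixes f :: "'a::euclidean_space \<Rightarrow> real"
  assumes e: "\<And>k. e k > 0" "e \<longlonglongrightarrow> 0" "\<And>k. e k \<le> 1" and f: "Lp_fun p f" and p: "1 < p"
  shows "(\<lambda>k. LINT w|lborel. \<bar>conv (e k) f w - f w\<bar> powr p) \<longlonglongrightarrow> 0"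
proof (rule LIMSEQ_I)
  fix r :: real assume r: "r > 0"
  \<comment> \<open>The quasi-triangle inequality is used twice in nested form, giving 2^p 2^p, and
    three error terms of size \<gamma> remain.\<close>
  define \<gamma> where "\<gamma> = r / (3 * (2 powr p * 2 powr p))"
  have \<gamma>: "\<gamma> > 0" using r by (simp add: \<gamma>_def)
  obtain g K where g: "continuous_on UNIV g" "compact K" "\<And>x. x \<notin> K \<Longrightarrow> g x = 0"
    "(LINT x|lborel. \<bar>f x - g x\<bar> powr p) < \<gamma>"
    by (rule Lp_approx[OF f p \<gamma>]) blast
  have Lg: "Lp_fun p g" using g p by (intro Lp_fun_continuous[of g K]) auto
  have p0: "0 \<le> p" using p by simp
  have "\<forall>\<^sub>F k in sequentially. (LINT w|lborel. \<bar>conv (e k) g w - g w\<bar> powr p) < \<gamma>"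
    by (rule order_tendstoD(2)[OF conv_Lp_tendsto_continuous[OF e g(1,2,3) p] \<gamma>])
  then obtain N where N: "\<And>k. k \<ge> N \<Longrightarrow> (LINT w|lborel. \<bar>conv (e k) g w - g w\<bar> powr p) < \<gamma>"
    unfolding eventually_sequentially by blast
  have "(LINT w|lborel. \<bar>conv (e k) f w - f w\<bar> powr p) < r" if k: "k \<ge> N" for k
  proof -
    let ?I = "\<lambda>h. LINT w|lborel. \<bar>h w\<bar> powr p"
    let ?d = "\<lambda>x. f x - g x"
    have L: "Lp_fun p ?d" "Lp_fun p (conv (e k) g)" "Lp_fun p (conv (e k) ?d)"
      by (intro Lp_fun_diff(1) conv_Lp(1) f Lg p0 p e)+
    have L2: "Lp_fun p (\<lambda>x. conv (e k) g x - g x)" "Lp_fun p (\<lambda>x. ?d x - conv (e k) ?d x)"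
      by (intro Lp_fun_diff(1) L Lg p0)+
    have eq: "conv (e k) f w - f w = (conv (e k) g w - g w) - (?d w - conv (e k) ?d w)" for w
      using conv_diff[OF e(1) p f Lg, of k w] by simp
    have "?I (\<lambda>w. conv (e k) f w - f w) \<le> 2 powr p * (?I (\<lambda>x. conv (e k) g x - g x) + ?I (\<lambda>x. ?d x - conv (e k) ?d x))"
      unfolding eq by (rule Lp_fun_diff(2)[OF L2 p0])
    also have "\<dots> \<le> 2 powr p * (?I (\<lambda>x. conv (e k) g x - g x) + 2 powr p * (?I ?d + ?I (conv (e k) ?d)))"
      by (intro mult_left_mono add_left_mono Lp_fun_diff(2)[OF L(1,3) p0]) auto
    also have "\<dots> \<le> 2 powr p * (?I (\<lambda>x. conv (e k) g x - g x) + 2 powr p * (?I ?d + ?I ?d))"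
      by (intro mult_left_mono add_left_mono conv_Lp(2) e L p) auto
    also have "\<dots> < 2 powr p * (2 powr p * \<gamma> + 2 powr p * (\<gamma> + \<gamma>))"
    proof (intro mult_strict_left_mono add_strict_mono)
      have "1 \<le> 2 powr p" using p by (intro ge_one_powr_ge_zero) auto
      then have "1 * \<gamma> \<le> 2 powr p * \<gamma>" using \<gamma> by (intro mult_right_mono) auto
      then show "?I (\<lambda>x. conv (e k) g x - g x) < 2 powr p * \<gamma>" using N[OF k] by linarith
    qed (use g(4) in auto)
    also have "\<dots> = r" by (simp add: \<gamma>_def field_simps)
    finally show ?thesis .
  qed
  then show "\<exists>N. \<forall>k\<ge>N. norm ((LINT w|lborel. \<bar>conv (e k) f w - f w\<bar> powr p) - 0) < r"
    by (intro exI[of _ N]) (auto simp: abs_of_nonneg integral_nonneg_AE)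
qed

section \<open>Limits of products in dual L^p spaces\<close>

lemma pairing_integrable:
  fixes a b :: "'a::euclidean_space \<Rightarrow> real"
  assumes a: "Lp_fun (p / (p - 1)) a" and b: "Lp_fun p b" and p: "1 < p"
  shows "integrable lborel (\<lambda>x. a x * b x)"
proof -
  have [measurable]: "a \<in> borel_measurable borel" "b \<in> borel_measurable borel"
    using a b by (auto simp: Lp_fun_def)
  have "integrable lborel (\<lambda>x. \<bar>a x\<bar> powr (p / (p - 1)) + \<bar>b x\<bar> powr p)"
    using a b by (simp add: Lp_fun_def)
  then show ?thesis
  proof (rule Bochner_Integration.integrable_bound)
    show "AE x in lborel. norm (a x * b x) \<le> norm (\<bar>a x\<bar> powr (p / (p - 1)) + \<bar>b x\<bar> powr p)"
      using young_powr[OF p] by (intro AE_I2) (auto simp: abs_mult)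
  qed measurable
qed

text \<open>Young's inequality for the product of l |a| and |b| / l. The free parameter l allows the
  factor that is merely bounded to be made as cheap as desired.\<close>

lemma pairing_bound:
  fixes a b :: "'a::euclidean_space \<Rightarrow> real"
  assumes a: "Lp_fun (p / (p - 1)) a" and b: "Lp_fun p b" and p: "1 < p" and l: "l > 0"
  shows "(LINT x|lborel. \<bar>a x * b x\<bar>) \<le> l powr (p / (p - 1)) * (LINT x|lborel. \<bar>a x\<bar> powr (p / (p - 1))) +
    l powr (- p) * (LINT x|lborel. \<bar>b x\<bar> powr p)"
proof -
  let ?q = "p / (p - 1)"
  have i: "integrable lborel (\<lambda>x. l powr ?q * \<bar>a x\<bar> powr ?q)" "integrable lborel (\<lambda>x. l powr (- p) * \<bar>b x\<bar> powr p)"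
    using a b by (simp_all add: Lp_fun_def)
  have "(LINT x|lborel. \<bar>a x * b x\<bar>) \<le> (LINT x|lborel. l powr ?q * \<bar>a x\<bar> powr ?q + l powr (- p) * \<bar>b x\<bar> powr p)"
  proof (rule integral_mono)
    fix x
    have "\<bar>a x * b x\<bar> = (l * \<bar>a x\<bar>) * (\<bar>b x\<bar> / l)" using l by (simp add: abs_mult)
    also have "\<dots> \<le> (l * \<bar>a x\<bar>) powr ?q + (\<bar>b x\<bar> / l) powr p"
      by (rule young_powr[OF p]) (use l in auto)
    also have "\<dots> = l powr ?q * \<bar>a x\<bar> powr ?q + l powr (- p) * \<bar>b x\<bar> powr p"
      using l by (simp add: powr_mult powr_divide powr_minus field_simps)
    finally show "\<bar>a x * b x\<bar> \<le> l powr ?q * \<bar>a x\<bar> powr ?q + l powr (- p) * \<bar>b x\<bar> powr p" .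
  qed (use i pairing_integrable[OF a b p] in \<open>auto intro: integrable_abs\<close>)
  also have "\<dots> = l powr ?q * (LINT x|lborel. \<bar>a x\<bar> powr ?q) + l powr (- p) * (LINT x|lborel. \<bar>b x\<bar> powr p)"
    using i by simp
  finally show ?thesis .
qed

lemma pairing_tendsto_0:
  fixes a b :: "nat \<Rightarrow> 'a::euclidean_space \<Rightarrow> real"
  assumes a: "\<And>k. Lp_fun (p / (p - 1)) (a k)" and b: "\<And>k. Lp_fun p (b k)" and p: "1 < p"
    and A: "(\<lambda>k. LINT x|lborel. \<bar>a k x\<bar> powr (p / (p - 1))) \<longlonglongrightarrow> 0"
    and B: "\<And>k. (LINT x|lborel. \<bar>b k x\<bar> powr p) \<le> B"
  shows "(\<lambda>k. LINT x|lborel. \<bar>a k x * b k x\<bar>) \<longlonglongrightarrow> 0"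
proof (rule LIMSEQ_I)
  fix r :: real assume r: "r > 0"
  let ?q = "p / (p - 1)"
  define C where "C = max B 1"
  have C: "C > 0" "B \<le> C" by (auto simp: C_def)
  \<comment> \<open>Chosen so that the bounded factor contributes at most l^(-p) C = r/2; with l
    fixed, the other contribution tends to 0.\<close>
  define l where "l = (2 * C / r) powr (1 / p)"
  have l: "l > 0" using C r by (simp add: l_def)
  have "l powr (- p) = r / (2 * C)"
    using C r p by (simp add: l_def powr_powr powr_minus)
  then have lC: "l powr (- p) * C = r / 2" using C by simp
  have "(\<lambda>k. l powr ?q * (LINT x|lborel. \<bar>a k x\<bar> powr ?q)) \<longlonglongrightarrow> l powr ?q * 0"
    by (intro tendsto_intros A)
  then have "\<forall>\<^sub>F k in sequentially. l powr ?q * (LINT x|lborel. \<bar>a k x\<bar> powr ?q) < r / 2"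
    using r by (intro order_tendstoD(2)) auto
  then have "\<forall>\<^sub>F k in sequentially. (LINT x|lborel. \<bar>a k x * b k x\<bar>) < r"
  proof eventually_elim
    fix k assume k: "l powr ?q * (LINT x|lborel. \<bar>a k x\<bar> powr ?q) < r / 2"
    have "(LINT x|lborel. \<bar>a k x * b k x\<bar>) \<le> l powr ?q * (LINT x|lborel. \<bar>a k x\<bar> powr ?q) + l powr (- p) * (LINT x|lborel. \<bar>b k x\<bar> powr p)"
      by (rule pairing_bound[OF a b p l])
    also have "l powr (- p) * (LINT x|lborel. \<bar>b k x\<bar> powr p) \<le> l powr (- p) * C"
      using B[of k] C by (intro mult_left_mono) auto
    finally show "(LINT x|lborel. \<bar>a k x * b k x\<bar>) < r" using k lC by simp
  qed
  then show "\<exists>N. \<forall>k\<ge>N. norm ((LINT x|lborel. \<bar>a k x * b k x\<bar>) - 0) < r"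
    by (auto simp: eventually_sequentially abs_of_nonneg integral_nonneg_AE)
qed

lemma integral_mult_bounded:
  fixes f g :: "'a::euclidean_space \<Rightarrow> real"
  assumes f: "integrable lborel f" and m: "m \<in> borel_measurable borel" "\<And>x. \<bar>m x\<bar> \<le> M"
  shows "integrable lborel (\<lambda>x. f x * m x)" "\<bar>LINT x|lborel. f x * m x\<bar> \<le> M * (LINT x|lborel. \<bar>f x\<bar>)"
proof -
  have [measurable]: "f \<in> borel_measurable borel" "m \<in> borel_measurable borel"
    using borel_measurable_integrable[OF f] m by auto
  have M: "0 \<le> M" using m(2)[of 0] by linarith
  have le: "\<bar>f x * m x\<bar> \<le> M * \<bar>f x\<bar>" for x
    using mult_right_mono[OF m(2)[of x], of "\<bar>f x\<bar>"] by (simp add: abs_mult mult.commute)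
  have i: "integrable lborel (\<lambda>x. M * \<bar>f x\<bar>)" using f by simp
  then show j: "integrable lborel (\<lambda>x. f x * m x)"
    by (rule Bochner_Integration.integrable_bound) (measurable, use le M in \<open>auto simp: abs_mult\<close>)
  have "\<bar>LINT x|lborel. f x * m x\<bar> \<le> (LINT x|lborel. \<bar>f x * m x\<bar>)" by (rule integral_abs_bound)
  also have "\<dots> \<le> (LINT x|lborel. M * \<bar>f x\<bar>)"
    by (rule integral_mono) (use i j le in auto)
  finally show "\<bar>LINT x|lborel. f x * m x\<bar> \<le> M * (LINT x|lborel. \<bar>f x\<bar>)" by simp
qed

text \<open>Telescoping: a_k b_k m_k - a' b' m_k = (a_k - a') b_k m_k + (b_k - b') a' m_k. Both
  terms vanish in the limit by \<open>pairing_tendsto_0\<close>, the second with the roles of p and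
  its conjugate exchanged; the remaining product converges dominatedly.\<close>

lemma pairing_tendsto:
  fixes a b m :: "nat \<Rightarrow> 'a::euclidean_space \<Rightarrow> real"
  assumes a: "\<And>k. Lp_fun (p / (p - 1)) (a k)" "Lp_fun (p / (p - 1)) a'"
    and b: "\<And>k. Lp_fun p (b k)" "Lp_fun p b'" and p: "1 < p"
    and A: "(\<lambda>k. LINT x|lborel. \<bar>a k x - a' x\<bar> powr (p / (p - 1))) \<longlonglongrightarrow> 0"
    and B: "(\<lambda>k. LINT x|lborel. \<bar>b k x - b' x\<bar> powr p) \<longlonglongrightarrow> 0"
    and bb: "\<And>k. (LINT x|lborel. \<bar>b k x\<bar> powr p) \<le> BB"
    and m: "\<And>k. m k \<in> borel_measurable borel" "\<And>k x. \<bar>m k x\<bar> \<le> M" "\<And>x. (\<lambda>k. m k x) \<longlonglongrightarrow> m' x"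
  shows "(\<lambda>k. LINT x|lborel. a k x * b k x * m k x) \<longlonglongrightarrow> (LINT x|lborel. a' x * b' x * m' x)"
proof -
  let ?q = "p / (p - 1)"
  have q: "1 < ?q" "?q / (?q - 1) = p" using p by (simp_all add: field_simps)
  have p0: "0 \<le> ?q" "0 \<le> p" using p by auto
  have da: "Lp_fun ?q (\<lambda>x. a k x - a' x)" and db: "Lp_fun p (\<lambda>x. b k x - b' x)" for k
    using Lp_fun_diff(1)[OF a(1)[of k] a(2) p0(1)] Lp_fun_diff(1)[OF b(1)[of k] b(2) p0(2)] by auto
  have lim1: "(\<lambda>k. LINT x|lborel. \<bar>(a k x - a' x) * b k x\<bar>) \<longlonglongrightarrow> 0"
    by (rule pairing_tendsto_0[OF da b(1) p A bb])
  have lim2: "(\<lambda>k. LINT x|lborel. \<bar>(b k x - b' x) * a' x\<bar>) \<longlonglongrightarrow> 0"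
    by (rule pairing_tendsto_0[of ?q, unfolded q(2), OF db a(2) q(1) B order_refl])
  have m': "m' \<in> borel_measurable borel"
    by (rule borel_measurable_LIMSEQ_real[where u = m]) (use m in auto)
  have i3: "integrable lborel (\<lambda>x. a' x * b' x)" by (rule pairing_integrable[OF a(2) b(2) p])
  note [measurable] = m(1) m' borel_measurable_integrable[OF i3]
  have lim3: "(\<lambda>k. LINT x|lborel. a' x * b' x * m k x) \<longlonglongrightarrow> (LINT x|lborel. a' x * b' x * m' x)"
  proof (rule integral_dominated_convergence)
    show "integrable lborel (\<lambda>x. M * \<bar>a' x * b' x\<bar>)" using i3 by (intro integrable_mult_right integrable_abs)
    show "AE x in lborel. (\<lambda>k. a' x * b' x * m k x) \<longlonglongrightarrow> a' x * b' x * m' x"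
      by (intro AE_I2 tendsto_intros m)
    show "AE x in lborel. norm (a' x * b' x * m k x) \<le> M * \<bar>a' x * b' x\<bar>" for k
    proof (rule AE_I2)
      fix x show "norm (a' x * b' x * m k x) \<le> M * \<bar>a' x * b' x\<bar>"
        using mult_right_mono[OF m(2)[of k x], of "\<bar>a' x * b' x\<bar>"] by (simp add: abs_mult mult_ac)
    qed
  qed measurable
  have "(\<lambda>k. M * (LINT x|lborel. \<bar>(a k x - a' x) * b k x\<bar>) + M * (LINT x|lborel. \<bar>(b k x - b' x) * a' x\<bar>)) \<longlonglongrightarrow> M * 0 + M * 0"
    by (intro tendsto_intros lim1 lim2)
  then have lim4: "(\<lambda>k. M * (LINT x|lborel. \<bar>(a k x - a' x) * b k x\<bar>) + M * (LINT x|lborel. \<bar>(b k x - b' x) * a' x\<bar>)) \<longlonglongrightarrow> 0"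
    by simp
  have "(\<lambda>k. (LINT x|lborel. a k x * b k x * m k x) - (LINT x|lborel. a' x * b' x * m k x)) \<longlonglongrightarrow> 0"
  proof (rule tendsto_0_le[where K = 1, OF lim4])
    show "\<forall>\<^sub>F k in sequentially. norm ((LINT x|lborel. a k x * b k x * m k x) - (LINT x|lborel. a' x * b' x * m k x)) \<le>
      norm (M * (LINT x|lborel. \<bar>(a k x - a' x) * b k x\<bar>) + M * (LINT x|lborel. \<bar>(b k x - b' x) * a' x\<bar>)) * 1"
    proof (rule always_eventually, rule allI)
      fix k
      have i1: "integrable lborel (\<lambda>x. (a k x - a' x) * b k x)" by (rule pairing_integrable[OF da b(1) p])
      have i2: "integrable lborel (\<lambda>x. (b k x - b' x) * a' x)"
        using pairing_integrable[of ?q, unfolded q(2), OF db a(2) q(1)] .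
      note j1 = integral_mult_bounded[OF i1 m(1,2)[of k]]
      note j2 = integral_mult_bounded[OF i2 m(1,2)[of k]]
      note j3 = integral_mult_bounded[OF i3 m(1,2)[of k]]
      have "(LINT x|lborel. a k x * b k x * m k x) =
          (LINT x|lborel. ((a k x - a' x) * b k x * m k x + (b k x - b' x) * a' x * m k x) + a' x * b' x * m k x)"
        by (intro Bochner_Integration.integral_cong) (auto simp: algebra_simps)
      also have "\<dots> = (LINT x|lborel. (a k x - a' x) * b k x * m k x) + (LINT x|lborel. (b k x - b' x) * a' x * m k x) +
          (LINT x|lborel. a' x * b' x * m k x)"
        using j1 j2 j3 by simp
      finally show "norm ((LINT x|lborel. a k x * b k x * m k x) - (LINT x|lborel. a' x * b' x * m k x)) \<le>
        norm (M * (LINT x|lborel. \<bar>(a k x - a' x) * b k x\<bar>) + M * (LINT x|lborel. \<bar>(b k x - b' x) * a' x\<bar>)) * 1"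
        using j1(2) j2(2) by simp
    qed
  qed
  from tendsto_add[OF this lim3] show ?thesis by simp
qed

section \<open>The energy estimate\<close>

text \<open>Unlike the positive part itself, its square is continuously differentiable, so it can
  serve as a factor of a test function in the kernel integration by parts.\<close>

lemma sq_pos_part_DERIV:
  assumes "(g has_real_derivative D) (at x)"
  shows "((\<lambda>s. (max 0 (g s))\<^sup>2) has_real_derivative 2 * max 0 (g x) * D) (at x)"
proof -
  have *: "((\<lambda>s::real. (max 0 s)\<^sup>2) has_real_derivative 2 * max 0 y) (at y)" for y
  proof -
    consider "y < 0" | "y = 0" | "y > 0" by linarith
    then show ?thesis
    proof cases
      case 1
      have "((\<lambda>s::real. (max 0 s)\<^sup>2) has_real_derivative 0) (at y)"
        by (rule has_field_derivative_transform_within_open[OF DERIV_const[of 0], where S = "{..<0}"]) (use 1 in auto)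
      then show ?thesis using 1 by simp
    next
      case 2
      have "((\<lambda>h::real. ((max 0 (0 + h))\<^sup>2 - (max 0 0)\<^sup>2) / h) \<longlongrightarrow> 0) (at 0)"
        by (rule tendsto_0_le[where K = 1 and f = "\<lambda>h. h"])
          (auto intro!: always_eventually simp: max_def power2_eq_square)
      then show ?thesis using 2 by (simp add: DERIV_def)
    next
      case 3
      have "((\<lambda>s::real. s\<^sup>2) has_real_derivative 2 * y) (at y)"
        by (auto intro!: derivative_eq_intros)
      then have "((\<lambda>s::real. (max 0 s)\<^sup>2) has_real_derivative 2 * y) (at y)"
        by (rule has_field_derivative_transform_within_open[of _ _ _ "{0<..}"]) (use 3 in auto)
      then show ?thesis using 3 by simp
    qed
  qed
  from DERIV_chain2[OF * assms] show ?thesis .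
qed

text \<open>The cube is three times a primitive of the squared positive part; it turns the time term
  of the energy estimate into a total derivative.\<close>

lemma cube_pos_part_DERIV:
  assumes "(g has_real_derivative D) (at x)"
  shows "((\<lambda>s. (max 0 (g s)) ^ 3) has_real_derivative 3 * (max 0 (g x))\<^sup>2 * D) (at x)"
proof -
  have eq: "max 0 y ^ 3 = (max 0 y)\<^sup>2 * y" for y :: real
    by (auto simp: max_def power3_eq_cube power2_eq_square)
  show ?thesis unfolding eq
    by (rule DERIV_cong[OF DERIV_mult[OF sq_pos_part_DERIV[OF assms] assms]])
      (auto simp: max_def power2_eq_square algebra_simps)
qed

text \<open>The mollified equation is tested with \<open>\<zeta> (u\<^sub>+)\<^sup>2\<close>; the time derivative of \<open>\<zeta>\<close> is
  negative where \<open>u\<close> is positive.\<close>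

lemma weak_comparison_core:
  fixes u :: "(real ^ 'n) \<times> real \<Rightarrow> real" and V H :: "(real ^ 'n) \<times> real \<Rightarrow> real ^ 'n"
    and \<zeta> :: "(real ^ 'n) \<times> real \<Rightarrow> real" and D :: "(real ^ 'n) \<times> real \<Rightarrow> (real ^ 'n) \<times> real \<Rightarrow> real"
  assumes u: "continuous_on UNIV u" "\<And>z. \<bar>u z\<bar> \<le> M" and p: "1 < p"
    and V: "\<And>i. Lp_fun (p / (p - 1)) (\<lambda>z. V z $ i)" "\<And>i. integrable lborel (\<lambda>z. V z $ i)"
    and H: "\<And>i. Lp_fun p (\<lambda>z. H z $ i)"
    and E1: "\<And>w \<epsilon>. 0 < \<epsilon> \<Longrightarrow> cball w \<epsilon> \<subseteq> C \<Longrightarrow>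
      (\<Sum>i\<in>UNIV. LINT z|lborel. V z $ i * dmoll \<epsilon> (axis i 1, 0) (z - w)) = (LINT z|lborel. u z * dmoll \<epsilon> (0, 1) (z - w))"
    and E2: "\<And>w \<epsilon> i. 0 < \<epsilon> \<Longrightarrow> cball w \<epsilon> \<subseteq> C \<Longrightarrow>
      (LINT z|lborel. u z * dmoll \<epsilon> (axis i 1, 0) (z - w)) = - (LINT z|lborel. H z $ i * moll \<epsilon> (z - w))"
    and mono: "\<And>z. 0 \<le> V z \<bullet> H z"
    and \<zeta>: "continuous_on UNIV \<zeta>" "\<And>e. e \<in> Basis \<Longrightarrow> continuous_on UNIV (D e)"
      "\<And>e z. e \<in> Basis \<Longrightarrow> ((\<lambda>s. \<zeta> (z + s *\<^sub>R e)) has_real_derivative D e z) (at 0)"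
      "\<And>z. 0 \<le> \<zeta> z"
    and S: "compact S" "\<And>z. z \<notin> S \<Longrightarrow> \<zeta> z = 0" "\<And>z e. z \<notin> S \<Longrightarrow> D e z = 0"
      "0 < \<mu>" "\<mu> \<le> 1" "\<And>w. w \<in> S \<Longrightarrow> cball w \<mu> \<subseteq> C"
    and D: "\<And>z i. 0 < u z \<Longrightarrow> D (axis i 1, 0) z = 0" "\<And>z. 0 < u z \<Longrightarrow> D (0, 1) z \<le> 0"
      "0 < u z0" "D (0, 1) z0 < 0"
  shows False
proof -
  let ?x = "\<lambda>i. (axis i (1::real), 0::real) :: (real ^ 'n) \<times> real" and ?t = "(0, 1) :: (real ^ 'n) \<times> real"
  note B = axis_in_Basis_prod
  \<comment> \<open>Radii of at most \<mu> keep every kernel centred in S inside C, so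
    \<open>E1\<close> and \<open>E2\<close> hold at all points where the test function
    lives.\<close>
  define e where "e k = \<mu> / real (Suc k)" for k
  have e: "0 < e k" "e k \<le> 1" "e k \<le> \<mu>" for k
  proof -
    show "0 < e k" using S(4) by (simp add: e_def)
    have "\<mu> / real (Suc k) \<le> \<mu> / 1" using S(4) by (intro divide_left_mono) auto
    then show "e k \<le> \<mu>" by (simp add: e_def)
    then show "e k \<le> 1" using S(5) by simp
  qed
  have e0: "e \<longlonglongrightarrow> 0"
    using tendsto_mult_right_zero[OF LIMSEQ_Suc[OF lim_1_over_n], of \<mu>] by (simp add: e_def[abs_def])
  have cb: "cball w (e k) \<subseteq> C" if "w \<in> S" for w k
    using S(6)[OF that] e(3)[of k] by (meson order_trans subset_cball)
  define U where "U k = conv (e k) u" for k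
  have U: "continuous_on UNIV (U k)" for k unfolding U_def by (intro continuous_on_conv e u)
  have dU: "((\<lambda>s. U k (w + s *\<^sub>R i)) has_real_derivative dconv (e k) i u w) (at 0)" if "i \<in> Basis" for i k w
    unfolding U_def by (rule conv_line_derivative[OF e(1) that u(1)])
  have UM: "\<bar>U k w\<bar> \<le> M" for k w
    using conv_near[OF e(1) u(1), of w k 0 M] u(2) by (simp add: U_def)
  have Ulim: "(\<lambda>k. U k w) \<longlonglongrightarrow> u w" for w
    unfolding U_def by (rule conv_tendsto[OF e(1) e0 u(1)])
  have M: "0 \<le> M" using u(2)[of 0] by linarith
  define \<eta> where "\<eta> k w = \<zeta> w * (max 0 (U k w))\<^sup>2" for k w
  define \<eta>' where "\<eta>' k i w = D (?x i) w * (max 0 (U k w))\<^sup>2 + \<zeta> w * (2 * max 0 (U k w) * dconv (e k) (?x i) u w)" for k i w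
  have c\<eta>: "continuous_on UNIV (\<eta> k)" for k
    unfolding \<eta>_def by (intro continuous_intros \<zeta> U)
  have c\<eta>': "continuous_on UNIV (\<eta>' k i)" for k i
    unfolding \<eta>'_def by (intro continuous_intros \<zeta> U B continuous_on_dconv e u)
  have z\<eta>: "\<eta> k w = 0" "\<eta>' k i w = 0" if "w \<notin> S" for k i w
    using S(2)[OF that] S(3)[OF that] by (auto simp: \<eta>_def \<eta>'_def)
  have d\<eta>: "((\<lambda>s. \<eta> k (x + s *\<^sub>R ?x i)) has_real_derivative \<eta>' k i x) (at 0)" for k i x
    unfolding \<eta>_def \<eta>'_def
    by (rule DERIV_cong[OF DERIV_mult[OF \<zeta>(3)[OF B(1)] sq_pos_part_DERIV[OF dU[OF B(1)]]]])
      (simp flip: zero_prod_def)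
  have ct: "continuous_on UNIV (\<lambda>w. D ?t w * (max 0 (U k w)) ^ 3)"
    "continuous_on UNIV (\<lambda>w. \<eta> k w * dconv (e k) ?t u w)" for k
    by (intro continuous_intros \<zeta> U B c\<eta> continuous_on_dconv e u)+
  have it: "integrable lborel (\<lambda>w. D ?t w * (max 0 (U k w)) ^ 3)"
    "integrable lborel (\<lambda>w. \<eta> k w * dconv (e k) ?t u w)" for k
    by (rule integrable_continuous_compact_support[OF ct(1) S(1)], simp add: S(3))
      (rule integrable_continuous_compact_support[OF ct(2) S(1)], simp add: z\<eta>)
  \<comment> \<open>The total time derivative of \<zeta> times the cube of the positive part of U
    integrates to 0, which trades the time derivative of U for that of \<zeta>.\<close>
  have time: "(LINT w|lborel. D ?t w * (max 0 (U k w)) ^ 3) = - 3 * (LINT w|lborel. \<eta> k w * dconv (e k) ?t u w)" for k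
  proof -
    have "(LINT w|lborel. D ?t w * (max 0 (U k w)) ^ 3 + 3 * (\<eta> k w * dconv (e k) ?t u w)) = 0"
    proof (rule integral_directional_derivative_eq_0[where e = ?t, OF _ _ _ S(1)])
      show "((\<lambda>s. \<zeta> (x + s *\<^sub>R ?t) * (max 0 (U k (x + s *\<^sub>R ?t))) ^ 3) has_real_derivative
          D ?t x * (max 0 (U k x)) ^ 3 + 3 * (\<eta> k x * dconv (e k) ?t u x)) (at 0)" for x
        by (rule DERIV_cong[OF DERIV_mult[OF \<zeta>(3)[OF B(2)] cube_pos_part_DERIV[OF dU[OF B(2)]]]])
          (simp add: \<eta>_def flip: zero_prod_def)
      show "continuous_on UNIV (\<lambda>x. \<zeta> x * (max 0 (U k x)) ^ 3)"
        by (intro continuous_intros \<zeta> U)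
      show "continuous_on UNIV (\<lambda>x. D ?t x * (max 0 (U k x)) ^ 3 + 3 * (\<eta> k x * dconv (e k) ?t u x))"
        by (intro continuous_on_add continuous_on_mult[OF continuous_on_const] ct)
    qed (simp add: S(2))
    then show ?thesis using it by simp
  qed
  \<comment> \<open>On S the equation \<open>E1\<close> replaces the time derivative of U by the
    divergence of the mollified V; off S the factor \<eta> is 0. The divergence is moved to \<eta>
    afterwards.\<close>
  have space: "(LINT w|lborel. \<eta> k w * dconv (e k) ?t u w) =
      - (\<Sum>i\<in>UNIV. LINT w|lborel. \<eta>' k i w * conv (e k) (\<lambda>z. V z $ i) w)" for k
  proof -
    have i\<eta>: "integrable lborel (\<eta> k)"
      by (rule integrable_continuous_compact_support[OF c\<eta> S(1)]) (simp add: z\<eta>)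
    have int: "integrable lborel (\<lambda>w. \<eta> k w * (LINT z|lborel. V z $ i * dmoll (e k) (?x i) (z - w)))" for i
    proof -
      obtain L where L: "\<And>x. \<bar>dmoll (e k) (?x i) x\<bar> \<le> L" by (rule bounded_dmoll[OF e(1)[of k] B(1)[of i]]) blast
      show ?thesis
        by (rule Fubini_kernel(2)[OF V(2) i\<eta> borel_measurable_continuous_onI[OF continuous_on_dmoll[OF B(1)]] L])
    qed
    have "\<eta> k w * dconv (e k) ?t u w = - (\<Sum>i\<in>UNIV. \<eta> k w * (LINT z|lborel. V z $ i * dmoll (e k) (?x i) (z - w)))" for w
    proof (cases "w \<in> S")
      case True
      show ?thesis unfolding dconv_def E1[OF e(1) cb[OF True], symmetric] by (simp add: sum_distrib_left)
    qed (simp add: z\<eta>)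
    then have "(LINT w|lborel. \<eta> k w * dconv (e k) ?t u w) =
        - (\<Sum>i\<in>UNIV. LINT w|lborel. \<eta> k w * (LINT z|lborel. V z $ i * dmoll (e k) (?x i) (z - w)))"
      using int by (simp add: Bochner_Integration.integral_sum)
    also have "(\<Sum>i\<in>UNIV. LINT w|lborel. \<eta> k w * (LINT z|lborel. V z $ i * dmoll (e k) (?x i) (z - w))) =
        (\<Sum>i\<in>UNIV. LINT w|lborel. \<eta>' k i w * conv (e k) (\<lambda>z. V z $ i) w)"
      by (intro sum.cong refl kernel_integration_by_parts[OF e(1) B(1) V(2) c\<eta> c\<eta>' S(1) z\<eta> d\<eta>])
    finally show ?thesis .
  qed
  \<comment> \<open>Both summands get the shape a b m of \<open>pairing_tendsto\<close>. The term
    with the gradient of \<zeta> lacks a factor in L^p, so the indicator of S plays that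
    part.\<close>
  have split: "\<eta>' k i w * conv (e k) (\<lambda>z. V z $ i) w =
      conv (e k) (\<lambda>z. V z $ i) w * indicator S w * (D (?x i) w * (max 0 (U k w))\<^sup>2) +
      conv (e k) (\<lambda>z. V z $ i) w * conv (e k) (\<lambda>z. H z $ i) w * (\<zeta> w * (2 * max 0 (U k w)))" for k i w
  proof (cases "w \<in> S")
    case True
    have "dconv (e k) (?x i) u w = conv (e k) (\<lambda>z. H z $ i) w"
      unfolding dconv_def conv_def E2[OF e(1) cb[OF True]] by simp
    then show ?thesis using True by (simp add: \<eta>'_def algebra_simps)
  qed (simp add: z\<eta> S)
  have bnd: "\<exists>L. \<forall>w. \<bar>g w\<bar> \<le> L" if g: "continuous_on UNIV g" "\<And>w. w \<notin> S \<Longrightarrow> g w = 0" for g :: "(real ^ 'n) \<times> real \<Rightarrow> real"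
  proof -
    have "bounded (g ` S)"
      by (intro compact_imp_bounded compact_continuous_image S continuous_on_subset[OF g(1)]) auto
    then obtain L where L: "\<And>x. x \<in> S \<Longrightarrow> \<bar>g x\<bar> \<le> L"
      unfolding bounded_iff by (metis imageI real_norm_def)
    have "\<bar>g w\<bar> \<le> max L 0" for w using L[of w] g(2)[of w] by (cases "w \<in> S") auto
    then show ?thesis by blast
  qed
  have Sm [measurable]: "S \<in> sets borel" and bS: "bounded S"
    using S(1) by (auto simp: borel_compact compact_imp_bounded)
  have IS: "Lp_fun p (indicator S :: (real ^ 'n) \<times> real \<Rightarrow> real)"
    by (rule Lp_fun_bounded_support[OF _ _ _ bS Sm, of _ 1]) (use p in auto)
  have q: "1 < p / (p - 1)" using p by (simp add: field_simps)
  have LV: "Lp_fun (p / (p - 1)) (conv (e k) (\<lambda>z. V z $ i))" for k i by (rule conv_Lp(1)[OF e(1) V(1) q])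
  have LH: "Lp_fun p (conv (e k) (\<lambda>z. H z $ i))" for k i by (rule conv_Lp(1)[OF e(1) H p])
  have mx: "\<bar>max 0 (U k w)\<bar> \<le> M" for k w using UM[of k w] M by auto
  define m1 where "m1 k i w = D (?x i) w * (max 0 (U k w))\<^sup>2" for k i w
  define m2 where "m2 k w = \<zeta> w * (2 * max 0 (U k w))" for k w
  have m1: "continuous_on UNIV (m1 k i)" and m2: "continuous_on UNIV (m2 k)" for k i
    unfolding m1_def m2_def by (intro continuous_intros \<zeta> U B)+
  have b1: "\<exists>L. \<forall>k w. \<bar>m1 k i w\<bar> \<le> L" for i
  proof -
    obtain L where L: "\<And>w. \<bar>D (?x i) w\<bar> \<le> L" using bnd[OF \<zeta>(2)[OF B(1)] S(3)] by metis
    have "\<bar>m1 k i w\<bar> \<le> L * M\<^sup>2" for k w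
      unfolding m1_def abs_mult power_abs using order_trans[OF abs_ge_zero L]
      by (intro mult_mono power_mono L mx) auto
    then show ?thesis by blast
  qed
  have b2: "\<exists>L. \<forall>k w. \<bar>m2 k w\<bar> \<le> L"
  proof -
    obtain L where L: "\<And>w. \<bar>\<zeta> w\<bar> \<le> L" using bnd[OF \<zeta>(1) S(2)] by metis
    have "\<bar>m2 k w\<bar> \<le> L * (2 * M)" for k w
      unfolding m2_def abs_mult using order_trans[OF abs_ge_zero L] mx[of k w]
      by (intro mult_mono L) auto
    then show ?thesis by blast
  qed
  have lim1: "(\<lambda>k. LINT w|lborel. conv (e k) (\<lambda>z. V z $ i) w * indicator S w * m1 k i w) \<longlonglongrightarrow>
      (LINT w|lborel. V w $ i * indicator S w * (D (?x i) w * (max 0 (u w))\<^sup>2))" for i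
  proof -
    obtain L where L: "\<And>k w. \<bar>m1 k i w\<bar> \<le> L" using b1 by blast
    show ?thesis
    proof (rule pairing_tendsto[OF LV V(1) IS IS p conv_Lp_tendsto[OF e(1) e0 e(2) V(1) q] _ order_refl _ L])
      show "(\<lambda>k. m1 k i x) \<longlonglongrightarrow> D (?x i) x * (max 0 (u x))\<^sup>2" for x
        unfolding m1_def by (intro tendsto_intros Ulim)
    qed (use m1 in \<open>auto intro: borel_measurable_continuous_onI\<close>)
  qed
  have lim2: "(\<lambda>k. LINT w|lborel. conv (e k) (\<lambda>z. V z $ i) w * conv (e k) (\<lambda>z. H z $ i) w * m2 k w) \<longlonglongrightarrow>
      (LINT w|lborel. V w $ i * H w $ i * (\<zeta> w * (2 * max 0 (u w))))" for i
  proof -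
    obtain L where L: "\<And>k w. \<bar>m2 k w\<bar> \<le> L" using b2 by blast
    show ?thesis
    proof (rule pairing_tendsto[OF LV V(1) LH H p conv_Lp_tendsto[OF e(1) e0 e(2) V(1) q]
          conv_Lp_tendsto[OF e(1) e0 e(2) H p] conv_Lp(2)[OF e(1) H p] _ L])
      show "(\<lambda>k. m2 k x) \<longlonglongrightarrow> \<zeta> x * (2 * max 0 (u x))" for x
        unfolding m2_def by (intro tendsto_intros Ulim)
    qed (use m2 in \<open>auto intro: borel_measurable_continuous_onI\<close>)
  qed
  have int12: "integrable lborel (\<lambda>w. conv (e k) (\<lambda>z. V z $ i) w * indicator S w * m1 k i w)"
    "integrable lborel (\<lambda>w. conv (e k) (\<lambda>z. V z $ i) w * conv (e k) (\<lambda>z. H z $ i) w * m2 k w)" for k i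
  proof -
    obtain L1 L2 where L: "\<And>k w. \<bar>m1 k i w\<bar> \<le> L1" "\<And>k w. \<bar>m2 k w\<bar> \<le> L2" using b1 b2 by metis
    show "integrable lborel (\<lambda>w. conv (e k) (\<lambda>z. V z $ i) w * indicator S w * m1 k i w)"
      by (rule integral_mult_bounded(1)[OF pairing_integrable[OF LV IS p] borel_measurable_continuous_onI[OF m1] L(1)])
    show "integrable lborel (\<lambda>w. conv (e k) (\<lambda>z. V z $ i) w * conv (e k) (\<lambda>z. H z $ i) w * m2 k w)"
      by (rule integral_mult_bounded(1)[OF pairing_integrable[OF LV LH p] borel_measurable_continuous_onI[OF m2] L(2)])
  qed
  have identity: "(LINT w|lborel. D ?t w * (max 0 (U k w)) ^ 3) =
      3 * (\<Sum>i\<in>UNIV. (LINT w|lborel. conv (e k) (\<lambda>z. V z $ i) w * indicator S w * m1 k i w) +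
        (LINT w|lborel. conv (e k) (\<lambda>z. V z $ i) w * conv (e k) (\<lambda>z. H z $ i) w * m2 k w))" for k
    unfolding time space split m1_def[symmetric] m2_def[symmetric] using int12 by simp
  have "(\<lambda>k. LINT w|lborel. D ?t w * (max 0 (U k w)) ^ 3) \<longlonglongrightarrow> 
      3 * (\<Sum>i\<in>UNIV. (LINT w|lborel. V w $ i * indicator S w * (D (?x i) w * (max 0 (u w))\<^sup>2)) +
        (LINT w|lborel. V w $ i * H w $ i * (\<zeta> w * (2 * max 0 (u w)))))"
    unfolding identity by (intro tendsto_intros lim1 lim2)
  moreover have "(\<lambda>k. LINT w|lborel. D ?t w * (max 0 (U k w)) ^ 3) \<longlonglongrightarrow> (LINT w|lborel. D ?t w * (max 0 (u w)) ^ 3)"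
  proof (rule integral_dominated_convergence)
    have "continuous_on UNIV (\<lambda>w. \<bar>D ?t w\<bar> * M ^ 3)"
      by (intro continuous_intros \<zeta> B)
    then show "integrable lborel (\<lambda>w. \<bar>D ?t w\<bar> * M ^ 3)"
      by (rule integrable_continuous_compact_support[OF _ S(1)]) (simp add: S)
    show "AE x in lborel. (\<lambda>k. D ?t x * (max 0 (U k x)) ^ 3) \<longlonglongrightarrow> D ?t x * (max 0 (u x)) ^ 3"
      by (intro AE_I2 tendsto_intros Ulim)
    show "AE x in lborel. norm (D ?t x * (max 0 (U k x)) ^ 3) \<le> \<bar>D ?t x\<bar> * M ^ 3" for k
      unfolding real_norm_def abs_mult power_abs
      by (intro AE_I2 mult_left_mono power_mono mx) auto
    have "continuous_on UNIV (\<lambda>w. D ?t w * (max 0 (u w)) ^ 3)"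
      by (intro continuous_intros \<zeta> B u)
    then show "(\<lambda>w. D ?t w * (max 0 (u w)) ^ 3) \<in> borel_measurable lborel"
      by (simp add: borel_measurable_continuous_onI)
  qed (use it(1) in auto)
  ultimately have eq: "(LINT w|lborel. D ?t w * (max 0 (u w)) ^ 3) =
      3 * (\<Sum>i\<in>UNIV. (LINT w|lborel. V w $ i * indicator S w * (D (?x i) w * (max 0 (u w))\<^sup>2)) +
        (LINT w|lborel. V w $ i * H w $ i * (\<zeta> w * (2 * max 0 (u w)))))"
    by (rule LIMSEQ_unique[rotated])
  \<comment> \<open>The gradient of \<zeta> vanishes where u > 0, so its term drops out. This works
    only after the limit, since the mollified U may be positive where u is not.\<close>
  have D0: "D (?x i) w * (max 0 (u w))\<^sup>2 = 0" for i w
    using D(1)[of w i] by (cases "0 < u w") auto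
  have "(\<Sum>i\<in>UNIV. LINT w|lborel. V w $ i * H w $ i * (\<zeta> w * (2 * max 0 (u w)))) =
      (LINT w|lborel. (\<Sum>i\<in>UNIV. V w $ i * H w $ i * (\<zeta> w * (2 * max 0 (u w)))))"
  proof (rule Bochner_Integration.integral_sum[symmetric])
    fix i
    have c: "continuous_on UNIV (\<lambda>w. \<zeta> w * (2 * max 0 (u w)))"
      by (intro continuous_intros \<zeta> u)
    have "\<exists>L. \<forall>w. \<bar>\<zeta> w * (2 * max 0 (u w))\<bar> \<le> L"
      by (rule bnd[OF c]) (simp add: S(2))
    then obtain L where L: "\<And>w. \<bar>\<zeta> w * (2 * max 0 (u w))\<bar> \<le> L" by blast
    from borel_measurable_continuous_onI[OF c] have "(\<lambda>w. \<zeta> w * (2 * max 0 (u w))) \<in> borel_measurable borel" .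
    then show "integrable lborel (\<lambda>w. V w $ i * H w $ i * (\<zeta> w * (2 * max 0 (u w))))"
      using L by (rule integral_mult_bounded(1)[OF pairing_integrable[OF V(1) H p]])
  qed
  also have "\<dots> = (LINT w|lborel. (V w \<bullet> H w) * (\<zeta> w * (2 * max 0 (u w))))"
    by (simp add: inner_vec_def sum_distrib_right)
  also have "\<dots> \<ge> 0"
    using \<zeta>(4) mono by (intro integral_nonneg_AE AE_I2 mult_nonneg_nonneg) auto
  \<comment> \<open>Monotonicity of the flux makes the time integral nonnegative, whereas its
    integrand is nonpositive everywhere and negative at z0.\<close>
  finally have ge: "0 \<le> (LINT w|lborel. D ?t w * (max 0 (u w)) ^ 3)"
    unfolding eq D0 by simp
  have cont: "continuous_on UNIV (\<lambda>w. - (D ?t w * (max 0 (u w)) ^ 3))"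
    by (intro continuous_intros \<zeta> B u)
  have "0 < (LINT w|lborel. - (D ?t w * (max 0 (u w)) ^ 3))"
  proof (rule integral_continuous_pos[OF cont, where ?x0.0 = z0])
    show "integrable lborel (\<lambda>w. - (D ?t w * (max 0 (u w)) ^ 3))"
      by (rule integrable_continuous_compact_support[OF cont S(1)]) (simp add: S)
    show "0 \<le> - (D ?t x * (max 0 (u x)) ^ 3)" for x
      using D(2)[of x] by (cases "0 < u x") (auto simp: mult_nonpos_nonneg)
    show "0 < - (D ?t z0 * (max 0 (u z0)) ^ 3)"
      using D(3,4) by (simp add: mult_neg_pos)
  qed
  then show False using ge by simp
qed

subsection \<open>Comparison of p-parabolic functions with the explicit family\<close>

text \<open>By Cauchy-Schwarz the expression is at least (|a|^(p-1) - |b|^(p-1)) (|a| - |b|), and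
  s^(p-1) is increasing for p > 1.\<close>

lemma flux_monotone:
  fixes a b :: "'a::real_inner"
  assumes p: "1 < p"
  shows "0 \<le> (norm a powr (p - 2) *\<^sub>R a - norm b powr (p - 2) *\<^sub>R b) \<bullet> (a - b)"
proof -
  have n: "norm x powr (p - 2) * norm x = norm x powr (p - 1)" for x :: 'a
    by (cases "x = 0") (auto simp: powr_diff power2_eq_square)
  have cs: "norm x powr (p - 2) * (x \<bullet> y) \<le> norm x powr (p - 1) * norm y" for x y :: 'a
    using mult_left_mono[OF norm_cauchy_schwarz[of x y], of "norm x powr (p - 2)"]
    by (simp add: n[symmetric] mult.assoc)
  have sq: "norm x powr (p - 2) * (x \<bullet> x) = norm x powr (p - 1) * norm x" for x :: 'a
    by (simp add: n[symmetric] dot_square_norm power2_eq_square mult.assoc)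
  have "0 \<le> (norm a powr (p - 1) - norm b powr (p - 1)) * (norm a - norm b)"
  proof (cases "norm a \<le> norm b")
    case True
    then have "norm a powr (p - 1) \<le> norm b powr (p - 1)" using p by (intro powr_mono2) auto
    then show ?thesis using True by (intro mult_nonpos_nonpos) auto
  next
    case False
    then have "norm b powr (p - 1) \<le> norm a powr (p - 1)" using p by (intro powr_mono2) auto
    then show ?thesis using False by (intro mult_nonneg_nonneg) auto
  qed
  also have "\<dots> \<le> (norm a powr (p - 2) *\<^sub>R a - norm b powr (p - 2) *\<^sub>R b) \<bullet> (a - b)"
    using cs[of a b] cs[of b a] sq[of a] sq[of b]
    by (simp add: inner_diff_left inner_diff_right inner_commute algebra_simps)
  finally show ?thesis .
qed

section \<open>A space-time cutoff and the kernel form of the weak equation\<close>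

text \<open>A C^1 function of the squared excess over \<open>cbox a' b'\<close>, times exp(-t). The
  exponential makes the time derivative strictly negative on the inner box, where the other factor
  is constant. Beyond the top of the inner box that factor decreases in time as well; this handles
  the top face, where no boundary values are prescribed.\<close>

lemma smooth_cutoff:
  fixes a b a' b' :: "(real ^ 'n) \<times> real"
  assumes ab: "\<And>i. i \<in> Basis \<Longrightarrow> a \<bullet> i < a' \<bullet> i" "\<And>i. i \<in> Basis \<Longrightarrow> b' \<bullet> i < b \<bullet> i"
  obtains \<zeta> D S \<mu> where "continuous_on UNIV \<zeta>" "\<And>e. e \<in> Basis \<Longrightarrow> continuous_on UNIV (D e)"
    "\<And>e z. e \<in> Basis \<Longrightarrow> ((\<lambda>s. \<zeta> (z + s *\<^sub>R e)) has_real_derivative D e z) (at 0)"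
    "\<And>z. 0 \<le> \<zeta> z" "compact S" "\<And>z. z \<notin> S \<Longrightarrow> \<zeta> z = 0" "\<And>z e. z \<notin> S \<Longrightarrow> D e z = 0"
    "0 < \<mu>" "\<mu> \<le> 1" "\<And>w. w \<in> S \<Longrightarrow> cball w \<mu> \<subseteq> box a b"
    "\<And>z e. e \<in> Basis \<Longrightarrow> a' \<bullet> e \<le> z \<bullet> e \<Longrightarrow> z \<bullet> e \<le> b' \<bullet> e \<Longrightarrow> snd e = 0 \<Longrightarrow> D e z = 0"
    "\<And>z. snd a' \<le> snd z \<Longrightarrow> D (0, 1) z \<le> 0"
    "\<And>z. z \<in> cbox a' b' \<Longrightarrow> D (0, 1) z < 0"
proof -
  define \<gamma> where "\<gamma> = Min ((\<lambda>i. min (a' \<bullet> i - a \<bullet> i) (b \<bullet> i - b' \<bullet> i)) ` Basis)"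
  have \<gamma>: "0 < \<gamma>" "\<And>i. i \<in> Basis \<Longrightarrow> \<gamma> \<le> a' \<bullet> i - a \<bullet> i" "\<And>i. i \<in> Basis \<Longrightarrow> \<gamma> \<le> b \<bullet> i - b' \<bullet> i"
  proof -
    show "0 < \<gamma>" unfolding \<gamma>_def using ab by (subst Min_gr_iff) auto
    fix i :: "(real ^ 'n) \<times> real" assume i: "i \<in> Basis"
    then have "\<gamma> \<le> min (a' \<bullet> i - a \<bullet> i) (b \<bullet> i - b' \<bullet> i)" unfolding \<gamma>_def by (intro Min_le) auto
    then show "\<gamma> \<le> a' \<bullet> i - a \<bullet> i" "\<gamma> \<le> b \<bullet> i - b' \<bullet> i" by auto
  qed
  \<comment> \<open>S lies in the \<mu>-enlargement of the inner box and the balls around its points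
    add another \<mu>; 2 \<mu> < \<gamma> fits into the smallest gap between the two boxes.\<close>
  define \<mu> where "\<mu> = min 1 (\<gamma> / 3)"
  have \<mu>: "0 < \<mu>" "\<mu> \<le> 1" "2 * \<mu> < \<gamma>" using \<gamma>(1) by (auto simp: \<mu>_def)
  define f where "f i z = (max 0 (a' \<bullet> i - z \<bullet> i))\<^sup>2 + (max 0 (z \<bullet> i - b' \<bullet> i))\<^sup>2" for i z :: "(real ^ 'n) \<times> real"
  define f' where "f' i z = 2 * max 0 (z \<bullet> i - b' \<bullet> i) - 2 * max 0 (a' \<bullet> i - z \<bullet> i)" for i z :: "(real ^ 'n) \<times> real"
  define N where "N z = (\<Sum>i\<in>Basis. f i z)" for z
  define \<zeta> where "\<zeta> z = (max 0 (1 - N z / \<mu>\<^sup>2))\<^sup>2 * exp (- snd z)" for z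
  define D where "D e z = (2 * max 0 (1 - N z / \<mu>\<^sup>2) * (- f' e z / \<mu>\<^sup>2) - (max 0 (1 - N z / \<mu>\<^sup>2))\<^sup>2 * snd e) * exp (- snd z)"
    for e z :: "(real ^ 'n) \<times> real"
  define S where "S = {z. N z \<le> \<mu>\<^sup>2}"
  have cN: "continuous_on UNIV N" unfolding N_def f_def by (intro continuous_intros)
  have f0: "0 \<le> f i z" for i z by (simp add: f_def)
  have dN: "((\<lambda>s. N (z + s *\<^sub>R e)) has_real_derivative f' e z) (at 0)" if e: "e \<in> Basis" for e z
  proof -
    have "((\<lambda>s. f i (z + s *\<^sub>R e)) has_real_derivative (if i = e then f' e z else 0)) (at 0)" if i: "i \<in> Basis" for i
    proof -
      have eq: "(z + s *\<^sub>R e) \<bullet> i = z \<bullet> i + s * (if i = e then 1 else 0)" for s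
        using i e by (simp add: inner_add_left inner_Basis)
      have d: "((\<lambda>s. a' \<bullet> i - (z + s *\<^sub>R e) \<bullet> i) has_real_derivative - (if i = e then 1 else 0)) (at 0)"
        "((\<lambda>s. (z + s *\<^sub>R e) \<bullet> i - b' \<bullet> i) has_real_derivative (if i = e then 1 else 0)) (at 0)"
        unfolding eq by (auto intro!: derivative_eq_intros)
      show ?thesis unfolding f_def
        by (rule DERIV_cong[OF DERIV_add[OF sq_pos_part_DERIV[OF d(1)] sq_pos_part_DERIV[OF d(2)]]])
          (simp add: f'_def eq)
    qed
    then have "((\<lambda>s. \<Sum>i\<in>Basis. f i (z + s *\<^sub>R e)) has_real_derivative (\<Sum>i\<in>Basis. if i = e then f' e z else 0)) (at 0)"
      by (intro DERIV_sum)
    then show ?thesis using e by (simp add: N_def)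
  qed
  have Sin: "a' \<bullet> i - \<mu> \<le> z \<bullet> i" "z \<bullet> i \<le> b' \<bullet> i + \<mu>" if "z \<in> S" "i \<in> Basis" for z i
  proof -
    have "f i z \<le> N z" unfolding N_def by (rule member_le_sum) (use that f0 in auto)
    then have "f i z \<le> \<mu>\<^sup>2" using that by (simp add: S_def)
    then have "(max 0 (a' \<bullet> i - z \<bullet> i))\<^sup>2 \<le> \<mu>\<^sup>2" "(max 0 (z \<bullet> i - b' \<bullet> i))\<^sup>2 \<le> \<mu>\<^sup>2"
      unfolding f_def by (smt (verit) zero_le_power2)+
    then have "max 0 (a' \<bullet> i - z \<bullet> i) \<le> \<mu>" "max 0 (z \<bullet> i - b' \<bullet> i) \<le> \<mu>"
      using \<mu>(1) by (auto intro: power2_le_imp_le)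
    then show "a' \<bullet> i - \<mu> \<le> z \<bullet> i" "z \<bullet> i \<le> b' \<bullet> i + \<mu>" by auto
  qed
  have cb: "cball w \<mu> \<subseteq> box a b" if w: "w \<in> S" for w
  proof
    fix z assume "z \<in> cball w \<mu>"
    then have "\<bar>z \<bullet> i - w \<bullet> i\<bar> \<le> \<mu>" if "i \<in> Basis" for i
      using Basis_le_norm[OF that, of "z - w"] by (simp add: inner_diff_left dist_norm norm_minus_commute)
    then show "z \<in> box a b"
      unfolding mem_box using Sin[OF w] \<gamma>(2,3) \<mu> by (smt (verit))
  qed
  have compS: "compact S"
  proof -
    have "closed S" unfolding S_def using cN by (intro closed_Collect_le) auto
    moreover have "S \<subseteq> box a b" using cb \<mu>(1) by (meson centre_in_cball less_imp_le subset_iff)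
    ultimately show ?thesis by (meson bounded_box bounded_subset compact_eq_bounded_closed)
  qed
  have out: "max 0 (1 - N z / \<mu>\<^sup>2) = 0" if "z \<notin> S" for z
    using that \<mu>(1) by (auto simp: S_def max_def field_simps)
  have deriv: "((\<lambda>s. \<zeta> (z + s *\<^sub>R e)) has_real_derivative D e z) (at 0)" if e: "e \<in> Basis" for e z
  proof -
    have d1: "((\<lambda>s. 1 - N (z + s *\<^sub>R e) / \<mu>\<^sup>2) has_real_derivative - f' e z / \<mu>\<^sup>2) (at 0)"
      by (rule DERIV_cong[OF DERIV_diff[OF DERIV_const DERIV_cdivide[OF dN[OF e]]]]) simp
    have d2: "((\<lambda>s. exp (- snd (z + s *\<^sub>R e))) has_real_derivative - snd e * exp (- snd z)) (at 0)"
      by (auto intro!: derivative_eq_intros)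
    show ?thesis unfolding \<zeta>_def
      by (rule DERIV_cong[OF DERIV_mult[OF sq_pos_part_DERIV[OF d1] d2]]) (simp add: D_def algebra_simps)
  qed
  have t: "((0::real ^ 'n), (1::real)) \<in> Basis" by (rule axis_in_Basis_prod)
  have inner_t: "z \<bullet> (0, 1) = snd z" for z :: "(real ^ 'n) \<times> real" by (cases z) simp
  show ?thesis
  proof (rule that[of \<zeta> D S \<mu>])
    show "continuous_on UNIV \<zeta>"
      unfolding \<zeta>_def using \<mu>(1) by (intro continuous_intros cN) auto
    show "continuous_on UNIV (D e)" for e
      unfolding D_def f'_def using \<mu>(1) by (intro continuous_intros cN) auto
    show "\<zeta> z = 0" if "z \<notin> S" for z using out[OF that] by (simp add: \<zeta>_def)
    show "D e z = 0" if "z \<notin> S" for z e using out[OF that] by (simp add: D_def)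
    show "D e z = 0" if "e \<in> Basis" "a' \<bullet> e \<le> z \<bullet> e" "z \<bullet> e \<le> b' \<bullet> e" "snd e = 0" for z e
      using that by (simp add: D_def f'_def)
    show "D (0, 1) z \<le> 0" if "snd a' \<le> snd z" for z
    proof -
      have "0 \<le> f' (0, 1) z" using that by (simp add: f'_def inner_t)
      then have "- f' (0, 1) z / \<mu>\<^sup>2 \<le> 0" by (simp add: divide_nonpos_nonneg)
      then have "2 * max 0 (1 - N z / \<mu>\<^sup>2) * (- f' (0, 1) z / \<mu>\<^sup>2) \<le> 0"
        by (intro mult_nonneg_nonpos) auto
      moreover have "0 \<le> (max 0 (1 - N z / \<mu>\<^sup>2))\<^sup>2" by (rule zero_le_power2)
      ultimately show ?thesis unfolding D_def
        by (intro mult_nonpos_nonneg) (simp_all only: snd_conv mult_1_right diff_le_0_iff_le exp_ge_zero order_trans)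
    qed
    show "D (0, 1) z < 0" if z: "z \<in> cbox a' b'" for z
    proof -
      have "f i z = 0" "f' i z = 0" if "i \<in> Basis" for i
        using z that by (auto simp: f_def f'_def mem_box)
      then show ?thesis using t by (simp add: D_def N_def)
    qed
  qed (use deriv compS \<mu> cb in \<open>auto simp: \<zeta>_def\<close>)
qed

lemma borel_measurable_vec_component [measurable (raw)]:
  fixes f :: "'a \<Rightarrow> real ^ 'n"
  assumes "f \<in> borel_measurable M"
  shows "(\<lambda>x. f x $ i) \<in> borel_measurable M"
  by (rule measurable_compose[OF assms])
    (intro borel_measurable_continuous_onI continuous_on_component continuous_on_id)

text \<open>The weak formulation is extracted in the form used by the energy estimate: tested with
  translates of \<open>moll\<close> and integrated over the whole space, with a Borel gradient that
  vanishes off C and a continuous extension of h.\<close>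

lemma weak_solution_kernel:
  fixes h h' :: "(real ^ 'n) \<times> real \<Rightarrow> real"
  assumes p: "1 < p" and U: "open U" and C: "C = U \<times> {t1<..<t2}"
    and h': "continuous_on UNIV h'" "\<And>z. z \<in> C \<Longrightarrow> h' z = h z"
    and G: "in_Lp_W1p p U t1 t2 (\<lambda>z. ereal (h z)) G"
    and weak: "\<And>\<phi>. \<phi> \<in> test_functions (U \<times> {t1<..<t2}) \<Longrightarrow>
         (LINT (x, t)|lebesgue_on (U \<times> {t1<..<t2}).
             (norm (G (x, t)) powr (p - 2) *\<^sub>R G (x, t)) \<bullet> grad (\<lambda>y. \<phi> (y, t)) x)
       - (LINT (x, t)|lebesgue_on (U \<times> {t1<..<t2}).
             real_of_ereal (ereal (h (x, t))) * deriv (\<lambda>s. \<phi> (x, s)) t) = 0"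
  shows "\<exists>g. g \<in> borel_measurable borel \<and> (\<forall>z. z \<notin> C \<longrightarrow> g z = 0) \<and> integrable lborel (\<lambda>z. norm (g z) powr p) \<and>
    (\<forall>w \<epsilon>. 0 < \<epsilon> \<longrightarrow> cball w \<epsilon> \<subseteq> C \<longrightarrow>
      (LINT z|lborel. (norm (g z) powr (p - 2) *\<^sub>R g z) \<bullet> (\<chi> i. dmoll \<epsilon> (axis i 1, 0) (z - w))) =
      (LINT z|lborel. h' z * dmoll \<epsilon> (0, 1) (z - w))) \<and>
    (\<forall>w \<epsilon> i. 0 < \<epsilon> \<longrightarrow> cball w \<epsilon> \<subseteq> C \<longrightarrow>
      (LINT z|lborel. h' z * dmoll \<epsilon> (axis i 1, 0) (z - w)) = - (LINT z|lborel. g z $ i * moll \<epsilon> (z - w)))"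
proof -
  let ?I = "{t1<..<t2}"
  have oC: "open C" unfolding C using U by (intro open_Times) auto
  have Cb [measurable]: "C \<in> sets borel" using oC by (rule borel_open)
  have Cl: "C \<in> sets lebesgue" using oC by (simp add: borel_open)
  have Ub: "U \<in> sets borel" "U \<in> sets lebesgue" using U by (simp_all add: borel_open)
  have GLp: "G \<in> borel_measurable (lebesgue_on C)" "integrable (lebesgue_on C) (\<lambda>z. norm (G z) powr p)"
    using G unfolding in_Lp_W1p_def in_Lp_def C by auto
  define Gc where "Gc z = indicator C z *\<^sub>R G z" for z
  have Gc [measurable]: "Gc \<in> borel_measurable lebesgue"
    unfolding Gc_def using GLp(1) Cl by (subst (asm) borel_measurable_restrict_space_iff) auto
  \<comment> \<open>\<open>G\<close> is only Lebesgue measurable jointly. A Borel representative,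
    taken componentwise, has Borel time slices and makes Fubini applicable on
    \<open>lborel\<close>.\<close>
  have "\<exists>g'\<in>borel_measurable lborel. AE z in lborel. Gc z $ i = g' z" for i
    by (rule completion_ex_borel_measurable_real) measurable
  then have "\<forall>i. \<exists>g'. g' \<in> borel_measurable borel \<and> (AE z in lborel. Gc z $ i = g' z)"
    by auto
  from choice[OF this] obtain gg where gg: "\<And>i. gg i \<in> borel_measurable borel" "\<And>i. AE z in lborel. Gc z $ i = gg i z"
    by blast
  define g where "g z = indicator C z *\<^sub>R (\<Sum>i\<in>UNIV. gg i z *\<^sub>R (axis i 1 :: real ^ 'n))" for z
  note [measurable] = gg(1)
  have g [measurable]: "g \<in> borel_measurable borel" unfolding g_def by measurable
  then have gl [measurable]: "g \<in> borel_measurable lebesgue" by (simp add: measurable_completion)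
  have "AE z in lborel. \<forall>i. Gc z $ i = gg i z" using gg(2) by (simp add: AE_all_countable)
  then have ae: "AE z in lborel. g z = Gc z"
  proof eventually_elim
    fix z assume z: "\<forall>i. Gc z $ i = gg i z"
    have "(\<Sum>i\<in>UNIV. gg i z *\<^sub>R (axis i 1 :: real ^ 'n)) $ j = gg j z" for j
      by (simp add: axis_def if_distrib[of "\<lambda>x. _ * x"] cong: if_cong)
    then show "g z = Gc z" using z
      by (cases "z \<in> C") (auto simp: vec_eq_iff g_def Gc_def)
  qed
  then have ael: "AE z in lebesgue. g z = Gc z" by (rule AE_completion)
  have g0: "g z = 0" if "z \<notin> C" for z using that by (simp add: g_def)
  have "integrable lebesgue (\<lambda>z. norm (Gc z) powr p)"
  proof -
    have "integrable lebesgue (\<lambda>z. indicator C z *\<^sub>R norm (G z) powr p)"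
      using GLp(2) Cl by (subst (asm) integrable_restrict_space) auto
    also have "(\<lambda>z. indicator C z *\<^sub>R norm (G z) powr p) = (\<lambda>z. norm (Gc z) powr p)"
      by (auto simp: Gc_def indicator_def fun_eq_iff)
    finally show ?thesis .
  qed
  then have "integrable lebesgue (\<lambda>z. norm (g z) powr p)"
  proof (rule integrable_cong_AE_imp)
    show "(\<lambda>z. norm (g z) powr p) \<in> borel_measurable lebesgue" by measurable
    show "AE z in lebesgue. norm (Gc z) powr p = norm (g z) powr p" using ael by eventually_elim simp
  qed
  then have gp: "integrable lborel (\<lambda>z. norm (g z) powr p)" by (subst (asm) integrable_completion) measurable
  have md: "((\<lambda>z. moll \<epsilon> (z - w)) has_derivative (\<lambda>e. dmoll \<epsilon> e (z - w))) (at z)" for \<epsilon> w and z :: "(real ^ 'n) \<times> real"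
  proof -
    have "((\<lambda>z. z - w) has_derivative (\<lambda>h. h)) (at z)" by (auto intro!: derivative_eq_intros)
    from has_derivative_compose[OF this moll_has_derivative] show ?thesis by simp
  qed
  have cd: "continuous_on UNIV (\<lambda>z::(real ^ 'n) \<times> real. dmoll \<epsilon> e (z - w))" if "e \<in> Basis" for \<epsilon> e w
    by (intro continuous_on_compose2[OF continuous_on_dmoll[OF that]] continuous_intros) auto
  have cm: "continuous_on UNIV (\<lambda>z::(real ^ 'n) \<times> real. moll \<epsilon> (z - w))" for \<epsilon> w
    by (intro continuous_on_compose2[OF continuous_on_moll] continuous_intros) auto
  have mz: "moll \<epsilon> (z - w) = 0" "dmoll \<epsilon> e (z - w) = 0" if "0 < \<epsilon>" "z \<notin> cball w \<epsilon>" for \<epsilon> e w and z :: "(real ^ 'n) \<times> real"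
    using that by (auto intro!: moll_eq_0 dmoll_eq_0 simp: dist_norm norm_minus_commute)
  have 1: "(LINT z|lborel. (norm (g z) powr (p - 2) *\<^sub>R g z) \<bullet> (\<chi> i. dmoll \<epsilon> (axis i 1, 0) (z - w))) =
      (LINT z|lborel. h' z * dmoll \<epsilon> (0, 1) (z - w))" if \<epsilon>: "0 < \<epsilon>" "cball w \<epsilon> \<subseteq> C" for w \<epsilon>
  proof -
    let ?d = "\<lambda>z. \<chi> i. dmoll \<epsilon> (axis i 1, 0) (z - w)"
    have "continuous_on UNIV ?d" by (intro continuous_on_vec_lambda cd axis_in_Basis_prod)
    then have d [measurable]: "?d \<in> borel_measurable borel" by (rule borel_measurable_continuous_onI)
    then have dl [measurable]: "?d \<in> borel_measurable lebesgue" by (simp add: measurable_completion)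
    have "(LINT z|lborel. (norm (g z) powr (p - 2) *\<^sub>R g z) \<bullet> ?d z) =
        (LINT z|lebesgue. (norm (g z) powr (p - 2) *\<^sub>R g z) \<bullet> ?d z)"
      by (rule integral_completion[symmetric]) measurable
    also have "\<dots> = (LINT z|lebesgue. (norm (Gc z) powr (p - 2) *\<^sub>R Gc z) \<bullet> ?d z)"
    proof (rule integral_cong_AE)
      show "AE z in lebesgue. (norm (g z) powr (p - 2) *\<^sub>R g z) \<bullet> ?d z = (norm (Gc z) powr (p - 2) *\<^sub>R Gc z) \<bullet> ?d z"
        using ael by eventually_elim simp
    qed measurable
    also have "\<dots> = (LINT z|lebesgue. indicator C z *\<^sub>R ((norm (G z) powr (p - 2) *\<^sub>R G z) \<bullet> ?d z))"
      by (intro Bochner_Integration.integral_cong) (auto simp: Gc_def indicator_def)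
    also have "\<dots> = (LINT z|lebesgue_on C. (norm (G z) powr (p - 2) *\<^sub>R G z) \<bullet> ?d z)"
      using Cl by (subst integral_restrict_space) auto
    also have "\<dots> = (LINT (x, t)|lebesgue_on C. (norm (G (x, t)) powr (p - 2) *\<^sub>R G (x, t)) \<bullet> grad (\<lambda>y. moll \<epsilon> ((y, t) - w)) x)"
    proof (rule Bochner_Integration.integral_cong[OF refl])
      have gr: "grad (\<lambda>y. moll \<epsilon> ((y, t) - w)) x = ?d (x, t)" for x t
        by (auto simp: vec_eq_iff grad_slice[OF md])
      fix z show "(norm (G z) powr (p - 2) *\<^sub>R G z) \<bullet> ?d z =
        (case z of (x, t) \<Rightarrow> (norm (G (x, t)) powr (p - 2) *\<^sub>R G (x, t)) \<bullet> grad (\<lambda>y. moll \<epsilon> ((y, t) - w)) x)"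
        by (cases z) (simp only: prod.case gr)
    qed
    also have "\<dots> = (LINT (x, t)|lebesgue_on C. real_of_ereal (ereal (h (x, t))) * deriv (\<lambda>s. moll \<epsilon> ((x, s) - w)) t)"
      using weak[OF moll_test_function[OF \<epsilon>(1)], of w] \<epsilon>(2) unfolding C by simp
    also have "\<dots> = (LINT z|lebesgue_on C. h' z * dmoll \<epsilon> (0, 1) (z - w))"
      by (rule Bochner_Integration.integral_cong[OF refl]) (auto simp: h' deriv_slice[OF md])
    also have "\<dots> = (LINT z|lborel. h' z * dmoll \<epsilon> (0, 1) (z - w))"
      by (rule lebesgue_on_compact_support(2)[OF _ compact_cball \<epsilon>(2) oC])
        (auto intro!: continuous_on_mult h' cd axis_in_Basis_prod simp: mz(2)[OF \<epsilon>(1)])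
    finally show ?thesis .
  qed
  \<comment> \<open>The weak spatial gradient is given on almost every time slice, so the space-time
    identity is obtained by integrating the slice identities over t.\<close>
  have 2: "(LINT z|lborel. h' z * dmoll \<epsilon> (axis i 1, 0) (z - w)) = - (LINT z|lborel. g z $ i * moll \<epsilon> (z - w))"
    if \<epsilon>: "0 < \<epsilon>" "cball w \<epsilon> \<subseteq> C" for w \<epsilon> i
  proof -
    let ?F1 = "\<lambda>x t. h' (x, t) * dmoll \<epsilon> (axis i 1, 0) ((x, t) - w)"
    let ?F2 = "\<lambda>x t. g (x, t) $ i * moll \<epsilon> ((x, t) - w)"
    have c1: "continuous_on UNIV (\<lambda>z. h' z * dmoll \<epsilon> (axis i 1, 0) (z - w))"
      by (intro continuous_on_mult h' cd axis_in_Basis_prod)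
    have i1: "integrable lborel (\<lambda>z. h' z * dmoll \<epsilon> (axis i 1, 0) (z - w))"
      by (rule integrable_continuous_compact_support[OF c1 compact_cball[of w \<epsilon>]]) (simp add: mz(2)[OF \<epsilon>(1)])
    have "Lp_fun p (\<lambda>z. g z $ i)"
    proof -
      have "integrable lborel (\<lambda>z. \<bar>g z $ i\<bar> powr p)"
        using gp by (rule Bochner_Integration.integrable_bound)
          (measurable, use p in \<open>auto intro!: powr_mono2 component_le_norm_cart\<close>)
      then show ?thesis by (simp add: Lp_fun_def)
    qed
    note i2 = integrable_mult_moll(1)[OF \<epsilon>(1) this p, of w]
    have e1: "(LINT z|lborel. h' z * dmoll \<epsilon> (axis i 1, 0) (z - w)) = (LINT t|lborel. LINT x|lborel. ?F1 x t)"
      and e2: "(LINT z|lborel. g z $ i * moll \<epsilon> (z - w)) = (LINT t|lborel. LINT x|lborel. ?F2 x t)"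
    proof -
      have "integrable (lborel \<Otimes>\<^sub>M lborel) (\<lambda>(x, t). ?F1 x t)" "integrable (lborel \<Otimes>\<^sub>M lborel) (\<lambda>(x, t). ?F2 x t)"
        using i1 i2 by (simp_all add: lborel_prod case_prod_beta')
      from this[THEN lborel_pair.integral_snd] show
        "(LINT z|lborel. h' z * dmoll \<epsilon> (axis i 1, 0) (z - w)) = (LINT t|lborel. LINT x|lborel. ?F1 x t)"
        "(LINT z|lborel. g z $ i * moll \<epsilon> (z - w)) = (LINT t|lborel. LINT x|lborel. ?F2 x t)"
        by (simp_all add: lborel_prod case_prod_beta')
    qed
    \<comment> \<open>A Borel null set contains all points where \<open>g\<close> and
      \<open>Gc\<close> differ. Almost all of its time slices are null, so on almost every slice
      \<open>g\<close> may replace \<open>G\<close>.\<close>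
    obtain N where N: "N \<in> null_sets lborel" "{z. g z \<noteq> Gc z} \<subseteq> N"
      using ae by (auto simp: eventually_ae_filter)
    have Nb: "N \<in> sets borel" using N(1) by auto
    have "AE z in lborel \<Otimes>\<^sub>M lborel. z \<notin> N"
      unfolding lborel_prod using N(1) by (rule AE_not_in)
    then have "AE x in lborel. AE t in lborel. (x, t) \<notin> N" by (rule lborel_pair.AE_pair)
    then have aeN: "AE t in lborel. AE x in lborel. (x, t) \<notin> N"
    proof (subst (asm) lborel_pair.AE_commute)
      have "- N \<in> sets (lborel \<Otimes>\<^sub>M lborel)" unfolding lborel_prod using Nb by simp
      moreover have "{x \<in> space (lborel \<Otimes>\<^sub>M lborel). (fst x, snd x) \<notin> N} = - N" by (auto simp: space_pair_measure)
      ultimately show "{x \<in> space (lborel \<Otimes>\<^sub>M lborel). (fst x, snd x) \<notin> N} \<in> sets (lborel \<Otimes>\<^sub>M lborel)" by simp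
    qed
    have "AE t in lebesgue_on ?I. in_W1p p U (\<lambda>x. h (x, t)) (\<lambda>x. G (x, t))"
      using G unfolding in_Lp_W1p_def by simp
    then have "AE t in lebesgue. t \<in> ?I \<longrightarrow> in_W1p p U (\<lambda>x. h (x, t)) (\<lambda>x. G (x, t))"
      by (subst (asm) AE_restrict_space_iff) auto
    then have aeW: "AE t in lborel. t \<in> ?I \<longrightarrow> in_W1p p U (\<lambda>x. h (x, t)) (\<lambda>x. G (x, t))"
      by (simp add: AE_completion_iff)
    have "AE t in lborel. (LINT x|lborel. ?F1 x t) = - (LINT x|lborel. ?F2 x t)"
      using aeN aeW
    proof eventually_elim
      fix t assume tN: "AE x in lborel. (x, t) \<notin> N" and tW: "t \<in> ?I \<longrightarrow> in_W1p p U (\<lambda>x. h (x, t)) (\<lambda>x. G (x, t))"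
      show "(LINT x|lborel. ?F1 x t) = - (LINT x|lborel. ?F2 x t)"
      proof (cases "t \<in> ?I")
        case False
        then have "(x, t) \<notin> cball w \<epsilon>" for x using \<epsilon>(2) by (auto simp: C)
        then have "moll \<epsilon> ((x, t) - w) = 0" "dmoll \<epsilon> (axis i 1, 0) ((x, t) - w) = 0" for x
          using mz[OF \<epsilon>(1)] by blast+
        then show ?thesis by simp
      next
        case True
        let ?\<phi> = "\<lambda>x. moll \<epsilon> ((x, t) - w)"
        let ?K = "fst ` cball w \<epsilon>"
        have K: "compact ?K" "?K \<subseteq> U"
          using \<epsilon>(2) unfolding C by (auto intro!: compact_continuous_image continuous_intros)
        have z: "moll \<epsilon> ((x, t) - w) = 0" "dmoll \<epsilon> e ((x, t) - w) = 0" if "x \<notin> ?K" for x e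
        proof -
          have "(x, t) \<notin> cball w \<epsilon>" using that by force
          then show "moll \<epsilon> ((x, t) - w) = 0" "dmoll \<epsilon> e ((x, t) - w) = 0" using mz[OF \<epsilon>(1)] by blast+
        qed
        have W: "(LINT x|lebesgue_on U. h (x, t) * grad ?\<phi> x $ i) = - (LINT x|lebesgue_on U. G (x, t) $ i * ?\<phi> x)"
          and Gm: "(\<lambda>x. G (x, t)) \<in> borel_measurable (lebesgue_on U)"
          using tW True moll_slice_test_function[OF \<epsilon>(1), of w U ?I t] \<epsilon>(2)
          unfolding in_W1p_def in_Lp_def C by auto
        have slice: "continuous_on UNIV (\<lambda>x::real ^ 'n. (x, t))" by (intro continuous_intros)
        have "(LINT x|lebesgue_on U. h (x, t) * grad ?\<phi> x $ i) = (LINT x|lebesgue_on U. ?F1 x t)"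
          using True by (intro Bochner_Integration.integral_cong) (auto simp: grad_slice[OF md] h'(2) C)
        also have "\<dots> = (LINT x|lborel. ?F1 x t)"
        proof (rule lebesgue_on_compact_support(2)[OF _ K U])
          show "continuous_on UNIV (\<lambda>x. ?F1 x t)"
            by (rule continuous_on_compose2[OF c1 slice]) auto
        qed (simp add: z)
        finally have L: "(LINT x|lebesgue_on U. h (x, t) * grad ?\<phi> x $ i) = (LINT x|lborel. ?F1 x t)" .
        have pm [measurable]: "?\<phi> \<in> borel_measurable borel"
          by (rule borel_measurable_continuous_onI) (rule continuous_on_compose2[OF cm slice], auto)
        then have pml [measurable]: "?\<phi> \<in> borel_measurable lebesgue" by (simp add: measurable_completion)
        have gs [measurable]: "(\<lambda>x. g (x, t) $ i) \<in> borel_measurable borel" by measurable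
        have gsl [measurable]: "(\<lambda>x. g (x, t) $ i) \<in> borel_measurable lebesgue" using gs by (simp add: measurable_completion)
        have Gs [measurable]: "(\<lambda>x. indicator U x *\<^sub>R G (x, t)) \<in> borel_measurable lebesgue"
          using Gm Ub(2) by (subst (asm) borel_measurable_restrict_space_iff) auto
        have "(LINT x|lebesgue_on U. G (x, t) $ i * ?\<phi> x) = (LINT x|lebesgue. indicator U x *\<^sub>R (G (x, t) $ i * ?\<phi> x))"
          using Ub(2) by (subst integral_restrict_space) auto
        also have "\<dots> = (LINT x|lebesgue. (indicator U x *\<^sub>R G (x, t)) $ i * ?\<phi> x)"
          by (simp add: mult.assoc)
        also have "\<dots> = (LINT x|lebesgue. ?F2 x t)"
        proof (rule integral_cong_AE)
          have "AE x in lebesgue. (x, t) \<notin> N" using tN by (rule AE_completion)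
          then show "AE x in lebesgue. (indicator U x *\<^sub>R G (x, t)) $ i * ?\<phi> x = ?F2 x t"
          proof eventually_elim
            fix x assume "(x, t) \<notin> N"
            then have "g (x, t) = Gc (x, t)" using N(2) by auto
            also have "\<dots> = indicator U x *\<^sub>R G (x, t)" using True by (auto simp: Gc_def C indicator_def)
            finally show "(indicator U x *\<^sub>R G (x, t)) $ i * ?\<phi> x = ?F2 x t" by simp
          qed
        qed measurable
        also have "\<dots> = (LINT x|lborel. ?F2 x t)" by (rule integral_completion) measurable
        finally show ?thesis using L W by simp
      qed
    qed
    then have "(LINT t|lborel. LINT x|lborel. ?F1 x t) = (LINT t|lborel. - (LINT x|lborel. ?F2 x t))"
    proof (rule integral_cong_AE[rotated 2])
      have [measurable]: "(\<lambda>z. h' z * dmoll \<epsilon> (axis i 1, 0) (z - w)) \<in> borel_measurable borel"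
        using c1 by (rule borel_measurable_continuous_onI)
      have "(\<lambda>(x, t). ?F1 x t) \<in> borel_measurable (lborel \<Otimes>\<^sub>M lborel)" unfolding lborel_prod by (simp add: case_prod_beta')
      then show "(\<lambda>t. LINT x|lborel. ?F1 x t) \<in> borel_measurable lborel" by measurable
      have "(\<lambda>z. g z $ i * moll \<epsilon> (z - w)) \<in> borel_measurable borel" by measurable
      then have "(\<lambda>(x, t). ?F2 x t) \<in> borel_measurable (lborel \<Otimes>\<^sub>M lborel)" unfolding lborel_prod by (simp add: case_prod_beta')
      then show "(\<lambda>t. - (LINT x|lborel. ?F2 x t)) \<in> borel_measurable lborel" by measurable
    qed
    then show ?thesis unfolding e1 e2 by simp
  qed
  show ?thesis by (intro exI[of _ g] conjI allI impI g g0 gp 1 2)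
qed

text \<open>Continuously differentiable functions satisfy the same kernel identities as weak
  solutions; this is how \<open>expl\<close> enters the energy estimate.\<close>

lemma moll_integration_by_parts:
  fixes f f' :: "'a::euclidean_space \<Rightarrow> real"
  assumes \<epsilon>: "0 < \<epsilon>" and e: "e \<in> Basis" and f: "continuous_on UNIV f" "continuous_on UNIV f'"
      "\<And>x. ((\<lambda>s. f (x + s *\<^sub>R e)) has_real_derivative f' x) (at 0)"
  shows "(LINT z|lborel. f z * dmoll \<epsilon> e (z - w)) = - (LINT z|lborel. f' z * moll \<epsilon> (z - w))"
proof -
  have cd: "continuous_on UNIV (\<lambda>z. dmoll \<epsilon> e (z - w))"
    by (intro continuous_on_compose2[OF continuous_on_dmoll[OF e]] continuous_intros) auto
  have cm: "continuous_on UNIV (\<lambda>z. moll \<epsilon> (z - w))"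
    by (intro continuous_on_compose2[OF continuous_on_moll] continuous_intros) auto
  have "((\<lambda>z. z - w) has_derivative (\<lambda>h. h)) (at z)" for z by (auto intro!: derivative_eq_intros)
  from has_derivative_compose[OF this moll_has_derivative]
  have fd: "frechet_derivative (\<lambda>z. moll \<epsilon> (z - w)) (at z) e = dmoll \<epsilon> e (z - w)" for z
    by (rule frechet_derivative_at[THEN fun_cong, symmetric])
  have t: "(\<lambda>z. moll \<epsilon> (z - w)) \<in> test_functions UNIV"
    using \<epsilon> by (rule moll_test_function) simp
  note * = test_function_integration_by_parts(1)[OF t open_UNIV e f, unfolded fd]
  have "(LINT z|lebesgue_on UNIV. f z * dmoll \<epsilon> e (z - w)) = (LINT z|lborel. f z * dmoll \<epsilon> e (z - w))"
    by (rule lebesgue_on_compact_support(2)[OF _ compact_cball[of w \<epsilon>]])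
      (auto intro!: continuous_on_mult f cd dmoll_eq_0 \<epsilon> simp: dist_norm norm_minus_commute)
  moreover have "(LINT z|lebesgue_on UNIV. f' z * moll \<epsilon> (z - w)) = (LINT z|lborel. f' z * moll \<epsilon> (z - w))"
    by (rule lebesgue_on_compact_support(2)[OF _ compact_cball[of w \<epsilon>]])
      (auto intro!: continuous_on_mult f cm moll_eq_0 \<epsilon> simp: dist_norm norm_minus_commute)
  ultimately show ?thesis using * by simp
qed

lemma Lp_fun_bounded_by:
  fixes f g :: "'a::euclidean_space \<Rightarrow> real"
  assumes [measurable]: "f \<in> borel_measurable borel" and "integrable lborel g" "\<And>x. \<bar>f x\<bar> powr p \<le> g x"
  shows "Lp_fun p f"
proof -
  have "integrable lborel (\<lambda>x. \<bar>f x\<bar> powr p)"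
    using assms(2)
  proof (rule Bochner_Integration.integrable_bound)
    show "AE x in lborel. norm (\<bar>f x\<bar> powr p) \<le> norm (g x)"
      using order_trans[OF assms(3) abs_ge_self] by (intro AE_I2) simp
  qed measurable
  then show ?thesis by (simp add: Lp_fun_def)
qed

lemma box_Times_box:
  fixes \<alpha> \<beta> :: "'a::euclidean_space" and s1 s2 :: real
  shows "box \<alpha> \<beta> \<times> {s1<..<s2} = box (\<alpha>, s1) (\<beta>, s2)"
  by (auto simp: box_def Basis_prod_def inner_prod_def)

lemma cbox_Times_box:
  fixes \<alpha> \<beta> :: "'a::euclidean_space" and s1 s2 :: real
  shows "cbox \<alpha> \<beta> \<times> {s1..s2} = cbox (\<alpha>, s1) (\<beta>, s2)"
  by (simp add: cbox_Pair_eq)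

lemma Basis_cart_prodE:
  fixes i :: "(real ^ 'n) \<times> real"
  assumes "i \<in> Basis"
  obtains j where "i = (axis j 1, 0)" | "i = (0, 1)"
  using assms by (auto simp: Basis_prod_def Basis_vec_def)

text \<open>The equation is odd, so -h is a solution too and h + expl is a difference of two
  solutions. Were it positive somewhere, then after subtracting a small \<delta> the set where it is
  nonnegative would keep away from the parabolic boundary, and the energy estimate with a cutoff
  around that set is contradictory.\<close>

lemma p_parabolic_le_expl:
  fixes \<alpha> \<beta> c :: "real ^ 'n" and h :: "(real ^ 'n) \<times> real \<Rightarrow> real"
  assumes p: "1 < p" "p < 2" and K: "K > 0" and h: "p_parabolic p W h"
    and \<alpha>\<beta>: "\<And>i. \<alpha> $ i < \<beta> $ i" and s: "s1 < s2"
    and ci: "compactly_inside (box \<alpha> \<beta> \<times> {s1<..<s2}) W"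
    and bd: "\<And>z. z \<in> parabolic_boundary (box \<alpha> \<beta>) s1 s2 \<Longrightarrow> expl p K c d z \<le> - h z"
    and z0: "z0 \<in> box \<alpha> \<beta> \<times> {s1<..<s2}"
  shows "expl p K c d z0 \<le> - h z0"
proof (rule ccontr)
  assume "\<not> expl p K c d z0 \<le> - h z0"
  \<comment> \<open>Half of the supposed gap: u equals \<delta> at z0 and is at most -\<delta> on
    the parabolic boundary.\<close>
  define \<delta> where "\<delta> = (h z0 + expl p K c d z0) / 2"
  have \<delta>: "\<delta> > 0" using \<open>\<not> expl p K c d z0 \<le> - h z0\<close> by (simp add: \<delta>_def)
  let ?C = "box \<alpha> \<beta> \<times> {s1<..<s2}"
  let ?a = "(\<alpha>, s1)" and ?b = "(\<beta>, s2)"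
  have C: "?C = box ?a ?b" by (rule box_Times_box)
  have ne: "box \<alpha> \<beta> \<noteq> {}" using \<alpha>\<beta> by (simp add: interval_ne_empty_cart)
  have clb: "closure (box \<alpha> \<beta>) = cbox \<alpha> \<beta>" using ne by (rule closure_box)
  have clC: "closure ?C = cbox ?a ?b"
    using s clb by (simp add: closure_Times cbox_Pair_eq)
  have CW: "cbox ?a ?b \<subseteq> W" using ci clC by (simp add: compactly_inside_def)
  have Csub: "?C \<subseteq> cbox ?a ?b" unfolding C by (rule box_subset_cbox)
  have hc: "continuous_on W h" using h by (simp add: p_parabolic_def)
  define u0 where "u0 z = h z + expl p K c d z - \<delta>" for z
  have "continuous_on (cbox ?a ?b) u0"
    unfolding u0_def by (intro continuous_intros continuous_on_subset[OF hc CW] continuous_on_expl p)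
  \<comment> \<open>Extension by clamping to the closed box gives a bounded continuous function on
    the whole space, as the mollification requires.\<close>
  define u where "u = ext_cont u0 ?a ?b"
  have uc: "continuous_on UNIV u" unfolding u_def
    by (intro continuous_on_ext_cont) fact
  have u_eq: "u z = h z + expl p K c d z - \<delta>" if "z \<in> cbox ?a ?b" for z
    using that by (simp add: u_def u0_def)
  have z0C: "z0 \<in> cbox ?a ?b" using z0 Csub by blast
  have uz0: "u z0 = \<delta>" using u_eq[OF z0C] by (simp add: \<delta>_def field_simps)
  have "bounded (u ` cbox ?a ?b)"
    by (intro compact_imp_bounded compact_continuous_image continuous_on_subset[OF uc]) auto
  then obtain M where M: "\<And>z. z \<in> cbox ?a ?b \<Longrightarrow> \<bar>u z\<bar> \<le> M"
    unfolding bounded_iff by (metis imageI real_norm_def)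
  have uM: "\<bar>u z\<bar> \<le> M" for z
  proof -
    have cl: "clamp ?a ?b z \<in> cbox ?a ?b"
      using z0C by (intro clamp_in_interval) (auto simp: mem_box intro: order_trans)
    then have "u z = u (clamp ?a ?b z)" by (simp add: u_def ext_cont_def)
    then show ?thesis using M[OF cl] by simp
  qed
  define P where "P = {z \<in> cbox ?a ?b. 0 \<le> u z}"
  have "P = cbox ?a ?b \<inter> {z. 0 \<le> u z}" by (auto simp: P_def)
  moreover have "closed {z. 0 \<le> u z}" by (intro closed_Collect_le continuous_on_const uc)
  ultimately have Pc: "compact P" by (simp add: compact_Int_closed)
  have z0P: "z0 \<in> P" using z0C uz0 \<delta> by (simp add: P_def)
  have Pin: "fst z \<in> box \<alpha> \<beta>" "s1 < snd z" if "z \<in> P" for z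
  proof -
    have z: "z \<in> cbox ?a ?b" "0 \<le> u z" using that by (auto simp: P_def)
    have "z \<notin> parabolic_boundary (box \<alpha> \<beta>) s1 s2"
    proof
      assume "z \<in> parabolic_boundary (box \<alpha> \<beta>) s1 s2"
      from bd[OF this] show False using z u_eq[OF z(1)] \<delta> by simp
    qed
    moreover have zz: "fst z \<in> cbox \<alpha> \<beta>" "s1 \<le> snd z" "snd z \<le> s2" using z(1) by (cases z; simp add: cbox_Pair_eq)+
    ultimately show s1: "s1 < snd z"
      unfolding parabolic_boundary_def clb by (cases z) force
    then show "fst z \<in> box \<alpha> \<beta>"
      using \<open>z \<notin> parabolic_boundary (box \<alpha> \<beta>) s1 s2\<close> zz
      unfolding parabolic_boundary_def frontier_def clb interior_open[OF open_box] by (cases z) auto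
  qed
  \<comment> \<open>Attained minima on the compact set P turn the strict inequalities at its points
    into uniform margins. They are used for the lateral faces and the bottom; P may reach the top
    face.\<close>
  have inf: "\<exists>m. L < m \<and> (\<forall>z\<in>P. m \<le> f z)" if "continuous_on P f" "\<And>z. z \<in> P \<Longrightarrow> L < f z" for f and L :: real
    using continuous_attains_inf[OF Pc _ that(1)] z0P that(2) by blast
  have "\<forall>i. \<exists>m. \<alpha> $ i < m \<and> (\<forall>z\<in>P. m \<le> fst z $ i)"
    by (intro allI inf continuous_intros) (use Pin in \<open>auto simp: mem_box_cart\<close>)
  then obtain ax where ax: "\<And>i. \<alpha> $ i < ax i" "\<And>i z. z \<in> P \<Longrightarrow> ax i \<le> fst z $ i" by metis
  have "\<forall>i. \<exists>m. - \<beta> $ i < m \<and> (\<forall>z\<in>P. m \<le> - fst z $ i)"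
    by (intro allI inf continuous_intros) (use Pin in \<open>auto simp: mem_box_cart\<close>)
  then obtain bx where bx: "\<And>i. - \<beta> $ i < bx i" "\<And>i z. z \<in> P \<Longrightarrow> bx i \<le> - fst z $ i" by metis
  have "\<exists>m. s1 < m \<and> (\<forall>z\<in>P. m \<le> snd z)"
    by (intro inf continuous_intros) (use Pin in auto)
  then obtain at' where at': "s1 < at'" "\<And>z. z \<in> P \<Longrightarrow> at' \<le> snd z" by blast
  define a' where "a' = ((\<chi> i. ax i) :: real ^ 'n, at')"
  \<comment> \<open>The top of the inner box is put at the time of z0: it stays strictly below s2,
    and z0 lies in the inner box, where the cutoff decreases strictly in time.\<close>
  define b' where "b' = ((\<chi> i. - bx i) :: real ^ 'n, snd z0)"
  have ab: "?a \<bullet> i < a' \<bullet> i" "b' \<bullet> i < ?b \<bullet> i" if "i \<in> Basis" for i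
    using that
  proof (atomize (full), cases rule: Basis_cart_prodE)
    case (1 j)
    then show "?a \<bullet> i < a' \<bullet> i \<and> b' \<bullet> i < ?b \<bullet> i"
      using ax(1)[of j] bx(1)[of j] by (simp add: a'_def b'_def inner_axis)
  next
    case 2
    then show "?a \<bullet> i < a' \<bullet> i \<and> b' \<bullet> i < ?b \<bullet> i"
      using at'(1) z0 by (cases z0) (simp add: a'_def b'_def)
  qed
  \<comment> \<open>Defined backwards from u, so that u = h' + expl - \<delta> holds on the whole
    space and not only in the box.\<close>
  define h' where "h' z = u z - expl p K c d z + \<delta>" for z
  have h': "continuous_on UNIV h'" "\<And>z. z \<in> ?C \<Longrightarrow> h' z = h z"
    using Csub u_eq by (auto simp: h'_def intro!: continuous_intros uc continuous_on_expl p)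
  have "weak_solution p W (\<lambda>z. ereal (h z))" using h by (simp add: p_parabolic_def)
  then obtain G where G: "in_Lp_W1p p (box \<alpha> \<beta>) s1 s2 (\<lambda>z. ereal (h z)) G"
    and weak: "\<And>\<phi>. \<phi> \<in> test_functions ?C \<Longrightarrow>
             (LINT (x, t)|lebesgue_on ?C. (norm (G (x, t)) powr (p - 2) *\<^sub>R G (x, t)) \<bullet> grad (\<lambda>y. \<phi> (y, t)) x)
           - (LINT (x, t)|lebesgue_on ?C. real_of_ereal (ereal (h (x, t))) * deriv (\<lambda>s. \<phi> (x, s)) t) = 0"
    unfolding weak_solution_def using s ci by (meson open_box)
  obtain g where g [measurable]: "g \<in> borel_measurable borel" and g0: "\<forall>z. z \<notin> ?C \<longrightarrow> g z = 0"
    and gp: "integrable lborel (\<lambda>z. norm (g z) powr p)"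
    and g1: "\<forall>w \<epsilon>. 0 < \<epsilon> \<longrightarrow> cball w \<epsilon> \<subseteq> ?C \<longrightarrow>
      (LINT z|lborel. (norm (g z) powr (p - 2) *\<^sub>R g z) \<bullet> (\<chi> i. dmoll \<epsilon> (axis i 1, 0) (z - w))) =
      (LINT z|lborel. h' z * dmoll \<epsilon> (0, 1) (z - w))"
    and g2: "\<forall>w \<epsilon> i. 0 < \<epsilon> \<longrightarrow> cball w \<epsilon> \<subseteq> ?C \<longrightarrow>
      (LINT z|lborel. h' z * dmoll \<epsilon> (axis i 1, 0) (z - w)) = - (LINT z|lborel. g z $ i * moll \<epsilon> (z - w))"
    by (rule exE[OF weak_solution_kernel[OF p(1) open_box refl h' G weak]])
      (assumption | (elim conjE, rule that; assumption))+
  let ?q = "p / (p - 1)"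
  define k where "k = (K * ?q) powr (p - 1)"
  define f where "f z = norm (g z) powr (p - 2) *\<^sub>R g z" for z
  define fe where "fe z = - k *\<^sub>R (fst z - c)" for z :: "(real ^ 'n) \<times> real"
  define eg where "eg z = expl_grad p K c (fst z)" for z :: "(real ^ 'n) \<times> real"
  have fe: "norm (eg z) powr (p - 2) *\<^sub>R eg z = fe z" for z
    unfolding eg_def fe_def k_def by (rule expl_flux[OF p(1) K])
  \<comment> \<open>Inside the box \<open>V\<close> and \<open>H\<close> are the differences of the
    fluxes and of the gradients of h and of the solution -expl. The indicator cuts off the explicit
    parts, which grow at infinity.\<close>
  define V where "V z = f z + indicator ?C z *\<^sub>R fe z" for z
  define H where "H z = g z + indicator ?C z *\<^sub>R eg z" for z
  have cfe: "continuous_on UNIV fe" unfolding fe_def by (intro continuous_intros)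
  have ceg: "continuous_on UNIV eg" unfolding eg_def
    by (intro continuous_on_compose2[OF continuous_on_expl_grad[OF p, where S = UNIV]] continuous_intros) auto
  have [measurable]: "fe \<in> borel_measurable borel" "eg \<in> borel_measurable borel"
    using cfe ceg by (auto intro: borel_measurable_continuous_onI)
  have oC: "open ?C" by (intro open_Times open_box) auto
  have Cb [measurable]: "?C \<in> sets borel" using oC by (rule borel_open)
  have bC: "bounded ?C" unfolding C by (rule bounded_box)
  have fm [measurable]: "f \<in> borel_measurable borel" unfolding f_def by measurable
  have bdd: "\<exists>L. \<forall>z. \<bar>- (indicator ?C z *\<^sub>R F z) $ i\<bar> \<le> L" if F: "continuous_on UNIV F" for F :: "(real ^ 'n) \<times> real \<Rightarrow> real ^ 'n" and i
  proof -
    have "bounded ((\<lambda>z. F z $ i) ` cbox ?a ?b)"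
      by (intro compact_imp_bounded compact_continuous_image continuous_on_component continuous_on_subset[OF F]) auto
    then obtain L where L: "\<And>z. z \<in> cbox ?a ?b \<Longrightarrow> \<bar>F z $ i\<bar> \<le> L"
      unfolding bounded_iff by (metis (mono_tags, lifting) imageI real_norm_def)
    have "\<bar>- (indicator ?C z *\<^sub>R F z) $ i\<bar> \<le> max L 0" for z
    proof (cases "z \<in> ?C")
      case True
      have "\<bar>F z $ i\<bar> \<le> L" by (rule L[OF subsetD[OF Csub True]])
      then show ?thesis using True by (simp add: max.coboundedI1)
    qed simp
    then show ?thesis by blast
  qed
  have Lfe: "Lp_fun r (\<lambda>z. - (indicator ?C z *\<^sub>R fe z) $ i)" if "0 \<le> r" for r i
  proof -
    obtain L where L: "\<And>z. \<bar>- (indicator ?C z *\<^sub>R fe z) $ i\<bar> \<le> L" using bdd[OF cfe] by blast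
    have "(\<lambda>z. - (indicator ?C z *\<^sub>R fe z) $ i) \<in> borel_measurable borel"
      by (intro borel_measurable_uminus borel_measurable_vec_component borel_measurable_scaleR
          borel_measurable_indicator Cb borel_measurable_continuous_onI[OF cfe])
    from Lp_fun_bounded_support[OF this L _ bC Cb that] show ?thesis by simp
  qed
  have Leg: "Lp_fun r (\<lambda>z. - (indicator ?C z *\<^sub>R eg z) $ i)" if "0 \<le> r" for r i
  proof -
    obtain L where L: "\<And>z. \<bar>- (indicator ?C z *\<^sub>R eg z) $ i\<bar> \<le> L" using bdd[OF ceg] by blast
    have "(\<lambda>z. - (indicator ?C z *\<^sub>R eg z) $ i) \<in> borel_measurable borel"
      by (intro borel_measurable_uminus borel_measurable_vec_component borel_measurable_scaleR
          borel_measurable_indicator Cb borel_measurable_continuous_onI[OF ceg])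
    from Lp_fun_bounded_support[OF this L _ bC Cb that] show ?thesis by simp
  qed
  have nf: "norm (f z) = norm (g z) powr (p - 1)" for z
    by (cases "g z = 0") (auto simp: f_def powr_diff power2_eq_square)
  have Lf: "Lp_fun ?q (\<lambda>z. f z $ i)" for i
  proof (rule Lp_fun_bounded_by[OF _ gp])
    fix z
    have "\<bar>f z $ i\<bar> powr ?q \<le> norm (f z) powr ?q"
      using p by (intro powr_mono2 component_le_norm_cart) auto
    also have "\<dots> = norm (g z) powr p" using p by (simp add: nf powr_powr)
    finally show "\<bar>f z $ i\<bar> powr ?q \<le> norm (g z) powr p" .
  qed measurable
  have Lg: "Lp_fun p (\<lambda>z. g z $ i)" for i
    by (rule Lp_fun_bounded_by[OF _ gp]) (measurable, use p in \<open>auto intro!: powr_mono2 component_le_norm_cart\<close>)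
  have q0: "0 \<le> ?q" "0 \<le> p" using p by auto
  have LV: "Lp_fun ?q (\<lambda>z. V z $ i)" for i
    using Lp_fun_diff(1)[OF Lf Lfe[OF q0(1)] q0(1), of i i] by (simp add: V_def)
  have LH: "Lp_fun p (\<lambda>z. H z $ i)" for i
    using Lp_fun_diff(1)[OF Lg Leg[OF q0(2)] q0(2), of i i] by (simp add: H_def)
  have IC: "Lp_fun p (indicator ?C :: (real ^ 'n) \<times> real \<Rightarrow> real)"
    by (rule Lp_fun_bounded_support[OF _ _ _ bC Cb, of _ 1]) (use p in auto)
  have f1: "integrable lborel (\<lambda>z. f z $ i)" for i
  proof -
    have "(\<lambda>z. f z $ i) = (\<lambda>z. f z $ i * indicator ?C z)"
      using g0 by (auto simp: fun_eq_iff f_def indicator_def)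
    then show ?thesis using pairing_integrable[OF Lf IC p(1)] by simp
  qed
  have fe1: "integrable lborel (\<lambda>z. indicator ?C z * fe z $ i)" for i
  proof -
    have "integrable lborel (\<lambda>z. - (- (indicator ?C z *\<^sub>R fe z) $ i * indicator ?C z))"
      by (intro integrable_minus pairing_integrable[OF Lfe[OF q0(1)] IC p(1)])
    also have "(\<lambda>z. - (- (indicator ?C z *\<^sub>R fe z) $ i * indicator ?C z)) = (\<lambda>z. indicator ?C z * fe z $ i)"
      by (auto simp: indicator_def fun_eq_iff)
    finally show ?thesis .
  qed
  have V1: "integrable lborel (\<lambda>z. V z $ i)" for i
    using f1[of i] fe1[of i] by (simp add: V_def)
  have mono: "0 \<le> V z \<bullet> H z" for z
  proof (cases "z \<in> ?C")
    case True
    then have "V z = norm (g z) powr (p - 2) *\<^sub>R g z - norm (- eg z) powr (p - 2) *\<^sub>R (- eg z)" "H z = g z - (- eg z)"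
      by (simp_all add: V_def H_def f_def fe)
    then show ?thesis using flux_monotone[OF p(1), of "g z" "- eg z"] by simp
  qed (simp add: V_def H_def f_def g0)
  have cd: "continuous_on UNIV (\<lambda>z::(real ^ 'n) \<times> real. dmoll \<epsilon> e (z - w))" if "e \<in> Basis" for \<epsilon> e w
    by (intro continuous_on_compose2[OF continuous_on_dmoll[OF that]] continuous_intros) auto
  have mz: "moll \<epsilon> (z - w) = 0" "dmoll \<epsilon> e (z - w) = 0" if "0 < \<epsilon>" "z \<notin> cball w \<epsilon>" for \<epsilon> e w and z :: "(real ^ 'n) \<times> real"
    using that by (auto intro!: moll_eq_0 dmoll_eq_0 simp: dist_norm norm_minus_commute)
  note B = axis_in_Basis_prod
  have ce: "continuous_on UNIV (expl p K c d)" by (rule continuous_on_expl[OF p(1)])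
  have int: "integrable lborel (\<lambda>z. F z * dmoll \<epsilon> e (z - w))" if "0 < \<epsilon>" "e \<in> Basis" "continuous_on UNIV F"
    for F \<epsilon> e and w :: "(real ^ 'n) \<times> real"
    by (rule integrable_continuous_compact_support[OF continuous_on_mult[OF that(3) cd[OF that(2)]] compact_cball[of w \<epsilon>]])
      (simp add: mz(2)[OF that(1)])
  \<comment> \<open>Derivatives of the kernel integrate to 0, so the shift by \<delta> does not show
    in the equations.\<close>
  have d0: "(LINT z|lborel. dmoll \<epsilon> e (z - w)) = 0" if "0 < \<epsilon>" "e \<in> Basis" for \<epsilon> e and w :: "(real ^ 'n) \<times> real"
    using moll_integration_by_parts[OF that, of "\<lambda>_. 1" "\<lambda>_. 0" w] by simp
  have hu: "(LINT z|lborel. u z * dmoll \<epsilon> e (z - w)) =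
      (LINT z|lborel. h' z * dmoll \<epsilon> e (z - w)) + (LINT z|lborel. expl p K c d z * dmoll \<epsilon> e (z - w))"
    if e: "0 < \<epsilon>" "e \<in> Basis" for \<epsilon> e w
  proof -
    have "(LINT z|lborel. u z * dmoll \<epsilon> e (z - w)) =
        (LINT z|lborel. h' z * dmoll \<epsilon> e (z - w) + expl p K c d z * dmoll \<epsilon> e (z - w) - \<delta> * dmoll \<epsilon> e (z - w))"
      by (intro Bochner_Integration.integral_cong) (auto simp: h'_def algebra_simps)
    also have "\<dots> = (LINT z|lborel. h' z * dmoll \<epsilon> e (z - w)) + (LINT z|lborel. expl p K c d z * dmoll \<epsilon> e (z - w))"
      using int[OF e h'(1), of w] int[OF e ce, of w] int[OF e continuous_on_const[of UNIV \<delta>], of w] d0[OF e, of w] by simp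
    finally show ?thesis .
  qed
  have ext: "((\<lambda>s. expl p K c d (z + s *\<^sub>R (0, 1))) has_real_derivative - (real CARD('n) * k)) (at 0)" for z
    using expl_time_derivative[of p K c d "fst z" "snd z"] by (cases z) (simp add: k_def)
  have exx: "((\<lambda>s. expl p K c d (z + s *\<^sub>R (axis i 1, 0))) has_real_derivative eg z $ i) (at 0)" for z i
    using expl_space_derivative[OF p(1), of K c d "fst z" i "snd z"] by (cases z) (simp add: eg_def)
  have fex: "((\<lambda>s. fe (z + s *\<^sub>R (axis i 1, 0)) $ i) has_real_derivative - k) (at 0)" for z i
    unfolding fe_def by (auto intro!: derivative_eq_intros simp: axis_def)
  have E1: "(\<Sum>i\<in>UNIV. LINT z|lborel. V z $ i * dmoll \<epsilon> (axis i 1, 0) (z - w)) = (LINT z|lborel. u z * dmoll \<epsilon> (0, 1) (z - w))"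
    if \<epsilon>: "0 < \<epsilon>" "cball w \<epsilon> \<subseteq> box ?a ?b" for w \<epsilon>
  proof -
    have \<epsilon>C: "cball w \<epsilon> \<subseteq> ?C" using \<epsilon>(2) C by simp
    have if1: "integrable lborel (\<lambda>z. f z $ i * dmoll \<epsilon> (axis i 1, 0) (z - w))" for i
    proof -
      obtain L where L: "\<And>x. \<bar>dmoll \<epsilon> (axis i 1, 0) (x :: (real ^ 'n) \<times> real)\<bar> \<le> L" by (rule bounded_dmoll[OF \<epsilon>(1) B(1)[of i]]) blast
      show ?thesis
        by (rule integral_mult_bounded(1)[OF f1 borel_measurable_continuous_onI[OF cd[OF B(1)]] L])
    qed
    have ife: "integrable lborel (\<lambda>z. fe z $ i * dmoll \<epsilon> (axis i 1, 0) (z - w))" for i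
      by (intro int \<epsilon> B continuous_on_component cfe)
    have "V z $ i * dmoll \<epsilon> (axis i 1, 0) (z - w) = f z $ i * dmoll \<epsilon> (axis i 1, 0) (z - w) + fe z $ i * dmoll \<epsilon> (axis i 1, 0) (z - w)"
      for z i
    proof (cases "z \<in> ?C")
      case False
      then have "z \<notin> cball w \<epsilon>" using \<epsilon>C by blast
      then show ?thesis using mz(2)[OF \<epsilon>(1)] by simp
    qed (simp add: V_def algebra_simps)
    then have "(\<Sum>i\<in>UNIV. LINT z|lborel. V z $ i * dmoll \<epsilon> (axis i 1, 0) (z - w)) =
      (\<Sum>i\<in>UNIV. LINT z|lborel. f z $ i * dmoll \<epsilon> (axis i 1, 0) (z - w)) +
      (\<Sum>i\<in>UNIV. LINT z|lborel. fe z $ i * dmoll \<epsilon> (axis i 1, 0) (z - w))"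
      using if1 ife by (simp add: sum.distrib)
    also have "(\<Sum>i\<in>UNIV. LINT z|lborel. f z $ i * dmoll \<epsilon> (axis i 1, 0) (z - w)) =
        (LINT z|lborel. f z \<bullet> (\<chi> i. dmoll \<epsilon> (axis i 1, 0) (z - w)))"
      using if1 by (subst Bochner_Integration.integral_sum[symmetric]) (auto simp: inner_vec_def)
    also have "\<dots> = (LINT z|lborel. h' z * dmoll \<epsilon> (0, 1) (z - w))"
      unfolding f_def by (rule g1[rule_format, OF \<epsilon>(1) \<epsilon>C])
    also have "(\<Sum>i\<in>UNIV. LINT z|lborel. fe z $ i * dmoll \<epsilon> (axis i 1, 0) (z - w)) =
        (\<Sum>i\<in>(UNIV :: 'n set). - (LINT z|lborel. - k * moll \<epsilon> (z - w)))"
      by (intro sum.cong refl moll_integration_by_parts[OF \<epsilon>(1) B(1)] continuous_on_component cfe continuous_on_const fex)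
    also have "\<dots> = - (LINT z|lborel. - (real CARD('n) * k) * moll \<epsilon> (z - w))" by simp
    also have "\<dots> = (LINT z|lborel. expl p K c d z * dmoll \<epsilon> (0, 1) (z - w))"
      by (rule moll_integration_by_parts[OF \<epsilon>(1) B(2) ce continuous_on_const ext, symmetric])
    finally show ?thesis unfolding hu[OF \<epsilon>(1) B(2)] .
  qed
  have E2: "(LINT z|lborel. u z * dmoll \<epsilon> (axis i 1, 0) (z - w)) = - (LINT z|lborel. H z $ i * moll \<epsilon> (z - w))"
    if \<epsilon>: "0 < \<epsilon>" "cball w \<epsilon> \<subseteq> box ?a ?b" for w \<epsilon> i
  proof -
    have \<epsilon>C: "cball w \<epsilon> \<subseteq> ?C" using \<epsilon>(2) C by simp
    have ceg': "continuous_on UNIV (\<lambda>z. eg z $ i)" by (intro continuous_on_component ceg)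
    have cm: "continuous_on UNIV (\<lambda>z. moll \<epsilon> (z - w))"
      by (intro continuous_on_compose2[OF continuous_on_moll] continuous_intros) auto
    have i1: "integrable lborel (\<lambda>z. g z $ i * moll \<epsilon> (z - w))"
      by (rule integrable_mult_moll(1)[OF \<epsilon>(1) Lg p(1)])
    have i2: "integrable lborel (\<lambda>z. eg z $ i * moll \<epsilon> (z - w))"
      by (rule integrable_continuous_compact_support[OF continuous_on_mult[OF ceg' cm] compact_cball[of w \<epsilon>]])
        (simp add: mz(1)[OF \<epsilon>(1)])
    have "H z $ i * moll \<epsilon> (z - w) = g z $ i * moll \<epsilon> (z - w) + eg z $ i * moll \<epsilon> (z - w)" for z
    proof (cases "z \<in> ?C")
      case False
      then have "z \<notin> cball w \<epsilon>" using \<epsilon>C by blast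
      then show ?thesis using mz(1)[OF \<epsilon>(1)] by simp
    qed (simp add: H_def algebra_simps)
    then have "(LINT z|lborel. H z $ i * moll \<epsilon> (z - w)) =
        (LINT z|lborel. g z $ i * moll \<epsilon> (z - w)) + (LINT z|lborel. eg z $ i * moll \<epsilon> (z - w))"
      using i1 i2 by simp
    then show ?thesis
      unfolding hu[OF \<epsilon>(1) B(1)] g2[rule_format, OF \<epsilon>(1) \<epsilon>C] moll_integration_by_parts[OF \<epsilon>(1) B(1) ce ceg' exx] by simp
  qed
  show False
  proof (rule smooth_cutoff[where a = ?a and b = ?b and a' = a' and b' = b', OF ab])
    fix \<zeta> D S \<mu>
    assume \<zeta>: "continuous_on UNIV \<zeta>" "\<And>e. e \<in> Basis \<Longrightarrow> continuous_on UNIV (D e)"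
      "\<And>e z. e \<in> Basis \<Longrightarrow> ((\<lambda>s. \<zeta> (z + s *\<^sub>R e)) has_real_derivative D e z) (at 0)"
      "\<And>z. 0 \<le> \<zeta> z" and S: "compact S" "\<And>z. z \<notin> S \<Longrightarrow> \<zeta> z = 0" "\<And>z e. z \<notin> S \<Longrightarrow> D e z = 0"
      "0 < \<mu>" "\<mu> \<le> 1" "\<And>w. w \<in> S \<Longrightarrow> cball w \<mu> \<subseteq> box ?a ?b"
      and D: "\<And>z e. e \<in> Basis \<Longrightarrow> a' \<bullet> e \<le> z \<bullet> e \<Longrightarrow> z \<bullet> e \<le> b' \<bullet> e \<Longrightarrow> snd e = 0 \<Longrightarrow> D e z = 0"
      "\<And>z. snd a' \<le> snd z \<Longrightarrow> D (0, 1) z \<le> 0"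
      "\<And>z. z \<in> cbox a' b' \<Longrightarrow> D (0, 1) z < 0"
    \<comment> \<open>S lies in the open box, so a point of S with u > 0 belongs to P, where the
      derivatives of the cutoff have the required signs; outside S they vanish.\<close>
    have SP: "z \<in> P" if "0 < u z" "z \<in> S" for z
    proof -
      have "z \<in> box ?a ?b" using S(6)[OF that(2)] S(4) by (meson centre_in_cball less_imp_le subset_iff)
      then show ?thesis using that(1) box_subset_cbox by (auto simp: P_def)
    qed
    have Dx: "D (axis i 1, 0) z = 0" if "0 < u z" for z i
    proof (cases "z \<in> S")
      case True
      from SP[OF that True] have "ax i \<le> fst z $ i" "fst z $ i \<le> - bx i" using ax(2) bx(2)[of z i] by auto
      then show ?thesis
        by (intro D(1) axis_in_Basis_prod) (cases z; simp add: a'_def b'_def inner_axis)+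
    qed (rule S(3))
    have Dt: "D (0, 1) z \<le> 0" if "0 < u z" for z
    proof (cases "z \<in> S")
      case True
      show ?thesis by (rule D(2)) (use at'(2)[OF SP[OF that True]] in \<open>simp add: a'_def\<close>)
    qed (simp add: S(3))
    have Dz0: "D (0, 1) z0 < 0"
    proof (rule D(3))
      have "ax i \<le> fst z0 $ i" "fst z0 $ i \<le> - bx i" for i using ax(2)[OF z0P] bx(2)[OF z0P, of i] by auto
      then show "z0 \<in> cbox a' b'" using at'(2)[OF z0P]
        by (cases z0) (simp add: a'_def b'_def cbox_Pair_eq mem_box_cart)
    qed
    show False
      by (rule weak_comparison_core[OF uc uM p(1) LV V1 LH E1 E2 mono \<zeta> S Dx Dt _ Dz0]) (use uz0 \<delta> in simp_all)
  qed
qed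

subsection \<open>Touching from below and the barrier\<close>

text \<open>The common property of superparabolic functions and of negatives of p-parabolic ones,
  isolated so that one touching argument serves both.\<close>

definition expl_comparison :: "real \<Rightarrow> ((real ^ 'n) \<times> real) set \<Rightarrow> ((real ^ 'n) \<times> real \<Rightarrow> ereal) \<Rightarrow> bool" where
  "expl_comparison p \<Omega> u \<longleftrightarrow>
    (\<forall>\<alpha> \<beta> s1 s2 K c d. (\<forall>i. \<alpha> $ i < \<beta> $ i) \<and> s1 < s2 \<and> compactly_inside (box \<alpha> \<beta> \<times> {s1<..<s2}) \<Omega> \<and> 0 < K \<and>
      (\<forall>z\<in>parabolic_boundary (box \<alpha> \<beta>) s1 s2. ereal (expl p K c d z) \<le> u z) \<longrightarrow>
      (\<forall>z\<in>box \<alpha> \<beta> \<times> {s1<..<s2}. ereal (expl p K c d z) \<le> u z))"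

text \<open>Mean value theorem with a strictly increasing derivative. Strictness is what keeps the
  explicit solution away from v on the sides of the small box.\<close>

lemma powr_tangent_strict:
  fixes s c p :: real
  assumes p: "1 < p" and s: "0 \<le> s" and c: "0 < c" and ne: "s \<noteq> c"
  shows "c powr p + p * c powr (p - 1) * (s - c) < s powr p"
proof (cases "s = 0")
  case True
  have "c powr (p - 1) * c = c powr p" using c by (simp add: powr_diff)
  then have "c powr p + p * c powr (p - 1) * (s - c) = (1 - p) * c powr p"
    using True by (simp add: algebra_simps)
  also have "\<dots> < 0" using p c by (intro mult_neg_pos) auto
  finally show ?thesis using True p by simp
next
  case False
  then have s: "0 < s" using s by simp
  have d: "((\<lambda>x. x powr p) has_real_derivative p * x powr (p - 1)) (at x)" if "0 < x" for x
    using that by (rule has_real_derivative_powr)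
  show ?thesis
  proof (cases "c < s")
    case True
    obtain \<xi> where \<xi>: "c < \<xi>" "\<xi> < s" "s powr p - c powr p = (s - c) * (p * \<xi> powr (p - 1))"
      using MVT2[OF True, of "\<lambda>x. x powr p" "\<lambda>x. p * x powr (p - 1)"] d c by force
    have "p * c powr (p - 1) < p * \<xi> powr (p - 1)"
      using p c \<xi> by (intro mult_strict_left_mono powr_less_mono2) auto
    then have "(s - c) * (p * c powr (p - 1)) < (s - c) * (p * \<xi> powr (p - 1))"
      by (rule mult_strict_left_mono) (use True in simp)
    then show ?thesis using \<xi>(3) by (simp add: mult.commute)
  next
    case False
    then have sc: "s < c" using ne by simp
    obtain \<xi> where \<xi>: "s < \<xi>" "\<xi> < c" "c powr p - s powr p = (c - s) * (p * \<xi> powr (p - 1))"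
      using MVT2[OF sc, of "\<lambda>x. x powr p" "\<lambda>x. p * x powr (p - 1)"] d s by force
    have "p * \<xi> powr (p - 1) < p * c powr (p - 1)"
      using p s \<xi> by (intro mult_strict_left_mono powr_less_mono2) auto
    then have "(c - s) * (p * \<xi> powr (p - 1)) < (c - s) * (p * c powr (p - 1))"
      by (rule mult_strict_left_mono) (use sc in simp)
    then show ?thesis using \<xi>(3) by (simp add: algebra_simps)
  qed
qed

text \<open>An explicit solution centred at \<open>x0 / 2\<close> fits strictly below \<open>v\<close> near the touching
  point: on the time slice this is convexity of \<open>s powr p'\<close> together with the triangle inequality.\<close>

lemma touching_contradiction:
  fixes v :: "(real ^ 'n) \<times> real \<Rightarrow> real" and u :: "(real ^ 'n) \<times> real \<Rightarrow> ereal"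
  assumes p: "1 < p" "p < 2" and \<Omega>: "open \<Omega>" "(x0, t0) \<in> \<Omega>" and x0: "x0 \<noteq> 0" and q: "0 < q"
    and v: "continuous_on \<Omega> v" and cmp: "expl_comparison p \<Omega> u"
    and below: "\<And>z. z \<in> \<Omega> \<Longrightarrow> ereal (v z + m) \<le> u z" and touch: "u (x0, t0) = ereal (v (x0, t0) + m)"
    and slope: "\<And>x. (x, t0) \<in> \<Omega> \<Longrightarrow> - q * (norm x - norm x0) \<le> v (x, t0) - v (x0, t0)"
    and r: "0 < r"
    and time: "\<And>x t. (x, t) \<in> \<Omega> \<Longrightarrow> (x, t0) \<in> \<Omega> \<Longrightarrow> dist x x0 < r \<Longrightarrow> t < t0 \<Longrightarrow>
      real CARD('n) * (q powr (p - 1) / (norm x0 / 2)) * (t0 - t) < v (x, t) - v (x, t0)"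
  shows False
proof -
  define R where "R = norm x0 / 2"
  define c where "c = (1 / 2) *\<^sub>R x0"
  define p' where "p' = p / (p - 1)"
  \<comment> \<open>\<open>K\<close> makes K s^p' have slope q at s = R, matching the bound on the
    radial slope of v at x0. The decay rate in time that results is n q^(p-1) / R.\<close>
  define K where "K = q / (p' * R powr (p' - 1))"
  have R: "0 < R" "norm c = R" "norm (x0 - c) = R"
  proof -
    show "0 < R" using x0 by (simp add: R_def)
    show "norm c = R" by (simp add: c_def R_def)
    have "x0 - c = c" by (simp add: c_def scaleR_2[symmetric] algebra_simps flip: scaleR_left_distrib)
    then show "norm (x0 - c) = R" by (simp only:) (simp add: c_def R_def)
  qed
  have p': "1 < p'" "(p' - 1) * (p - 1) = 1" using p by (simp_all add: p'_def field_simps)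
  have K: "0 < K" using q p' R by (simp add: K_def)
  have Kq: "K * p' * R powr (p' - 1) = q" using p' R by (simp add: K_def)
  have "(K * p') powr (p - 1) * R = (K * p') powr (p - 1) * (R powr (p' - 1)) powr (p - 1)"
    using R p' by (simp add: powr_powr)
  also have "\<dots> = q powr (p - 1)" unfolding Kq[symmetric] by (rule powr_mult[symmetric])
  finally have k: "(K * p') powr (p - 1) = q powr (p - 1) / R" using R by (simp add: field_simps)
  define d where "d = v (x0, t0) + m - expl p K c 0 (x0, t0)"
  define D where "D z = v z + m - expl p K c d z" for z
  define \<kappa> where "\<kappa> = real CARD('n) * (q powr (p - 1) / R)"
  have expl: "expl p K c e (x, t) = e - \<kappa> * t - K * norm (x - c) powr p'" for e x t
    by (simp add: expl_def p'_def[symmetric] k \<kappa>_def)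
  have D0: "D (x0, t0) = 0" by (simp add: D_def d_def expl)
  \<comment> \<open>The ball of radius R about c touches the ball of radius 2R about the origin from
    inside, only at x0. Off the sphere of radius R about c the convexity estimate is strict; on that
    sphere the triangle inequality is strict except at x0.\<close>
  have Dslice: "0 < D (x, t0)" if "(x, t0) \<in> \<Omega>" "x \<noteq> x0" for x
  proof -
    have eq: "D (x, t0) = v (x, t0) - v (x0, t0) + K * (norm (x - c) powr p' - R powr p')"
      by (simp add: D_def d_def expl R(3) algebra_simps)
    have tri: "norm x \<le> norm (x - c) + R" using norm_triangle_ineq[of "x - c" c] R by simp
    have q_eq: "K * (p' * R powr (p' - 1) * (norm (x - c) - R)) = q * (norm (x - c) - R)"
      using Kq by (simp add: mult.assoc)
    have n0: "norm x0 = 2 * R" by (simp add: R_def)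
    show ?thesis
    proof (cases "norm (x - c) = R")
      case False
      have "R powr p' + p' * R powr (p' - 1) * (norm (x - c) - R) < norm (x - c) powr p'"
        using powr_tangent_strict[OF p'(1) norm_ge_zero R(1) False] .
      then have "K * (p' * R powr (p' - 1) * (norm (x - c) - R)) < K * (norm (x - c) powr p' - R powr p')"
        using K by (intro mult_strict_left_mono) auto
      then have "- q * (norm x - norm x0) + q * (norm (x - c) - R) < D (x, t0)"
        using slope[OF that(1)] eq q_eq by linarith
      moreover have "- q * (norm x - norm x0) + q * (norm (x - c) - R) = q * (norm (x - c) + R - norm x)"
        by (simp add: n0 algebra_simps)
      moreover have "0 \<le> q * (norm (x - c) + R - norm x)" using q tri by (intro mult_nonneg_nonneg) auto
      ultimately show ?thesis by linarith
    next
      case True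
      have "norm x \<noteq> norm (x - c) + norm c"
      proof
        assume "norm x = norm (x - c) + norm c"
        then have "norm ((x - c) + c) = norm (x - c) + norm c" by simp
        then have "norm (x - c) *\<^sub>R c = norm c *\<^sub>R (x - c)" by (simp only: norm_triangle_eq)
        then have "R *\<^sub>R c = R *\<^sub>R (x - c)" using True R by simp
        then have "x = c + c" using R by simp
        also have "\<dots> = x0" by (simp add: c_def flip: scaleR_left_distrib)
        finally show False using that by simp
      qed
      then have "norm x - norm x0 < 0" using tri True R n0 by linarith
      then have "0 < - q * (norm x - norm x0)" using q mult_pos_neg[of q "norm x - norm x0"] by simp
      then show ?thesis using slope[OF that(1)] eq True by simp
    qed
  qed
  have Dslice0: "0 \<le> D (x, t0)" if "(x, t0) \<in> \<Omega>" for x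
    using Dslice[OF that] D0 by (cases "x = x0") auto
  have Dtime: "0 < D (x, t)" if "(x, t) \<in> \<Omega>" "(x, t0) \<in> \<Omega>" "dist x x0 < r" "t < t0" for x t
  proof -
    have "D (x, t) - D (x, t0) = v (x, t) - v (x, t0) - \<kappa> * (t0 - t)"
      by (simp add: D_def expl algebra_simps)
    then show ?thesis using time[OF that] Dslice0[OF that(2)] by (simp add: R_def \<kappa>_def)
  qed
  have "open (\<Omega> \<inter> ball x0 r \<times> UNIV)" using \<Omega> by (intro open_Int open_Times) auto
  moreover have "(x0, t0) \<in> \<Omega> \<inter> ball x0 r \<times> UNIV" using \<Omega> r by simp
  ultimately obtain a b where ab: "cbox a b \<subseteq> \<Omega> \<inter> ball x0 r \<times> UNIV" "(x0, t0) \<in> box a b" "\<And>i. i \<in> Basis \<Longrightarrow> a \<bullet> i < b \<bullet> i"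
    by (rule open_contains_cbox) blast
  obtain a1 ta where a: "a = (a1, ta)" by (cases a)
  obtain b1 tb where b: "b = (b1, tb)" by (cases b)
  have sub: "cbox a1 b1 \<times> {ta..tb} \<subseteq> \<Omega> \<inter> ball x0 r \<times> UNIV"
    using ab(1) by (simp only: a b cbox_Times_box)
  have "(x0, t0) \<in> box a1 b1 \<times> {ta<..<tb}"
    using ab(2) by (simp only: a b box_Times_box)
  then have x0b: "x0 \<in> box a1 b1" and tt: "ta < t0" "t0 < tb" by auto
  have cb: "cbox a1 b1 \<times> {ta..tb} \<subseteq> \<Omega>" "\<And>x. x \<in> cbox a1 b1 \<Longrightarrow> dist x x0 < r"
  proof -
    show "cbox a1 b1 \<times> {ta..tb} \<subseteq> \<Omega>" using sub by blast
    fix x assume "x \<in> cbox a1 b1"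
    then have "(x, t0) \<in> cbox a1 b1 \<times> {ta..tb}" using tt by simp
    then have "(x, t0) \<in> ball x0 r \<times> UNIV" using sub by blast
    then show "dist x x0 < r" by (simp add: dist_commute)
  qed
  have lt: "a1 $ i < b1 $ i" for i
    using ab(3)[OF axis_in_Basis_prod(1)[of i]] by (simp add: a b inner_axis)
  have ne: "box a1 b1 \<noteq> {}" using x0b by blast
  have clb: "closure (box a1 b1) = cbox a1 b1" using ne by (rule closure_box)
  define F where "F = frontier (box a1 b1)"
  have F: "compact F" "F \<subseteq> cbox a1 b1" "x0 \<notin> F"
    using x0b unfolding F_def frontier_def clb interior_open[OF open_box] by (auto intro!: compact_diff)
  have Dc: "continuous_on \<Omega> D"
    unfolding D_def by (intro continuous_intros v continuous_on_expl p)
  have ct: "compact (cbox a1 b1 \<times> {ta..tb})" by (intro compact_Times) auto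
  \<comment> \<open>The hypothesis \<open>time\<close> concerns times before t0 only. Positivity on
    the lateral faces at time t0 is carried a little further by uniform continuity.\<close>
  have "\<exists>\<sigma>>0. \<forall>x\<in>F. \<forall>t\<in>{t0..t0 + \<sigma>}. t \<le> tb \<longrightarrow> 0 < D (x, t)"
  proof (cases "F = {}")
    case False
    have "continuous_on F (\<lambda>x. D (x, t0))"
      by (rule continuous_on_compose2[OF Dc]) (use F cb tt in \<open>auto intro!: continuous_intros\<close>)
    then obtain y where y: "y \<in> F" "\<And>x. x \<in> F \<Longrightarrow> D (y, t0) \<le> D (x, t0)"
      using continuous_attains_inf[OF F(1) False] by blast
    have pos: "0 < D (y, t0)" using y F cb tt by (intro Dslice) auto
    have "uniformly_continuous_on (cbox a1 b1 \<times> {ta..tb}) D"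
      by (rule compact_uniformly_continuous[OF continuous_on_subset[OF Dc cb(1)] ct])
    then obtain \<sigma> where \<sigma>: "0 < \<sigma>" "\<And>z z'. z \<in> cbox a1 b1 \<times> {ta..tb} \<Longrightarrow> z' \<in> cbox a1 b1 \<times> {ta..tb} \<Longrightarrow>
        dist z' z < \<sigma> \<Longrightarrow> dist (D z') (D z) < D (y, t0)"
      unfolding uniformly_continuous_on_def using pos by metis
    have "0 < D (x, t)" if "x \<in> F" "t \<in> {t0..t0 + \<sigma> / 2}" "t \<le> tb" for x t
    proof -
      have "dist (D (x, t)) (D (x, t0)) < D (y, t0)"
        by (rule \<sigma>(2)) (use that F tt \<sigma>(1) in \<open>auto simp: dist_Pair_Pair dist_real_def\<close>)
      then show ?thesis using y(2)[OF that(1)] by (simp add: dist_real_def)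
    qed
    then show ?thesis using \<sigma>(1) by (intro exI[of _ "\<sigma> / 2"]) auto
  qed (auto intro: exI[of _ 1])
  then obtain \<sigma> where \<sigma>: "0 < \<sigma>" "\<And>x t. x \<in> F \<Longrightarrow> t0 \<le> t \<Longrightarrow> t \<le> t0 + \<sigma> \<Longrightarrow> t \<le> tb \<Longrightarrow> 0 < D (x, t)" by auto
  \<comment> \<open>The box has to end after t0 so that the touching point is interior to it, yet
    within \<sigma> of t0.\<close>
  define t2 where "t2 = min tb (t0 + \<sigma>)"
  have t2: "t0 < t2" "t2 \<le> tb" "t2 \<le> t0 + \<sigma>" using tt \<sigma> by (auto simp: t2_def)
  define PB where "PB = cbox a1 b1 \<times> {ta} \<union> F \<times> {ta..t2}"
  have PB\<Omega>: "PB \<subseteq> \<Omega>" using cb(1) F t2 tt by (force simp: PB_def)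
  have PBc: "compact PB" unfolding PB_def using F by (intro compact_Un compact_Times) auto
  have PBn: "PB \<noteq> {}" using ne box_subset_cbox[of a1 b1] by (auto simp: PB_def)
  have PBpos: "0 < D z" if "z \<in> PB" for z
  proof -
    obtain x t where z: "z = (x, t)" by (cases z)
    have x: "x \<in> cbox a1 b1" and t: "ta \<le> t" "t \<le> t2" using that F z t2 tt by (auto simp: PB_def)
    show ?thesis
    proof (cases "t < t0")
      case True
      then show ?thesis unfolding z using x t t2 tt cb by (intro Dtime) auto
    next
      case False
      then have "x \<in> F" using that z tt by (auto simp: PB_def)
      then show ?thesis unfolding z using False t t2 by (intro \<sigma>(2)) auto
    qed
  qed
  obtain z1 where z1: "z1 \<in> PB" "\<And>z. z \<in> PB \<Longrightarrow> D z1 \<le> D z"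
    using continuous_attains_inf[OF PBc PBn continuous_on_subset[OF Dc PB\<Omega>]] by blast
  \<comment> \<open>The minimum of D over a compact set containing the parabolic boundary is the
    amount by which the explicit solution can be lifted. The lifted solution stays below u there but
    exceeds u at the touching point.\<close>
  define \<eta> where "\<eta> = D z1"
  have \<eta>: "0 < \<eta>" unfolding \<eta>_def by (rule PBpos[OF z1(1)])
  have e\<eta>: "expl p K c (d + \<eta>) z = expl p K c d z + \<eta>" for z by (cases z) (simp add: expl)
  have bd: "ereal (expl p K c (d + \<eta>) z) \<le> u z" if z: "z \<in> parabolic_boundary (box a1 b1) ta t2" for z
  proof -
    have zP: "z \<in> PB" using z unfolding parabolic_boundary_def clb F_def[symmetric] PB_def by auto
    have "\<eta> \<le> D z" using z1(2)[OF zP] by (simp add: \<eta>_def)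
    then have "expl p K c (d + \<eta>) z \<le> v z + m" unfolding e\<eta> D_def by linarith
    then show ?thesis using below[of z] PB\<Omega> zP by (meson ereal_less_eq(3) order_trans subsetD)
  qed
  have "closure (box a1 b1 \<times> {ta<..<t2}) = cbox a1 b1 \<times> {ta..t2}"
    using tt t2 clb by (simp add: closure_Times)
  moreover have "cbox a1 b1 \<times> {ta..t2} \<subseteq> \<Omega>" using cb(1) t2 by force
  ultimately have "compactly_inside (box a1 b1 \<times> {ta<..<t2}) \<Omega>"
    unfolding compactly_inside_def by (simp add: compact_Times)
  then have "ereal (expl p K c (d + \<eta>) (x0, t0)) \<le> u (x0, t0)"
    using cmp[unfolded expl_comparison_def, rule_format, of a1 b1 ta t2 K c "d + \<eta>" "(x0, t0)"] lt tt t2 K bd x0b by auto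
  then show False using D0 \<eta> by (simp add: touch e\<eta> D_def)
qed

section \<open>The barrier\<close>

text \<open>The factor 2 in the denominator keeps the second term, which is negative in the domain,
  below half of the first one in modulus.\<close>

definition barrier :: "real \<Rightarrow> real \<Rightarrow> real \<Rightarrow> (real ^ 'n) \<times> real \<Rightarrow> real" where
  "barrier \<alpha> \<gamma> \<theta> z = norm (fst z) powr \<alpha> + snd z * norm (fst z) powr (- \<gamma>) / (2 * \<theta>)"

lemma continuous_on_barrier: "S \<subseteq> {z. fst z \<noteq> 0} \<Longrightarrow> continuous_on S (barrier \<alpha> \<gamma> \<theta>)"
  unfolding barrier_def divide_inverse
  by (intro continuous_on_add continuous_on_mult continuous_on_powr continuous_on_const continuous_on_norm
      continuous_on_fst continuous_on_snd continuous_on_id) auto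

text \<open>At fixed time the barrier is r^\<alpha> - \<tau> r^(-\<gamma>) with \<tau> \<ge> 0,
  concave in r, so it lies below its tangent at r0. After scaling to y = r / r0 the two tangent
  bounds are weighted AM-GM and exp s \<ge> 1 + s.\<close>

lemma barrier_slope:
  fixes r r0 :: real
  assumes "0 < \<alpha>" "\<alpha> < 1" "0 < \<gamma>" "0 < r" "0 < r0" "0 \<le> \<tau>"
  shows "(r powr \<alpha> - \<tau> * r powr (- \<gamma>)) - (r0 powr \<alpha> - \<tau> * r0 powr (- \<gamma>)) \<le>
    (\<alpha> * r0 powr (\<alpha> - 1) + \<tau> * \<gamma> * r0 powr (- \<gamma> - 1)) * (r - r0)"
proof -
  define y where "y = r / r0"
  have y: "0 < y" "r = y * r0" using assms by (auto simp: y_def)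
  have 1: "y powr \<alpha> \<le> 1 + \<alpha> * (y - 1)"
    using Youngs_inequality_0[of \<alpha> "1 - \<alpha>" y 1] assms y by (simp add: algebra_simps)
  have "ln y \<le> y - 1" using y by (intro ln_le_minus_one)
  then have "1 - \<gamma> * (y - 1) \<le> 1 + (- \<gamma>) * ln y" using assms by (simp add: mult_left_mono)
  also have "\<dots> \<le> y powr (- \<gamma>)"
    using exp_ge_add_one_self[of "(- \<gamma>) * ln y"] y by (simp add: powr_def)
  finally have 2: "1 - \<gamma> * (y - 1) \<le> y powr (- \<gamma>)" .
  have e1: "r powr \<alpha> = r0 powr \<alpha> * y powr \<alpha>" "r powr (- \<gamma>) = r0 powr (- \<gamma>) * y powr (- \<gamma>)"
    unfolding y(2) by (simp_all add: powr_mult)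
  have e2: "r0 powr (\<alpha> - 1) * (r - r0) = r0 powr \<alpha> * (y - 1)" "r0 powr (- \<gamma> - 1) * (r - r0) = r0 powr (- \<gamma>) * (y - 1)"
    using assms unfolding y(2) by (simp_all add: powr_diff field_simps)
  have "r0 powr \<alpha> * y powr \<alpha> \<le> r0 powr \<alpha> * (1 + \<alpha> * (y - 1))"
    using 1 by (intro mult_left_mono) auto
  moreover have "\<tau> * (r0 powr (- \<gamma>) * (1 - \<gamma> * (y - 1))) \<le> \<tau> * (r0 powr (- \<gamma>) * y powr (- \<gamma>))"
    using 2 assms by (intro mult_left_mono) auto
  moreover have "(\<alpha> * r0 powr (\<alpha> - 1) + \<tau> * \<gamma> * r0 powr (- \<gamma> - 1)) * (r - r0) =
      \<alpha> * (r0 powr (\<alpha> - 1) * (r - r0)) + \<tau> * \<gamma> * (r0 powr (- \<gamma> - 1) * (r - r0))"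
    by (simp add: algebra_simps)
  ultimately show ?thesis unfolding e1 e2 by (simp add: algebra_simps)
qed

lemma open_Theta_dom: "0 < l \<Longrightarrow> open (Theta_dom l \<theta> :: ((real ^ 'n) \<times> real) set)"
proof -
  assume l: "0 < l"
  have "(Theta_dom l \<theta> :: ((real ^ 'n) \<times> real) set) = {z. 0 < - snd z} \<inter> ({z. - snd z < \<theta> * norm (fst z) powr l} \<inter> {z. \<theta> * norm (fst z) powr l < \<theta>})"
    by (auto simp: Theta_dom_def)
  moreover
  have c: "continuous_on UNIV (\<lambda>z :: (real ^ 'n) \<times> real. norm (fst z) powr l)"
    using l by (intro continuous_on_powr' continuous_intros) auto
  have "open {z :: (real ^ 'n) \<times> real. 0 < - snd z}" "open {z :: (real ^ 'n) \<times> real. - snd z < \<theta> * norm (fst z) powr l}"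
    "open {z :: (real ^ 'n) \<times> real. \<theta> * norm (fst z) powr l < \<theta>}"
    by (intro open_Collect_less continuous_intros c)+
  ultimately show "open (Theta_dom l \<theta> :: ((real ^ 'n) \<times> real) set)" by (simp only: open_Int)
qed

lemma Theta_domD:
  assumes "(x, t) \<in> Theta_dom l \<theta>" "0 < l" "0 < \<theta>"
  shows "x \<noteq> 0" "t < 0" "- t < \<theta> * norm x powr l" "norm x < 1"
proof -
  show *: "t < 0" "- t < \<theta> * norm x powr l" using assms by (auto simp: Theta_dom_def)
  then show "x \<noteq> 0" using assms by auto
  have "norm x powr l < 1" using assms by (auto simp: Theta_dom_def)
  then show "norm x < 1"
    using assms by (metis ge_one_powr_ge_zero less_imp_le not_le)
qed

text \<open>The radial slope of A times the barrier at x0 determines the explicit solution, and the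
  condition on \<open>A\<close> says that this solution decays in time more slowly than v. The
  nonincreasing term \<open>s\<close> only helps: it is constant in one application and a penalty
  tending to minus infinity at the final time in the other.\<close>

lemma barrier_no_touching:
  fixes u :: "(real ^ 'n) \<times> real \<Rightarrow> ereal"
  assumes p: "1 < p" "p < 2" and \<theta>: "0 < \<theta>" and l: "0 < l" and \<alpha>: "0 < \<alpha>" "\<alpha> < 1"
    and \<gamma>: "\<gamma> = p - \<alpha> * (p - 1)" "\<alpha> + \<gamma> \<le> l"
    and A: "0 < A" "2 * real CARD('n) * (A * (\<alpha> + \<gamma> / 2)) powr (p - 1) < A / (2 * \<theta>)"
    and \<Omega>: "open \<Omega>" "\<Omega> \<subseteq> Theta_dom l \<theta>" "z0 \<in> \<Omega>"
    and s: "continuous_on \<Omega> (\<lambda>z. s (snd z))" "\<And>z z'. z \<in> \<Omega> \<Longrightarrow> z' \<in> \<Omega> \<Longrightarrow> snd z \<le> snd z' \<Longrightarrow> s (snd z') \<le> s (snd z)"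
    and cmp: "expl_comparison p \<Omega> u"
    and below: "\<And>z. z \<in> \<Omega> \<Longrightarrow> ereal (s (snd z) - A * barrier \<alpha> \<gamma> \<theta> z + m) \<le> u z"
    and touch: "u z0 = ereal (s (snd z0) - A * barrier \<alpha> \<gamma> \<theta> z0 + m)"
  shows False
proof -
  obtain x0 t0 where z0: "z0 = (x0, t0)" by (cases z0)
  have T0: "x0 \<noteq> 0" "t0 < 0" "- t0 < \<theta> * norm x0 powr l" "norm x0 < 1"
    using Theta_domD[OF _ l \<theta>, of x0 t0] \<Omega> z0 by auto
  let ?r = "norm x0"
  have r: "0 < ?r" using T0 by simp
  have "\<alpha> * (p - 1) < 1 * (p - 1)" using \<alpha> p by (intro mult_strict_right_mono) auto
  then have g1: "1 < \<gamma>" using \<gamma> by simp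
  define \<tau> where "\<tau> = - t0 / (2 * \<theta>)"
  have \<tau>: "0 \<le> \<tau>" unfolding \<tau>_def using T0 \<theta> by (intro divide_nonneg_pos) auto
  define Q where "Q = \<alpha> * ?r powr (\<alpha> - 1) + \<tau> * \<gamma> * ?r powr (- \<gamma> - 1)"
  define q where "q = A * Q"
  have Q: "0 < Q" unfolding Q_def using \<alpha> r \<tau> g1 by (intro add_pos_nonneg mult_pos_pos mult_nonneg_nonneg) auto
  have q: "0 < q" using Q A by (simp add: q_def)
  \<comment> \<open>The shape of the domain enters here: -t0 < \<theta> r^l and r < 1 give \<tau>
    \<le> r^(\<alpha>+\<gamma>)/2, so the time term changes the slope \<alpha> r^(\<alpha>-1) only
    by a constant factor.\<close>
  have "\<tau> \<le> ?r powr l / 2" using T0(3) \<theta> by (simp add: \<tau>_def field_simps)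
  also have "\<dots> \<le> ?r powr (\<alpha> + \<gamma>) / 2"
    using T0(4) r \<gamma>(2) by (intro divide_right_mono powr_mono') auto
  finally have "\<tau> * \<gamma> * ?r powr (- \<gamma> - 1) \<le> ?r powr (\<alpha> + \<gamma>) / 2 * \<gamma> * ?r powr (- \<gamma> - 1)"
    using g1 by (intro mult_right_mono) auto
  also have "\<dots> = \<gamma> / 2 * (?r powr (\<alpha> + \<gamma>) * ?r powr (- \<gamma> - 1))" by simp
  also have "?r powr (\<alpha> + \<gamma>) * ?r powr (- \<gamma> - 1) = ?r powr (\<alpha> - 1)"
    by (simp add: powr_add[symmetric])
  finally have "Q \<le> (\<alpha> + \<gamma> / 2) * ?r powr (\<alpha> - 1)" unfolding Q_def by (simp add: algebra_simps)
  then have "q \<le> A * ((\<alpha> + \<gamma> / 2) * ?r powr (\<alpha> - 1))" unfolding q_def using A by (intro mult_left_mono) auto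
  then have "q powr (p - 1) \<le> (A * (\<alpha> + \<gamma> / 2) * ?r powr (\<alpha> - 1)) powr (p - 1)"
    using q p by (intro powr_mono2) (auto simp: mult.assoc)
  also have "\<dots> = (A * (\<alpha> + \<gamma> / 2)) powr (p - 1) * ?r powr ((\<alpha> - 1) * (p - 1))"
    by (simp add: powr_mult powr_powr)
  \<comment> \<open>This is the scaling identity behind \<gamma>. The extra factor r cancels against
    the radius r/2 of the explicit solution and leaves the factor 2.\<close>
  also have "(\<alpha> - 1) * (p - 1) = - \<gamma> + 1" using \<gamma>(1) by (simp add: algebra_simps)
  also have "?r powr (- \<gamma> + 1) = ?r powr (- \<gamma>) * ?r" by (simp only: powr_add powr_one norm_ge_zero)
  finally have "q powr (p - 1) / (?r / 2) \<le> (A * (\<alpha> + \<gamma> / 2)) powr (p - 1) * (?r powr (- \<gamma>) * ?r) / (?r / 2)"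
    using r by (intro divide_right_mono) auto
  also have "\<dots> = 2 * (A * (\<alpha> + \<gamma> / 2)) powr (p - 1) * ?r powr (- \<gamma>)" using r by simp
  finally have "real CARD('n) * (q powr (p - 1) / (?r / 2)) \<le>
      real CARD('n) * (2 * (A * (\<alpha> + \<gamma> / 2)) powr (p - 1) * ?r powr (- \<gamma>))"
    by (intro mult_left_mono) auto
  also have "\<dots> = (2 * real CARD('n) * (A * (\<alpha> + \<gamma> / 2)) powr (p - 1)) * ?r powr (- \<gamma>)" by simp
  also have "\<dots> < A / (2 * \<theta>) * ?r powr (- \<gamma>)" using A r by (intro mult_strict_right_mono) auto
  finally have kk: "real CARD('n) * (q powr (p - 1) / (?r / 2)) < A / (2 * \<theta>) * ?r powr (- \<gamma>)" .
  \<comment> \<open>The strict inequality at x0 persists for nearby x, as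
    \<open>touching_contradiction\<close> requires it on a whole neighbourhood.\<close>
  have "((\<lambda>x. A / (2 * \<theta>) * norm x powr (- \<gamma>)) \<longlongrightarrow> A / (2 * \<theta>) * ?r powr (- \<gamma>)) (at x0)"
    using T0 by (intro tendsto_intros) auto
  from order_tendstoD(1)[OF this kk] obtain \<rho> where \<rho>: "0 < \<rho>"
    "\<And>x. x \<noteq> x0 \<Longrightarrow> dist x x0 < \<rho> \<Longrightarrow> real CARD('n) * (q powr (p - 1) / (?r / 2)) < A / (2 * \<theta>) * norm x powr (- \<gamma>)"
    unfolding eventually_at by auto
  have near: "real CARD('n) * (q powr (p - 1) / (?r / 2)) < A / (2 * \<theta>) * norm x powr (- \<gamma>)" if "dist x x0 < \<rho>" for x
    using \<rho>(2)[of x] that kk by (cases "x = x0") auto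
  define v where "v z = s (snd z) - A * barrier \<alpha> \<gamma> \<theta> z" for z :: "(real ^ 'n) \<times> real"
  show False
  proof (rule touching_contradiction[of p \<Omega> x0 t0 q v u m \<rho>])
    show "continuous_on \<Omega> v"
      unfolding v_def using \<Omega>(2) Theta_domD(1)[OF _ l \<theta>]
      by (intro continuous_intros s continuous_on_barrier) force
    show "- q * (norm x - norm x0) \<le> v (x, t0) - v (x0, t0)" if "(x, t0) \<in> \<Omega>" for x
    proof -
      have x: "0 < norm x" using Theta_domD(1)[OF _ l \<theta>, of x t0] \<Omega>(2) that by auto
      have b: "barrier \<alpha> \<gamma> \<theta> (y, t0) = norm y powr \<alpha> - \<tau> * norm y powr (- \<gamma>)" for y :: "real ^ 'n"
        by (simp add: barrier_def \<tau>_def)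
      have "barrier \<alpha> \<gamma> \<theta> (x, t0) - barrier \<alpha> \<gamma> \<theta> (x0, t0) \<le> Q * (norm x - norm x0)"
        unfolding b Q_def using \<alpha> g1 x r \<tau> by (intro barrier_slope) auto
      then have "A * (barrier \<alpha> \<gamma> \<theta> (x, t0) - barrier \<alpha> \<gamma> \<theta> (x0, t0)) \<le> A * (Q * (norm x - norm x0))"
        using A by (intro mult_left_mono) auto
      then show ?thesis by (simp add: v_def q_def algebra_simps)
    qed
    show "real CARD('n) * (q powr (p - 1) / (norm x0 / 2)) * (t0 - t) < v (x, t) - v (x, t0)"
      if "(x, t) \<in> \<Omega>" "(x, t0) \<in> \<Omega>" "dist x x0 < \<rho>" "t < t0" for x t
    proof -
      have "real CARD('n) * (q powr (p - 1) / (norm x0 / 2)) * (t0 - t) < A / (2 * \<theta>) * norm x powr (- \<gamma>) * (t0 - t)"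
        using near[OF that(3)] that(4) by (intro mult_strict_right_mono) auto
      also have "\<dots> \<le> v (x, t) - v (x, t0)"
        using s(2)[OF that(1,2)] that(4) \<theta> by (simp add: v_def barrier_def field_simps)
      finally show ?thesis .
    qed
  qed (use p \<Omega> z0 T0 q cmp below touch \<rho>(1) in \<open>auto simp: v_def\<close>)
qed

text \<open>If h exceeded the barrier in the box, the difference plus a penalty \<eta>/(t2 - t)
  would have a negative minimum, attained off the parabolic boundary and before t2. There -h would
  be touched from below by the negative of the penalised barrier.\<close>

lemma barrier_superparabolic:
  fixes c0 :: real
  assumes p: "1 < p" "p < 2" and \<theta>: "0 < \<theta>" and l: "0 < l" and \<alpha>: "0 < \<alpha>" "\<alpha> < 1"
    and \<gamma>: "\<gamma> = p - \<alpha> * (p - 1)" "\<alpha> + \<gamma> \<le> l"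
    and A: "0 < A" "2 * real CARD('n) * (A * (\<alpha> + \<gamma> / 2)) powr (p - 1) < A / (2 * \<theta>)"
  shows "superparabolic p (Theta_dom l \<theta>) (\<lambda>z :: (real ^ 'n) \<times> real. ereal (c0 + A * barrier \<alpha> \<gamma> \<theta> z))"
  unfolding superparabolic_def
proof (intro conjI ballI allI impI)
  let ?T = "Theta_dom l \<theta> :: ((real ^ 'n) \<times> real) set"
  define w where "w z = c0 + A * barrier \<alpha> \<gamma> \<theta> z" for z :: "(real ^ 'n) \<times> real"
  have oT: "open ?T" by (rule open_Theta_dom[OF l])
  have wc: "continuous_on ?T w" unfolding w_def using Theta_domD(1)[OF _ l \<theta>]
    by (intro continuous_intros continuous_on_barrier) force
  show "ereal (c0 + A * barrier \<alpha> \<gamma> \<theta> z) \<le> Liminf (at z within ?T) (\<lambda>z. ereal (c0 + A * barrier \<alpha> \<gamma> \<theta> z))" if z: "z \<in> ?T" for z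
    unfolding w_def[symmetric]
  proof (unfold le_Liminf_iff, intro allI impI)
    fix y assume "y < ereal (w z)"
    moreover have "((\<lambda>z. ereal (w z)) \<longlongrightarrow> ereal (w z)) (at z within ?T)"
      using wc z by (simp add: continuous_on_def)
    ultimately show "\<forall>\<^sub>F x in at z within ?T. y < ereal (w x)" by (rule order_tendstoD(1)[rotated])
  qed
  show "?T \<subseteq> closure {z \<in> ?T. \<bar>ereal (c0 + A * barrier \<alpha> \<gamma> \<theta> z)\<bar> \<noteq> \<infinity>}"
    using closure_subset by auto
  fix a b :: "real ^ 'n" and t1 t2 h z1
  assume asm: "(\<forall>i. a $ i < b $ i) \<and> t1 < t2 \<and> compactly_inside (box a b \<times> {t1<..<t2}) ?T \<and>
      p_parabolic p (box a b \<times> {t1<..<t2}) h \<and> continuous_on (closure (box a b \<times> {t1<..<t2})) h \<and>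
      (\<forall>z\<in>parabolic_boundary (box a b) t1 t2. ereal (h z) \<le> ereal (c0 + A * barrier \<alpha> \<gamma> \<theta> z))"
    and z1: "z1 \<in> box a b \<times> {t1<..<t2}"
  let ?Q = "box a b \<times> {t1<..<t2}"
  have t: "t1 < t2" and hp: "p_parabolic p ?Q h" and hc: "continuous_on (closure ?Q) h"
    and bd: "\<And>z. z \<in> parabolic_boundary (box a b) t1 t2 \<Longrightarrow> h z \<le> w z"
    using asm by (auto simp: w_def)
  have ne: "box a b \<noteq> {}" using z1 by auto
  have clb: "closure (box a b) = cbox a b" using ne by (rule closure_box)
  have clQ: "closure ?Q = cbox a b \<times> {t1..t2}" using t clb by (simp add: closure_Times)
  have QT: "cbox a b \<times> {t1..t2} \<subseteq> ?T" using asm clQ by (simp add: compactly_inside_def)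
  have QQ: "?Q \<subseteq> cbox a b \<times> {t1..t2}" using box_subset_cbox by fastforce
  show "ereal (h z1) \<le> ereal (c0 + A * barrier \<alpha> \<gamma> \<theta> z1)"
  proof (rule ccontr)
    assume "\<not> ereal (h z1) \<le> ereal (c0 + A * barrier \<alpha> \<gamma> \<theta> z1)"
    then have neg: "w z1 < h z1" by (simp add: w_def)
    have z1t: "t1 < snd z1" "snd z1 < t2" using z1 by auto
    \<comment> \<open>Scaled so that the penalty uses up only half of the gap at z1.\<close>
    define \<eta> where "\<eta> = (h z1 - w z1) / 2 * (t2 - snd z1)"
    have \<eta>: "0 < \<eta>" using neg z1t by (simp add: \<eta>_def)
    define g where "g z = w z - h z + \<eta> / (t2 - snd z)" for z
    have "\<eta> / (t2 - snd z1) = (h z1 - w z1) / 2" using z1t nonzero_mult_div_cancel_right[of "t2 - snd z1" "(h z1 - w z1) / 2"] unfolding \<eta>_def by simp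
    then have gz1: "g z1 < 0" using neg by (simp add: g_def)
    have whc: "continuous_on (cbox a b \<times> {t1..t2}) (\<lambda>z. w z - h z)"
      using continuous_on_subset[OF wc QT] hc clQ by (intro continuous_intros) auto
    have "bounded ((\<lambda>z. w z - h z) ` (cbox a b \<times> {t1..t2}))"
      by (intro compact_imp_bounded compact_continuous_image whc compact_Times) auto
    then obtain M where M: "\<And>z. z \<in> cbox a b \<times> {t1..t2} \<Longrightarrow> \<bar>w z - h z\<bar> \<le> M"
      unfolding bounded_iff by (metis (no_types, lifting) imageI real_norm_def)
    have M0: "0 \<le> M" using M[of z1] z1 QQ by fastforce
    \<comment> \<open>During the last \<sigma> units of time the penalty is at least M + 1 and
      outweighs w - h, so it suffices to minimise over the earlier, compact part.\<close>
    define \<sigma> where "\<sigma> = min (t2 - snd z1) (\<eta> / (M + 1))"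
    have \<sigma>: "0 < \<sigma>" "snd z1 \<le> t2 - \<sigma>" "\<sigma> \<le> \<eta> / (M + 1)" using z1t \<eta> M0 by (auto simp: \<sigma>_def)
    let ?K = "cbox a b \<times> {t1..t2 - \<sigma>}"
    have K: "compact ?K" "z1 \<in> ?K" "?K \<subseteq> cbox a b \<times> {t1..t2}"
      using z1 QQ \<sigma> by (auto intro: compact_Times)
    have "continuous_on ?K g"
      unfolding g_def by (intro continuous_intros continuous_on_subset[OF whc K(3)]) (use \<sigma> in auto)
    then obtain z0 where z0: "z0 \<in> ?K" "\<And>z. z \<in> ?K \<Longrightarrow> g z0 \<le> g z"
      using continuous_attains_inf[OF K(1)] K(2) by blast
    have gz0: "g z0 < 0" using z0(2)[OF K(2)] gz1 by linarith
    have late: "0 \<le> g z" if "z \<in> cbox a b \<times> {t1..t2}" "t2 - \<sigma> < snd z" "snd z < t2" for z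
    proof -
      have "\<eta> / \<sigma> \<le> \<eta> / (t2 - snd z)" using that \<eta> by (intro divide_left_mono mult_pos_pos) (use \<sigma> in auto)
      moreover have "M + 1 \<le> \<eta> / \<sigma>" using \<sigma> M0 by (simp add: field_simps)
      ultimately show ?thesis using M[OF that(1)] by (simp add: g_def)
    qed
    have "z0 \<notin> parabolic_boundary (box a b) t1 t2"
    proof
      assume "z0 \<in> parabolic_boundary (box a b) t1 t2"
      from bd[OF this] have "0 \<le> w z0 - h z0" by simp
      moreover have "0 \<le> \<eta> / (t2 - snd z0)" using \<eta> z0(1) \<sigma> by (intro divide_nonneg_nonneg) auto
      ultimately show False using gz0 by (simp add: g_def)
    qed
    then have z0Q: "z0 \<in> ?Q"
      using z0(1) \<sigma>(1) unfolding parabolic_boundary_def frontier_def clb interior_open[OF open_box]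
      by (cases z0) force
    have min: "g z0 \<le> g z" if "z \<in> ?Q" for z
    proof (cases "snd z \<le> t2 - \<sigma>")
      case True
      show ?thesis by (rule z0(2)) (use that True QQ in force)
    next
      case False
      have "0 \<le> g z" by (rule late) (use that False QQ in auto)
      then show ?thesis using gz0 by linarith
    qed
    show False
    proof (rule barrier_no_touching[OF p \<theta> l \<alpha> \<gamma> A, where \<Omega> = ?Q and u = "\<lambda>z. ereal (- h z)" and
          s = "\<lambda>t. - c0 - \<eta> / (t2 - t)" and m = "g z0" and ?z0.0 = z0])
      show "open ?Q" by (intro open_Times) auto
      show "?Q \<subseteq> ?T" using QQ QT by blast
      show "z0 \<in> ?Q" by (rule z0Q)
      show "continuous_on ?Q (\<lambda>z. - c0 - \<eta> / (t2 - snd z))" by (intro continuous_intros) auto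
      show "- c0 - \<eta> / (t2 - snd z') \<le> - c0 - \<eta> / (t2 - snd z)" if "z \<in> ?Q" "z' \<in> ?Q" "snd z \<le> snd z'" for z z'
      proof -
        have "\<eta> / (t2 - snd z) \<le> \<eta> / (t2 - snd z')"
          using that \<eta> by (intro divide_left_mono mult_pos_pos) auto
        then show ?thesis by simp
      qed
      show "expl_comparison p ?Q (\<lambda>z. ereal (- h z))"
        unfolding expl_comparison_def
      proof (intro allI impI ballI)
        fix \<alpha>' \<beta>' s1 s2 K c d z
        assume "(\<forall>i. \<alpha>' $ i < \<beta>' $ i) \<and> s1 < s2 \<and> compactly_inside (box \<alpha>' \<beta>' \<times> {s1<..<s2}) ?Q \<and> 0 < K \<and>
          (\<forall>z\<in>parabolic_boundary (box \<alpha>' \<beta>') s1 s2. ereal (expl p K c d z) \<le> ereal (- h z))"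
          and "z \<in> box \<alpha>' \<beta>' \<times> {s1<..<s2}"
        then show "ereal (expl p K c d z) \<le> ereal (- h z)"
          using p_parabolic_le_expl[OF p _ hp, of K \<alpha>' \<beta>' s1 s2 c d z] by simp
      qed
      show "ereal (- c0 - \<eta> / (t2 - snd z) - A * barrier \<alpha> \<gamma> \<theta> z + g z0) \<le> ereal (- h z)" if "z \<in> ?Q" for z
        using min[OF that] by (simp add: g_def w_def)
      show "ereal (- h z0) = ereal (- c0 - \<eta> / (t2 - snd z0) - A * barrier \<alpha> \<gamma> \<theta> z0 + g z0)"
        by (simp add: g_def w_def)
    qed
  qed
qed simp

section \<open>Lower bound for the upper class\<close>

text \<open>In the domain -t |x|^(-\<gamma>) \<le> \<theta> |x|^(l-\<gamma>) \<le> \<theta>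
  |x|^\<alpha>, the last step because |x| < 1; dividing by 2 \<theta> leaves half of the main
  term.\<close>

lemma barrier_ge:
  assumes "z \<in> Theta_dom l \<theta>" "0 < \<theta>" "0 < l" "\<alpha> + \<gamma> \<le> l"
  shows "norm (fst z) powr \<alpha> / 2 \<le> barrier \<alpha> \<gamma> \<theta> z" "barrier \<alpha> \<gamma> \<theta> z \<le> norm (fst z) powr \<alpha>"
proof -
  obtain x t where z: "z = (x, t)" by (cases z)
  have T: "x \<noteq> 0" "t < 0" "- t < \<theta> * norm x powr l" "norm x < 1"
    using Theta_domD[of x t l \<theta>] assms z by auto
  have "- t * norm x powr (- \<gamma>) \<le> \<theta> * norm x powr l * norm x powr (- \<gamma>)"
    using T by (intro mult_right_mono) auto
  also have "\<dots> = \<theta> * norm x powr (l - \<gamma>)" by (simp add: powr_add[symmetric] mult.assoc)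
  also have "\<dots> \<le> \<theta> * norm x powr \<alpha>"
    using T assms by (intro mult_left_mono powr_mono') auto
  finally have "- t * norm x powr (- \<gamma>) / (2 * \<theta>) \<le> \<theta> * norm x powr \<alpha> / (2 * \<theta>)"
    using assms by (intro divide_right_mono) auto
  then show "norm (fst z) powr \<alpha> / 2 \<le> barrier \<alpha> \<gamma> \<theta> z" using assms by (simp add: z barrier_def)
  have "t * norm x powr (- \<gamma>) / (2 * \<theta>) \<le> 0"
    using T assms by (intro divide_nonpos_pos mult_nonpos_nonneg) auto
  then show "barrier \<alpha> \<gamma> \<theta> z \<le> norm (fst z) powr \<alpha>" by (simp add: z barrier_def)
qed

text \<open>Without a minimum each point of K has a neighbourhood on whose trace in S the values
  exceed g c for some c in S. The c of least value in a finite subcover lies in one of these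
  neighbourhoods, a contradiction. Points of K - S are covered with c = z1, which is how boundary
  values keep the minimum inside.\<close>

lemma lsc_attains_min:
  fixes g :: "'a::topological_space \<Rightarrow> 'b::linorder"
  assumes K: "compact K" "S \<subseteq> K" and z1: "z1 \<in> S"
    and lsc: "\<And>z y. z \<in> S \<Longrightarrow> y < g z \<Longrightarrow> \<exists>N. open N \<and> z \<in> N \<and> (\<forall>z'\<in>N \<inter> S. y < g z')"
    and bdry: "\<And>z. z \<in> K - S \<Longrightarrow> \<exists>N. open N \<and> z \<in> N \<and> (\<forall>z'\<in>N \<inter> S. g z1 < g z')"
  obtains z0 where "z0 \<in> S" "\<And>z. z \<in> S \<Longrightarrow> g z0 \<le> g z"
proof (rule ccontr)
  note ob = that
  assume "\<not> thesis"
  then have no: "\<exists>c\<in>S. g c < g z" if "z \<in> S" for z using that ob[of z] by (meson not_le)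
  have "\<exists>c N. c \<in> S \<and> open N \<and> z \<in> N \<and> (\<forall>z'\<in>N \<inter> S. g c < g z')" if "z \<in> K" for z
  proof (cases "z \<in> S")
    case True
    from no[OF True] obtain c where c: "c \<in> S" "g c < g z" by blast
    from lsc[OF True c(2)] show ?thesis using c(1) by blast
  next
    case False
    then show ?thesis using bdry[of z] that z1 by blast
  qed
  then obtain c N where cN: "\<And>z. z \<in> K \<Longrightarrow> c z \<in> S" "\<And>z. z \<in> K \<Longrightarrow> open (N z)" "\<And>z. z \<in> K \<Longrightarrow> z \<in> N z"
    "\<And>z z'. z \<in> K \<Longrightarrow> z' \<in> N z \<inter> S \<Longrightarrow> g (c z) < g z'" by metis
  obtain F where F: "F \<subseteq> K" "finite F" "K \<subseteq> (\<Union>z\<in>F. N z)"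
    using compactE_image[OF K(1), of K N] cN(2,3) by blast
  have "F \<noteq> {}" using F(3) z1 K(2) by blast
  then have "\<exists>m\<in>(\<lambda>z. g (c z)) ` F. \<not> (\<exists>x\<in>(\<lambda>z. g (c z)) ` F. x < m)"
    using F(2) by (intro ex_min_if_finite) auto
  then obtain y where y: "y \<in> F" "\<And>z. z \<in> F \<Longrightarrow> g (c y) \<le> g (c z)"
    by (auto simp: not_less)
  have "c y \<in> S" using y F cN by blast
  then obtain z where z: "z \<in> F" "c y \<in> N z" using F K by blast
  then have "g (c z) < g (c y)" using cN(4) F \<open>c y \<in> S\<close> by blast
  then show False using y(2)[OF z(1)] by simp
qed

text \<open>If u fell below the lower barrier somewhere, the boundary condition would force the
  difference to attain its minimum inside the domain; \<open>barrier_no_touching\<close> with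
  constant \<open>s\<close> excludes such a point.\<close>

lemma upper_class_ge_barrier:
  fixes f :: "(real ^ 'n) \<times> real \<Rightarrow> real" and u :: "(real ^ 'n) \<times> real \<Rightarrow> ereal"
  assumes p: "1 < p" "p < 2" and \<theta>: "0 < \<theta>" and l: "0 < l" and \<alpha>: "0 < \<alpha>" "\<alpha> < 1"
    and \<gamma>: "\<gamma> = p - \<alpha> * (p - 1)" "\<alpha> + \<gamma> \<le> l"
    and A: "0 < A" "2 * real CARD('n) * (A * (\<alpha> + \<gamma> / 2)) powr (p - 1) < A / (2 * \<theta>)"
    and u: "u \<in> upper_class p (Theta_dom l \<theta>) f" and cK: "compact (closure (Theta_dom l \<theta> :: ((real ^ 'n) \<times> real) set))"
    and f: "\<And>\<xi>. \<xi> \<in> frontier (Theta_dom l \<theta>) \<Longrightarrow> c1 - A / 2 * norm (fst \<xi>) powr \<alpha> \<le> f \<xi>"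
    and z1: "z1 \<in> Theta_dom l \<theta>"
  shows "ereal (c1 - A * barrier \<alpha> \<gamma> \<theta> z1) \<le> u z1"
proof (rule ccontr)
  let ?T = "Theta_dom l \<theta> :: ((real ^ 'n) \<times> real) set"
  define v where "v z = c1 - A * barrier \<alpha> \<gamma> \<theta> z" for z :: "(real ^ 'n) \<times> real"
  \<comment> \<open>The formula of the barrier is singular at x = 0. This majorant of v is
    continuous on the whole space and carries the comparison on the frontier.\<close>
  define v' where "v' z = c1 - A / 2 * norm (fst z) powr \<alpha>" for z :: "(real ^ 'n) \<times> real"
  define g where "g z = u z + ereal (- v z)" for z
  have sup: "superparabolic p ?T u" and bdry: "\<And>\<xi>. \<xi> \<in> frontier ?T \<Longrightarrow> ereal (f \<xi>) \<le> Liminf (at \<xi> within ?T) u"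
    using u by (auto simp: upper_class_def)
  have oT: "open ?T" by (rule open_Theta_dom[OF l])
  have vc: "continuous_on ?T v" unfolding v_def using Theta_domD(1)[OF _ l \<theta>]
    by (intro continuous_intros continuous_on_barrier) force
  have v'c: "continuous_on UNIV v'" unfolding v'_def
    using \<alpha> by (intro continuous_intros continuous_on_powr') auto
  have vv': "v z \<le> v' z" if "z \<in> ?T" for z
    using mult_left_mono[OF barrier_ge(1)[OF that \<theta> l \<gamma>(2)], of A] A by (simp add: v_def v'_def)
  have gless: "ereal r < g z \<longleftrightarrow> ereal (r + v z) < u z" for r z
    unfolding g_def by (cases "u z") auto
  assume "\<not> ereal (c1 - A * barrier \<alpha> \<gamma> \<theta> z1) \<le> u z1"
  then have uz1: "u z1 < ereal (v z1)" by (simp add: v_def)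
  have "u z1 \<noteq> - \<infinity>" using sup z1 unfolding superparabolic_def by blast
  then obtain u1 where u1: "u z1 = ereal u1" using uz1 by (cases "u z1") auto
  define m1 where "m1 = u1 - v z1"
  have m1: "m1 < 0" "g z1 = ereal m1" using uz1 by (auto simp: m1_def g_def u1)
  obtain z0 where z0: "z0 \<in> ?T" "\<And>z. z \<in> ?T \<Longrightarrow> g z0 \<le> g z"
  proof (rule lsc_attains_min[OF cK closure_subset z1, of g])
    fix z y assume z: "z \<in> ?T" and y: "y < g z"
    obtain r0 where r0: "y < ereal r0" "ereal r0 < g z" using ereal_dense2[OF y] by blast
    then have "ereal (r0 + v z) < u z" by (simp add: gless)
    from ereal_dense2[OF this] obtain r2 where r2: "r0 + v z < r2" "ereal r2 < u z" by auto
    have "u z \<le> Liminf (at z within ?T) u" using sup z unfolding superparabolic_def by blast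
    then have "\<forall>\<^sub>F z' in at z within ?T. ereal r2 < u z'" using r2(2) unfolding le_Liminf_iff by blast
    moreover have "(v \<longlongrightarrow> v z) (at z within ?T)" using vc z by (simp add: continuous_on_def)
    then have "\<forall>\<^sub>F z' in at z within ?T. v z' < r2 - r0" by (rule order_tendstoD(2)) (use r2 in simp)
    ultimately have "\<forall>\<^sub>F z' in at z within ?T. y < g z'"
    proof eventually_elim
      fix z' assume "ereal r2 < u z'" "v z' < r2 - r0"
      then have "ereal (r0 + v z') < ereal r2" by simp
      then have "ereal (r0 + v z') < u z'" using \<open>ereal r2 < u z'\<close> by (rule less_trans)
      then have "ereal r0 < g z'" by (simp only: gless)
      with r0(1) show "y < g z'" by (rule less_trans)
    qed
    then show "\<exists>N. open N \<and> z \<in> N \<and> (\<forall>z'\<in>N \<inter> ?T. y < g z')"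
      unfolding eventually_at_topological using y by (metis IntD1 IntD2)
  next
    fix \<xi> assume "\<xi> \<in> closure ?T - ?T"
    then have \<xi>: "\<xi> \<in> frontier ?T" "\<xi> \<notin> ?T" using oT by (auto simp: frontier_def interior_open)
    \<comment> \<open>The negative number m1 is split in halves: one makes the boundary inequality
      strict, the other absorbs the variation of \<open>v'\<close> near \<xi>.\<close>
    have "ereal (v' \<xi> + m1 / 2) < ereal (f \<xi>)" using f[OF \<xi>(1)] m1 by (simp add: v'_def)
    then have "\<forall>\<^sub>F z' in at \<xi> within ?T. ereal (v' \<xi> + m1 / 2) < u z'"
      using bdry[OF \<xi>(1)] unfolding le_Liminf_iff by blast
    moreover have "(v' \<longlongrightarrow> v' \<xi>) (at \<xi> within ?T)"
      using continuous_on_subset[OF v'c subset_UNIV, of "insert \<xi> ?T"] 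
      by (auto simp: continuous_on_def intro: tendsto_within_subset)
    then have "\<forall>\<^sub>F z' in at \<xi> within ?T. v' z' < v' \<xi> - m1 / 2" by (rule order_tendstoD(2)) (use m1 in simp)
    ultimately have "\<forall>\<^sub>F z' in at \<xi> within ?T. z' \<in> ?T \<longrightarrow> g z1 < g z'"
    proof eventually_elim
      fix z' assume h: "ereal (v' \<xi> + m1 / 2) < u z'" "v' z' < v' \<xi> - m1 / 2"
      show "z' \<in> ?T \<longrightarrow> g z1 < g z'"
      proof
        assume "z' \<in> ?T"
        then have "m1 + v z' < v' \<xi> + m1 / 2" using vv'[of z'] h(2) by simp
        then have "ereal (m1 + v z') < ereal (v' \<xi> + m1 / 2)" by simp
        then have "ereal (m1 + v z') < u z'" using h(1) by (rule less_trans)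
        then show "g z1 < g z'" unfolding m1(2) gless .
      qed
    qed
    then show "\<exists>N. open N \<and> \<xi> \<in> N \<and> (\<forall>z'\<in>N \<inter> ?T. g z1 < g z')"
      unfolding eventually_at_topological using \<xi>(2) by (metis IntD1 IntD2)
  qed blast
  have "g z0 \<le> ereal m1" using z0(2)[OF z1] by (simp add: m1)
  moreover have "u z0 \<noteq> - \<infinity>" using sup z0(1) unfolding superparabolic_def by blast
  ultimately obtain u0 where u0: "u z0 = ereal u0" by (cases "u z0") (auto simp: g_def)
  define m where "m = u0 - v z0"
  have gz0: "g z0 = ereal m" by (simp add: g_def u0 m_def)
  show False
  proof (rule barrier_no_touching[OF p \<theta> l \<alpha> \<gamma> A, where \<Omega> = ?T and u = u and s = "\<lambda>t. c1" and m = m and ?z0.0 = z0])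
    show "expl_comparison p ?T u"
      unfolding expl_comparison_def
    proof (intro allI impI)
      fix \<alpha>' \<beta>' s1 s2 K c d
      assume "(\<forall>i. \<alpha>' $ i < \<beta>' $ i) \<and> s1 < s2 \<and> compactly_inside (box \<alpha>' \<beta>' \<times> {s1<..<s2}) ?T \<and> 0 < K \<and>
          (\<forall>z\<in>parabolic_boundary (box \<alpha>' \<beta>') s1 s2. ereal (expl p K c d z) \<le> u z)"
      then show "\<forall>z\<in>box \<alpha>' \<beta>' \<times> {s1<..<s2}. ereal (expl p K c d z) \<le> u z"
        using sup expl_p_parabolic[OF p] continuous_on_expl[OF p(1)] unfolding superparabolic_def by blast
    qed
    show "ereal (c1 - A * barrier \<alpha> \<gamma> \<theta> z + m) \<le> u z" if "z \<in> ?T" for z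
      using z0(2)[OF that] unfolding gz0 by (cases "u z") (auto simp: g_def v_def)
    show "u z0 = ereal (c1 - A * barrier \<alpha> \<gamma> \<theta> z0 + m)" by (simp add: u0 m_def v_def)
  qed (use oT z0 in auto)
qed

section \<open>Regularity of the origin\<close>

lemma closure_Theta_dom:
  fixes x :: "real ^ 'n"
  assumes "0 < l" "0 < \<theta>" "(x, t) \<in> closure (Theta_dom l \<theta>)"
  shows "t \<le> 0" "- t \<le> \<theta> * norm x powr l" "norm x \<le> 1"
proof -
  let ?B = "{z :: (real ^ 'n) \<times> real. snd z \<le> 0} \<inter> ({z. - snd z \<le> \<theta> * norm (fst z) powr l} \<inter> {z. norm (fst z) \<le> 1})"
  have c: "continuous_on UNIV (\<lambda>z :: (real ^ 'n) \<times> real. norm (fst z) powr l)"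
    using assms by (intro continuous_on_powr' continuous_intros) auto
  have "closed ?B"
    by (intro closed_Int closed_Collect_le c continuous_on_mult continuous_on_const continuous_on_minus
        continuous_on_snd continuous_on_fst continuous_on_norm continuous_on_id)
  moreover have "Theta_dom l \<theta> \<subseteq> ?B"
    using Theta_domD[OF _ assms(1,2)] by force
  ultimately have "closure (Theta_dom l \<theta>) \<subseteq> ?B" by (rule closure_minimal[rotated])
  then show "t \<le> 0" "- t \<le> \<theta> * norm x powr l" "norm x \<le> 1" using assms(3) by auto
qed

theorem proposition1p2:
  fixes p l \<theta> :: real
  assumes "1 < p" and "p < 2" and "l > p" and "\<theta> > 0"
  shows "regular_point p (Theta_dom l \<theta> :: ((real ^ 'n) \<times> real) set) (0, 0)"
proof -
  let ?T = "Theta_dom l \<theta> :: ((real ^ 'n) \<times> real) set"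
  note p = assms(1,2) and \<theta> = assms(4)
  have l: "0 < l" using assms by simp
  \<comment> \<open>Since \<alpha> + \<gamma> = p + \<alpha> (2 - p) \<le> p + \<alpha>, the bound
    \<alpha> \<le> l - p suffices; the entry 1/2 keeps \<alpha> below 1.\<close>
  define \<alpha> where "\<alpha> = min (1 / 2) (l - p)"
  define \<gamma> where "\<gamma> = p - \<alpha> * (p - 1)"
  have \<alpha>: "0 < \<alpha>" "\<alpha> < 1" "\<alpha> \<le> l - p" using assms by (auto simp: \<alpha>_def)
  have "\<alpha> * (2 - p) \<le> \<alpha> * 1" using p \<alpha> by (intro mult_left_mono) auto
  then have \<gamma>: "\<alpha> + \<gamma> \<le> l" using \<alpha>(3) by (simp add: \<gamma>_def algebra_simps)
  have "\<alpha> * (p - 1) < 1 * (p - 1)" using \<alpha> p by (intro mult_strict_right_mono) auto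
  then have \<gamma>1: "1 < \<gamma>" by (simp add: \<gamma>_def)
  have "closure ?T \<subseteq> cball 0 1 \<times> {- \<theta>..0}"
  proof (clarsimp)
    fix x :: "real ^ 'n" and t assume "(x, t) \<in> closure ?T"
    note c = closure_Theta_dom[OF l \<theta> this]
    have "norm x powr l \<le> 1 powr l" using c l by (intro powr_mono2) auto
    then have "\<theta> * norm x powr l \<le> \<theta> * 1" using \<theta> by (intro mult_left_mono) auto
    then show "norm x \<le> 1 \<and> - \<theta> \<le> t \<and> t \<le> 0" using c by simp
  qed
  then have cK: "compact (closure ?T)"
    using bounded_subset[OF bounded_Times[OF bounded_cball bounded_closed_interval]]
    by (simp add: compact_eq_bounded_closed)
  have cF: "compact (frontier ?T)"
    unfolding frontier_def by (rule compact_diff[OF cK open_interior])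
  have zero: "(0, 0) \<in> frontier ?T"
  proof -
    obtain i :: 'n where True by simp
    have n: "norm (axis i 1 :: real ^ 'n) = 1" by simp
    \<comment> \<open>The time coordinate is half of the admissible depth \<theta> |x|^l and the
      shift by 2 keeps |x| < 1, so the sequence runs to the tip inside the domain.\<close>
    define X where "X k = ((1 / real (k + 2)) *\<^sub>R axis i 1 :: real ^ 'n, - (\<theta> / 2) * (1 / real (k + 2)) powr l)" for k
    have "X k \<in> ?T" for k
    proof -
      have "(1 / real (k + 2)) powr l < 1 powr l" using l by (intro powr_less_mono2) auto
      moreover have "0 < (1 / real (k + 2)) powr l" by simp
      ultimately show ?thesis using \<theta> n by (simp add: X_def Theta_dom_def mult_less_cancel_left)
    qed
    moreover have "X \<longlonglongrightarrow> (0, 0)"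
    proof -
      have 1: "(\<lambda>k. 1 / real (k + 2)) \<longlonglongrightarrow> 0"
        using LIMSEQ_ignore_initial_segment[OF lim_1_over_n, of 2] by simp
      have 2: "(\<lambda>k. (1 / real (k + 2)) powr l) \<longlonglongrightarrow> 0"
        by (rule tendsto_zero_powrI[OF 1 tendsto_const]) (use l in auto)
      show ?thesis unfolding X_def
        using tendsto_Pair[OF tendsto_scaleR[OF 1 tendsto_const[of "axis i 1 :: real ^ 'n"]] tendsto_mult[OF tendsto_const[of "- (\<theta> / 2)"] 2]]
        by simp
    qed
    ultimately have "(0, 0) \<in> closure ?T" unfolding closure_sequential by blast
    moreover have "(0, 0) \<notin> ?T" using Theta_domD(1)[OF _ l \<theta>] by blast
    ultimately show ?thesis using open_Theta_dom[OF l, of \<theta>, where 'n = 'n] by (simp add: frontier_def interior_open)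
  qed
  \<comment> \<open>The squeeze around f (0, 0): the upper barrier belongs to the upper class, and
    the lower one bounds every member of that class from below.\<close>
  have bounds: "\<exists>A>0. \<forall>z\<in>?T. ereal (f (0, 0) - \<epsilon> - A * barrier \<alpha> \<gamma> \<theta> z) \<le> upper_Perron p ?T f z \<and>
      upper_Perron p ?T f z \<le> ereal (f (0, 0) + \<epsilon> + A * barrier \<alpha> \<gamma> \<theta> z)"
    if f: "continuous_on (frontier ?T) f" and \<epsilon>: "0 < \<epsilon>" for f \<epsilon>
  proof -
    have "bounded (f ` frontier ?T)" by (intro compact_imp_bounded compact_continuous_image f cF)
    then obtain M where M: "\<And>\<xi>. \<xi> \<in> frontier ?T \<Longrightarrow> \<bar>f \<xi>\<bar> \<le> M"
      unfolding bounded_iff by (metis imageI real_norm_def)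
    obtain \<delta> where \<delta>: "0 < \<delta>" "\<And>\<xi>. \<xi> \<in> frontier ?T \<Longrightarrow> dist \<xi> (0, 0) < \<delta> \<Longrightarrow> dist (f \<xi>) (f (0, 0)) < \<epsilon>"
      using f zero \<epsilon> unfolding continuous_on_iff by metis
    have "((\<lambda>r. r + \<theta> * r powr l) \<longlongrightarrow> 0 + \<theta> * 0) (at_right 0)"
      by (intro tendsto_add tendsto_mult tendsto_const tendsto_ident_at tendsto_zero_powrI[where b = l])
        (use l in \<open>auto simp: eventually_at_filter\<close>)
    then have "\<forall>\<^sub>F r in at_right 0. r + \<theta> * r powr l < \<delta>" using \<delta> by (intro order_tendstoD(2)) auto
    then obtain b where b: "0 < b" "\<And>r. 0 < r \<Longrightarrow> r < b \<Longrightarrow> r + \<theta> * r powr l < \<delta>"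
      unfolding eventually_at_right_field by auto
    \<comment> \<open>On the frontier |t| \<le> \<theta> |x|^l, so |x| < \<rho> alone puts a point
      within \<delta> of the origin. This is why a power of |x| can control f on the whole
      frontier.\<close>
    define \<rho> where "\<rho> = b / 2"
    have \<rho>: "0 < \<rho>" "\<rho> + \<theta> * \<rho> powr l < \<delta>" using b by (auto simp: \<rho>_def)
    define C where "C = 2 * real CARD('n) * (\<alpha> + \<gamma> / 2) powr (p - 1) * (2 * \<theta>)"
    \<comment> \<open>The first entry gives C A^(p-1) < A, which holds for large A because p - 1 <
      1. The second makes A/2 \<rho>^\<alpha> at least 2 M, which covers the frontier points with
      |x| \<ge> \<rho>.\<close>
    define A where "A = max (C powr (1 / (2 - p))) (4 * M / \<rho> powr \<alpha>) + 1"
    have C: "0 < C" unfolding C_def using \<alpha> \<gamma>1 \<theta> by simp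
    have CA: "C powr (1 / (2 - p)) < A" "4 * M / \<rho> powr \<alpha> \<le> A"
      unfolding A_def by (simp_all add: max_def)
    have "0 < A" by (rule le_less_trans[OF powr_ge_zero CA(1)])
    note A = this CA
    have A0: "2 * real CARD('n) * (A * (\<alpha> + \<gamma> / 2)) powr (p - 1) < A / (2 * \<theta>)"
    proof -
      have "C = (C powr (1 / (2 - p))) powr (2 - p)" using C p by (simp add: powr_powr)
      also have "\<dots> < A powr (2 - p)" using A p by (intro powr_less_mono2) auto
      finally have "A powr (p - 1) * C < A powr (p - 1) * A powr (2 - p)"
        using A by (intro mult_strict_left_mono) auto
      also have "A powr (p - 1) * A powr (2 - p) = A" using A by (simp add: powr_add[symmetric])
      finally have "A powr (p - 1) * C / (2 * \<theta>) < A / (2 * \<theta>)" using \<theta> by (intro divide_strict_right_mono) auto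
      moreover have "A powr (p - 1) * C / (2 * \<theta>) = 2 * real CARD('n) * (A * (\<alpha> + \<gamma> / 2)) powr (p - 1)"
        using \<theta> by (simp add: C_def powr_mult)
      ultimately show ?thesis by simp
    qed
    have main: "\<bar>f \<xi> - f (0, 0)\<bar> \<le> \<epsilon> + A / 2 * norm (fst \<xi>) powr \<alpha>" if \<xi>: "\<xi> \<in> frontier ?T" for \<xi>
    proof -
      obtain x t where xt: "\<xi> = (x, t)" by (cases \<xi>)
      have "(x, t) \<in> closure ?T" using \<xi> xt by (simp add: frontier_def)
      note c = closure_Theta_dom[OF l \<theta> this]
      have nn: "0 \<le> A / 2 * norm x powr \<alpha>" using A by simp
      show ?thesis
      proof (cases "norm x < \<rho>")
        case True
        have "norm x powr l \<le> \<rho> powr l" using True l by (intro powr_mono2) auto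
        then have "\<theta> * norm x powr l \<le> \<theta> * \<rho> powr l" using \<theta> by (intro mult_left_mono) auto
        then have "norm x + \<bar>t\<bar> < \<delta>" using True \<rho>(2) c by simp
        moreover have "dist \<xi> (0, 0) \<le> norm x + \<bar>t\<bar>"
          using norm_Pair_le[of x t] by (simp add: xt dist_norm)
        ultimately have "dist (f \<xi>) (f (0, 0)) < \<epsilon>" by (intro \<delta>(2) \<xi>) simp
        then show ?thesis using nn by (simp add: dist_real_def xt)
      next
        case False
        have "\<rho> powr \<alpha> \<le> norm x powr \<alpha>" using False \<rho> \<alpha> by (intro powr_mono2) auto
        then have "A / 2 * \<rho> powr \<alpha> \<le> A / 2 * norm x powr \<alpha>" using A by (intro mult_left_mono) auto
        moreover have "4 * M \<le> A * \<rho> powr \<alpha>" using A(3) \<rho> by (simp add: pos_divide_le_eq)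
        ultimately show ?thesis using M[OF \<xi>] M[OF zero] \<epsilon> by (simp add: xt)
      qed
    qed
    define w where "w z = ereal (f (0, 0) + \<epsilon> + A * barrier \<alpha> \<gamma> \<theta> z)" for z :: "(real ^ 'n) \<times> real"
    have "w \<in> upper_class p ?T f"
      unfolding upper_class_def
    proof (intro CollectI conjI ballI)
      show "superparabolic p ?T w"
        unfolding w_def by (rule barrier_superparabolic[OF p \<theta> l \<alpha>(1,2) \<gamma>_def \<gamma> A(1) A0])
      fix \<xi> assume \<xi>: "\<xi> \<in> frontier ?T"
      \<comment> \<open>A minorant of w in the domain, continuous on the whole space; the formula
        for w itself is singular at x = 0.\<close>
      define \<phi> where "\<phi> z = f (0, 0) + \<epsilon> + A / 2 * norm (fst z) powr \<alpha>" for z :: "(real ^ 'n) \<times> real"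
      have "continuous_on UNIV \<phi>" unfolding \<phi>_def
        using \<alpha> by (intro continuous_intros continuous_on_powr') auto
      then have "(\<phi> \<longlongrightarrow> \<phi> \<xi>) (at \<xi> within ?T)"
        by (metis UNIV_I continuous_on_def subset_UNIV tendsto_within_subset)
      then have lim: "((\<lambda>z. ereal (\<phi> z)) \<longlongrightarrow> ereal (\<phi> \<xi>)) (at \<xi> within ?T)" by simp
      show "ereal (f \<xi>) \<le> Liminf (at \<xi> within ?T) w"
        unfolding le_Liminf_iff
      proof (intro allI impI)
        fix y assume y: "y < ereal (f \<xi>)"
        also have "ereal (f \<xi>) \<le> ereal (\<phi> \<xi>)" using main[OF \<xi>] by (simp add: \<phi>_def)
        finally have "\<forall>\<^sub>F z in at \<xi> within ?T. y < ereal (\<phi> z)" by (rule order_tendstoD(1)[OF lim])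
        moreover have "\<forall>\<^sub>F z in at \<xi> within ?T. z \<in> ?T" by (simp add: eventually_at_filter)
        ultimately show "\<forall>\<^sub>F z in at \<xi> within ?T. y < w z"
        proof eventually_elim
          fix z assume y: "y < ereal (\<phi> z)" and z: "z \<in> ?T"
          have "A * (norm (fst z) powr \<alpha> / 2) \<le> A * barrier \<alpha> \<gamma> \<theta> z"
            using barrier_ge(1)[OF z \<theta> l \<gamma>] A by (intro mult_left_mono) auto
          then have "ereal (\<phi> z) \<le> w z" by (simp add: \<phi>_def w_def)
          with y show "y < w z" by (rule less_le_trans)
        qed
      qed
    qed
    then have up: "upper_Perron p ?T f z \<le> w z" for z unfolding upper_Perron_def by (rule INF_lower)
    have low: "ereal (f (0, 0) - \<epsilon> - A * barrier \<alpha> \<gamma> \<theta> z) \<le> upper_Perron p ?T f z" if z: "z \<in> ?T" for z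
      unfolding upper_Perron_def
    proof (rule INF_greatest)
      fix u assume u: "u \<in> upper_class p ?T f"
      show "ereal (f (0, 0) - \<epsilon> - A * barrier \<alpha> \<gamma> \<theta> z) \<le> u z"
      proof (rule upper_class_ge_barrier[OF p \<theta> l \<alpha>(1,2) \<gamma>_def \<gamma> A(1) A0 u cK _ z])
        fix \<xi> assume "\<xi> \<in> frontier ?T"
        from main[OF this] show "f (0, 0) - \<epsilon> - A / 2 * norm (fst \<xi>) powr \<alpha> \<le> f \<xi>" by linarith
      qed
    qed
    show ?thesis using A(1) up low by (auto simp: w_def)
  qed
  have small: "\<forall>\<^sub>F z in at (0, 0) within ?T. z \<in> ?T \<and> A * barrier \<alpha> \<gamma> \<theta> z < \<epsilon>" if A: "0 < A" and \<epsilon>: "0 < \<epsilon>" for A \<epsilon>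
  proof -
    have "continuous_on UNIV (\<lambda>z :: (real ^ 'n) \<times> real. A * norm (fst z) powr \<alpha>)"
      using \<alpha> by (intro continuous_intros continuous_on_powr') auto
    then have "((\<lambda>z :: (real ^ 'n) \<times> real. A * norm (fst z) powr \<alpha>) \<longlongrightarrow> A * norm (fst (0 :: real ^ 'n, 0 :: real)) powr \<alpha>) (at (0, 0) within ?T)"
      unfolding continuous_on_def by (metis (mono_tags, lifting) UNIV_I fst_conv subset_UNIV tendsto_within_subset)
    then have "\<forall>\<^sub>F z in at (0, 0) within ?T. A * norm (fst z) powr \<alpha> < \<epsilon>"
      using \<epsilon> by (intro order_tendstoD(2)) auto
    moreover have "\<forall>\<^sub>F z in at (0, 0) within ?T. z \<in> ?T" by (simp add: eventually_at_filter)
    ultimately show ?thesis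
    proof eventually_elim
      fix z assume z: "A * norm (fst z) powr \<alpha> < \<epsilon>" "z \<in> ?T"
      have "A * barrier \<alpha> \<gamma> \<theta> z \<le> A * norm (fst z) powr \<alpha>"
        using barrier_ge(2)[OF z(2) \<theta> l \<gamma>] A by (intro mult_left_mono) auto
      then show "z \<in> ?T \<and> A * barrier \<alpha> \<gamma> \<theta> z < \<epsilon>" using z by simp
    qed
  qed
  have "(upper_Perron p ?T f \<longlongrightarrow> ereal (f (0, 0))) (at (0, 0) within ?T)" if f: "continuous_on (frontier ?T) f" for f
  proof (rule order_tendstoI)
    fix y assume "y < ereal (f (0, 0))"
    from ereal_dense2[OF this] obtain r where r: "y < ereal r" "r < f (0, 0)" by auto
    \<comment> \<open>Half of the distance: one \<epsilon> is spent in \<open>bounds\<close>, the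
      other on the value of the barrier near the origin.\<close>
    define \<epsilon> where "\<epsilon> = (f (0, 0) - r) / 2"
    have \<epsilon>: "0 < \<epsilon>" "r = f (0, 0) - \<epsilon> - \<epsilon>" using r by (auto simp: \<epsilon>_def)
    obtain A where A: "0 < A" "\<And>z. z \<in> ?T \<Longrightarrow> ereal (f (0, 0) - \<epsilon> - A * barrier \<alpha> \<gamma> \<theta> z) \<le> upper_Perron p ?T f z"
      using bounds[OF f \<epsilon>(1)] by blast
    show "\<forall>\<^sub>F z in at (0, 0) within ?T. y < upper_Perron p ?T f z"
      using small[OF A(1) \<epsilon>(1)]
    proof eventually_elim
      fix z assume z: "z \<in> ?T \<and> A * barrier \<alpha> \<gamma> \<theta> z < \<epsilon>"
      then have "ereal r \<le> ereal (f (0, 0) - \<epsilon> - A * barrier \<alpha> \<gamma> \<theta> z)" using \<epsilon>(2) by simp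
      also have "\<dots> \<le> upper_Perron p ?T f z" using A(2) z by blast
      finally show "y < upper_Perron p ?T f z" by (rule less_le_trans[OF r(1)])
    qed
  next
    fix y assume "ereal (f (0, 0)) < y"
    from ereal_dense2[OF this] obtain r where r: "ereal r < y" "f (0, 0) < r" by auto
    define \<epsilon> where "\<epsilon> = (r - f (0, 0)) / 2"
    have \<epsilon>: "0 < \<epsilon>" "r = f (0, 0) + \<epsilon> + \<epsilon>" using r by (auto simp: \<epsilon>_def)
    obtain A where A: "0 < A" "\<And>z. z \<in> ?T \<Longrightarrow> upper_Perron p ?T f z \<le> ereal (f (0, 0) + \<epsilon> + A * barrier \<alpha> \<gamma> \<theta> z)"
      using bounds[OF f \<epsilon>(1)] by blast
    show "\<forall>\<^sub>F z in at (0, 0) within ?T. upper_Perron p ?T f z < y"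
      using small[OF A(1) \<epsilon>(1)]
    proof eventually_elim
      fix z assume z: "z \<in> ?T \<and> A * barrier \<alpha> \<gamma> \<theta> z < \<epsilon>"
      then have "upper_Perron p ?T f z \<le> ereal (f (0, 0) + \<epsilon> + A * barrier \<alpha> \<gamma> \<theta> z)" using A(2) by blast
      also have "\<dots> \<le> ereal r" using z \<epsilon>(2) by simp
      finally show "upper_Perron p ?T f z < y" using r(1) by (rule le_less_trans)
    qed
  qed
  then show ?thesis using zero by (simp add: regular_point_def)
qed

end
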